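(* Let $\mu$ and $\nu$ be two probability measures in $\mathcal{P}_1(\mathbf{R})$. The excursion coupling $\pi\in\mathrm{Marg}(\mu,\nu)$ of $\mu$ and $\nu$ satisfies the two following statements. (1') For every sequence $(\pi_n,p_n)_{n\in\mathbf{N}}$ with $p_n\in\,]0,1[$, $p_n\to1$ and $\pi_n\in\mathrm{Marg}^*_{p_n}(\mu,\nu)$ for every $n$, it holds $\pi_n\to\pi$ weakly. (2') For every $q'\in\,]0,1[$, the map $\gamma\in\mathrm{Marg}_1^*(\mu,\nu)\mapsto\iint|y-x|^{q'}\,\mathrm{d}\gamma(x,y)$ is minimized by $\pi$.
   Context: $\mathcal{P}_1(\mathbf{R})$ is the set of Borel probability measures on $\mathbf{R}$ with finite first moment. $\mathrm{Marg}(\mu,\nu)$ is the set of Borel probability measures on $\mathbf{R}\times\mathbf{R}$ with first marginal $\mu$ and second marginal $\nu$, with the topology of weak convergence. For $p>0$, $T_p(\pi)=\iint|x-y|^p\,\mathrm{d}\pi(x,y)$, and $\mathrm{Marg}_p^*(\mu,\nu)$ is the set of minimizers of $T_p$ on $\mathrm{Marg}(\mu,\nu)$. **Generalized graph.** For probability measures $\mu,\nu$ on $\mathbf{R}$ put $\sigma=\mu-\nu$ and $F_\sigma(x)=\sigma(]-\infty,x])$, a càdlàg function. Let $F_\sigma(x^-)$ be its left limit at $x$. The multivalued map $F^*_\sigma$ is $F_\sigma^*(x)=[F_\sigma(x^-),F_\sigma(x)]$ (interval between the two values, in whichever order) at discontinuity points and $F^*_\sigma(x)=\{F_\sigma(x)\}$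 at continuity points; $\mathrm{Graph}^*(F_\sigma)=\{(x,h)\in\mathbf{R}^2: h\in F^*_\sigma(x)\}$. $\mathrm{Graph}^{*,+}(F_\sigma)$ (resp. $\mathrm{Graph}^{*,-}(F_\sigma)$) is the set of $(x,h)\in\mathrm{Graph}^*(F_\sigma)$ for which there is a neighborhood $U_x$ of $x$ such that every $(x',h')\in\mathrm{Graph}^*(F_\sigma)$ with $x'\in U_x\setminus\{x\}$ satisfies $(h'-h)(x'-x)>0$ (resp. $<0$). **Excursion coupling.** (i) If $\mu\perp\nu$: let $i^\pm(h)=\mathrm{card}[(\mathbf{R}\times\{h\})\cap\mathrm{Graph}^{*,+}(F_\sigma)]+\mathrm{card}[(\mathbf{R}\times\{h\})\cap\mathrm{Graph}^{*,-}(F_\sigma)]$ and let $\theta$ be the measure on $\mathbf{R}$ with density $i^\pm$ with respect to Lebesgue measure. Let $H$ be a random variable with law $\theta/2$, let $N=i^\pm(H)$ (almost surely finite and even), and write $(\mathbf{R}\times\{H\})\cap\mathrm{Graph}^*(F_\sigma)=\{x_1,\dots,x_N\}\times\{H\}$ with $x_1<\dots<x_N$. Conditionally on $H$, if $H>0$ the vector $(X,Y)$ is uniform on $\{(x_1,x_2),(x_3,x_4),\dots,(x_{N-1},x_N)\}$, and if $H<0$ it is uniform on $\{(x_2,x_1),(x_4,x_3),\dots,(x_N,x_{N-1})\}$. The excursion coupling is the law of $(X,Y)$ (it belongs to $\mathrm{Marg}(\mu,\nu)$). (ii) In general, write $\mu=\eta+\mu_0$, $\nu=\eta+\nu_0$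 with $\eta=\mu\wedge\nu$ and $\mu_0\perp\nu_0$ positive measures. The excursion coupling is $(\mathrm{id}\times\mathrm{id})_\#\eta+\mu_0(\mathbf{R})\,\pi_0$, where $\pi_0$ is the excursion coupling from (i) of $\mu_0(\mathbf{R})^{-1}\mu_0$ and $\nu_0(\mathbf{R})^{-1}\nu_0$ (the second term is absent if $\mu_0=0$). *)

theory Defs
  imports "HOL-Probability.Probability"
begin

definition P1 :: "real measure set" where
  "P1 = {\<mu>. prob_space \<mu> \<and> sets \<mu> = sets borel \<and> integrable \<mu> (\<lambda>x. x)}"

definition Marg :: "real measure \<Rightarrow> real measure \<Rightarrow> (real \<times> real) measure set" where
  "Marg \<mu> \<nu> = {\<pi>. prob_space \<pi> \<and> sets \<pi> = sets borel
                   \<and> distr \<pi> borel fst = \<mu> \<and> distr \<pi> borel snd = \<nu>}"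

text \<open>The cost takes values in \<open>[0,\<infinity>]\<close>.\<close>

definition T_cost :: "real \<Rightarrow> (real \<times> real) measure \<Rightarrow> ennreal" where
  "T_cost p \<pi> = (\<integral>\<^sup>+ (x, y). ennreal (\<bar>x - y\<bar> powr p) \<partial>\<pi>)"

definition Marg_opt :: "real \<Rightarrow> real measure \<Rightarrow> real measure \<Rightarrow> (real \<times> real) measure set" where
  "Marg_opt p \<mu> \<nu> = {\<pi> \<in> Marg \<mu> \<nu>. \<forall>\<pi>' \<in> Marg \<mu> \<nu>. T_cost p \<pi> \<le> T_cost p \<pi>'}"

text \<open>Weak convergence of finite Borel measures, tested against bounded continuous functions;
  the library's \<open>weak_conv_m\<close> only covers measures on the real line.\<close>

definition weakly_converges ::
    "(nat \<Rightarrow> 'a::topological_space measure) \<Rightarrow> 'a measure \<Rightarrow> bool" where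
  "weakly_converges M_seq M \<longleftrightarrow>
     (\<forall>f :: 'a \<Rightarrow> real. continuous_on UNIV f \<and> bounded (range f) \<longrightarrow>
        (\<lambda>n. integral\<^sup>L (M_seq n) f) \<longlonglongrightarrow> integral\<^sup>L M f)"

definition F_diff :: "real measure \<Rightarrow> real measure \<Rightarrow> real \<Rightarrow> real" where
  "F_diff \<mu> \<nu> x = cdf \<mu> x - cdf \<nu> x"

text \<open>The notions below are meant for cadlag \<open>F\<close>, so that the left limit exists.
  A \<open>closed_segment\<close> does not depend on the order of its endpoints.\<close>

definition F_star :: "(real \<Rightarrow> real) \<Rightarrow> real \<Rightarrow> real set" where
  "F_star F x = (if isCont F x then {F x} else closed_segment (Lim (at_left x) F) (F x))"

definition Graph_star :: "(real \<Rightarrow> real) \<Rightarrow> (real \<times> real) set" where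
  "Graph_star F = {(x, h). h \<in> F_star F x}"

definition Graph_star_plus :: "(real \<Rightarrow> real) \<Rightarrow> (real \<times> real) set" where
  "Graph_star_plus F = {(x, h) \<in> Graph_star F. \<exists>U. open U \<and> x \<in> U \<and>
     (\<forall>(x', h') \<in> Graph_star F. x' \<in> U - {x} \<longrightarrow> (h' - h) * (x' - x) > 0)}"

definition Graph_star_minus :: "(real \<Rightarrow> real) \<Rightarrow> (real \<times> real) set" where
  "Graph_star_minus F = {(x, h) \<in> Graph_star F. \<exists>U. open U \<and> x \<in> U \<and>
     (\<forall>(x', h') \<in> Graph_star F. x' \<in> U - {x} \<longrightarrow> (h' - h) * (x' - x) < 0)}"

text \<open>Cardinalities are taken in \<open>[0,\<infinity>]\<close> through the counting measure,
  since \<open>card\<close> would assign 0 to an infinite set.\<close>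

definition i_pm :: "(real \<Rightarrow> real) \<Rightarrow> real \<Rightarrow> ennreal" where
  "i_pm F h = emeasure (count_space UNIV) ((UNIV \<times> {h}) \<inter> Graph_star_plus F)
            + emeasure (count_space UNIV) ((UNIV \<times> {h}) \<inter> Graph_star_minus F)"

definition theta :: "(real \<Rightarrow> real) \<Rightarrow> real measure" where
  "theta F = density lborel (i_pm F)"

definition level_set :: "(real \<Rightarrow> real) \<Rightarrow> real \<Rightarrow> real set" where
  "level_set F h = {x. (x, h) \<in> Graph_star F}"

text \<open>The list \<open>xs\<close> is 0-based: \<open>xs ! 0 = x\<^sub>1\<close>, \<open>xs ! 1 = x\<^sub>2\<close>, and so on.\<close>

definition excursion_pairs :: "(real \<Rightarrow> real) \<Rightarrow> real \<Rightarrow> (real \<times> real) set" where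
  "excursion_pairs F h = (let xs = sorted_list_of_set (level_set F h) in
     if h > 0 then {(xs ! (2 * k), xs ! (2 * k + 1)) | k. 2 * k + 1 < length xs}
     else {(xs ! (2 * k + 1), xs ! (2 * k)) | k. 2 * k + 1 < length xs})"

text \<open>The levels at which the description of the conditional law makes sense. For the
  \<open>F\<close> used below, almost every level with respect to \<open>theta F\<close> is of this kind.\<close>

definition regular_level :: "(real \<Rightarrow> real) \<Rightarrow> real \<Rightarrow> bool" where
  "regular_level F h \<longleftrightarrow> h \<noteq> 0 \<and> finite (level_set F h) \<and> level_set F h \<noteq> {}
     \<and> even (card (level_set F h)) \<and> of_nat (card (level_set F h)) = i_pm F h"

text \<open>The conditional law of \<open>(X, Y)\<close> given \<open>H = h\<close>. The value at the non-regular levels is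
  arbitrary; a Dirac mass is used so that it is a Borel probability measure at every level.\<close>

definition excursion_kernel :: "(real \<Rightarrow> real) \<Rightarrow> real \<Rightarrow> (real \<times> real) measure" where
  "excursion_kernel F h =
     (if regular_level F h
      then distr (measure_pmf (pmf_of_set (excursion_pairs F h))) borel (\<lambda>z. z)
      else return borel (0, 0))"

text \<open>The coupling of two mutually singular probability measures: \<open>H\<close> is drawn with law
  \<open>theta / 2\<close>, then \<open>(X, Y)\<close> with the conditional law given \<open>H\<close>.\<close>

definition excursion_coupling_singular ::
    "real measure \<Rightarrow> real measure \<Rightarrow> (real \<times> real) measure" where
  "excursion_coupling_singular \<mu> \<nu> =
     (let F = F_diff \<mu> \<nu> in scale_measure (1 / 2) (theta F) \<bind> excursion_kernel F)"

definition add_measure :: "'a measure \<Rightarrow> 'a measure \<Rightarrow> 'a measure" where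
  "add_measure M N = measure_of (space M) (sets M) (\<lambda>A. emeasure M A + emeasure N A)"

text \<open>On measures with the same \<open>\<sigma>\<close>-algebra, \<open>inf\<close> is the infimum for the setwise order,
  that is \<open>\<mu> \<and> \<nu>\<close>. The remainders \<open>\<mu> - \<eta>\<close> and \<open>\<nu> - \<eta>\<close> are then mutually singular.\<close>

definition excursion_coupling ::
    "real measure \<Rightarrow> real measure \<Rightarrow> (real \<times> real) measure" where
  "excursion_coupling \<mu> \<nu> =
     (let \<eta> = inf \<mu> \<nu>;
          \<mu>\<^sub>0 = diff_measure \<mu> \<eta>;
          \<nu>\<^sub>0 = diff_measure \<nu> \<eta>;
          m = emeasure \<mu>\<^sub>0 UNIV;
          diag = distr \<eta> borel (\<lambda>x. (x, x))
      in if m = 0 then diag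
         else add_measure diag (scale_measure m
                (excursion_coupling_singular (scale_measure (1 / m) \<mu>\<^sub>0) (scale_measure (1 / m) \<nu>\<^sub>0))))"

end

theory Submission
  imports Defs
begin

text \<open>
  Let \<open>X\<close>, \<open>Y\<close> be the coordinates of a plan \<open>\<gamma>\<close> and let \<open>F\<close> be the difference of the two distribution
  functions. For \<open>a \<le> b\<close> the number \<open>flow \<gamma> a b = \<gamma>(X \<le> a, b < Y)\<close> is the mass that jumps over
  \<open>[a, b]\<close> to the right; the flow of the transposed plan is the mass that jumps to the left. At a
  single point \<open>u\<close> the two flows differ by \<open>F u\<close>, so they are \<open>F\<^sup>+ + r\<close> and \<open>F\<^sup>- + r\<close> with an excess
  \<open>r \<ge> 0\<close>, and by Tonelli \<open>T_cost 1 \<gamma>\<close> is \<open>\<integral>\<bar>F\<bar> + 2 \<integral>r\<close>. The plans that are optimal for the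
  distance are therefore those without excess. A flow over \<open>[a, b]\<close> is at most the flow at each point
  of \<open>[a, b]\<close>; a plan without excess thus has flow at most \<open>inf F\<^sup>+\<close> over \<open>[a, b]\<close>.

  The excursion coupling attains this bound on every interval, in both directions: at a level
  \<open>h > 0\<close> the interval \<open>[a, b]\<close> lies inside one of the pairs \<open>(x\<^sub>1, x\<^sub>2), (x\<^sub>3, x\<^sub>4), \<dots>\<close> exactly when
  \<open>F > h\<close> on it, up to countably many \<open>h\<close>, so the flow over \<open>[a, b]\<close> is the Lebesgue measure of the
  levels between \<open>0\<close> and \<open>inf F\<close>. This property, called \<open>maximal_flow\<close>, implies both claims.

  For the secondary costs, \<open>d powr q\<close> is a mixture over \<open>t > 0\<close> of the functions
  \<open>min d t = d - (d - t)\<^sup>+\<close>. Among the plans that are optimal for the distance, the integral of \<open>d\<close> is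
  constant and that of \<open>(d - t)\<^sup>+\<close>, which is the integral over \<open>s\<close> of the flows over \<open>[s, s + t]\<close>, is
  largest for the plan with maximal flow (\<open>maximal_flow_imp_optimal\<close>).

  For the limit \<open>p \<rightarrow> 1\<close>, strict concavity forbids two jumps \<open>x \<rightarrow> y\<close> and \<open>x' \<rightarrow> y'\<close> with
  \<open>x < x' \<le> y < y'\<close>, since exchanging their targets is cheaper (\<open>Marg_opt_noncrossing\<close>). In a plan
  without such crossings the flow over \<open>[a, b]\<close> is not smaller than the infimum of the pointwise flows
  (\<open>noncrossing_le_flow\<close>), hence not smaller than \<open>inf F\<^sup>+\<close>. As \<open>p \<rightarrow> 1\<close> the excess vanishes, so the flows
  over all intervals converge to the maximal ones. Together with the marginals these flows determine
  the joint distribution functions, which converge at every point (\<open>maximal_flow_imp_weak_limit\<close>).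

  The remaining work is on the coupling itself. Off countably many levels, every point of a finite
  level set is a crossing of the completed graph, and the crossings alternate; this is where the parity
  in the definition comes from. The number of points at level \<open>h\<close> is a Borel function of \<open>h\<close> with
  integral at most \<open>2\<close> (half of Banach's indicatrix theorem). The flows give the difference of the two
  marginals of the coupling, which is \<open>\<mu> - \<nu>\<close>; since \<open>\<mu> \<bottom> \<nu>\<close>, the minimality of the Jordan
  decomposition and the bound on the total mass identify the marginals themselves
  (\<open>excursion_coupling_singular_marginals\<close>). The common part of \<open>\<mu>\<close> and \<open>\<nu>\<close> stays on the diagonal
  and does not contribute to any flow.
\<close>

section \<open>Plans, marginals and flows\<close>

definition transpose_plan :: "(real \<times> real) measure \<Rightarrow> (real \<times> real) measure" where
  "transpose_plan \<gamma> = distr \<gamma> borel prod.swap"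

text \<open>
  For \<open>a \<le> b\<close> these are the jumps over \<open>[a, b]\<close> to the right.
\<close>

definition flow :: "(real \<times> real) measure \<Rightarrow> real \<Rightarrow> real \<Rightarrow> real" where
  "flow \<gamma> a b = measure \<gamma> ({..a} \<times> {b<..})"

text \<open>
  The mass that passes over \<open>u\<close> in one direction and is compensated by mass in the other one.
\<close>

definition excess :: "(real \<times> real) measure \<Rightarrow> real \<Rightarrow> real" where
  "excess \<gamma> u = min (flow \<gamma> u u) (flow (transpose_plan \<gamma>) u u)"

lemma Marg_prob_space: "\<gamma> \<in> Marg \<mu> \<nu> \<Longrightarrow> prob_space \<gamma>"
  and Marg_sets: "\<gamma> \<in> Marg \<mu> \<nu> \<Longrightarrow> sets \<gamma> = sets borel"
  and Marg_distr_fst: "\<gamma> \<in> Marg \<mu> \<nu> \<Longrightarrow> distr \<gamma> borel fst = \<mu>"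
  and Marg_distr_snd: "\<gamma> \<in> Marg \<mu> \<nu> \<Longrightarrow> distr \<gamma> borel snd = \<nu>"
  by (auto simp: Marg_def)

lemma Marg_space: "\<gamma> \<in> Marg \<mu> \<nu> \<Longrightarrow> space \<gamma> = UNIV"
  using sets_eq_imp_space_eq[OF Marg_sets] by simp

lemma borel_Times [measurable]:
  "A \<in> sets borel \<Longrightarrow> B \<in> sets borel \<Longrightarrow> A \<times> B \<in> sets (borel :: (real \<times> real) measure)"
  unfolding borel_prod[symmetric] by (rule pair_measureI)

lemma measurable_fst_snd_borel [measurable]:
  "fst \<in> borel_measurable (borel :: (real \<times> real) measure)"
  "snd \<in> borel_measurable (borel :: (real \<times> real) measure)"
  by (simp_all add: borel_prod[symmetric])

lemma measurable_swap_borel [measurable]: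
  "prod.swap \<in> borel \<rightarrow>\<^sub>M (borel :: (real \<times> real) measure)"
proof -
  have eq: "prod.swap = (\<lambda>z :: real \<times> real. (snd z, fst z))" by auto
  show ?thesis
    unfolding borel_prod[symmetric] eq by measurable
qed

lemma measurable_fst_snd_sets_borel:
  assumes "sets (\<gamma> :: (real \<times> real) measure) = sets borel"
  shows "fst \<in> borel_measurable \<gamma>" "snd \<in> borel_measurable \<gamma>" "prod.swap \<in> \<gamma> \<rightarrow>\<^sub>M borel"
  by (simp_all add: measurable_cong_sets[OF assms refl])

lemma emeasure_distr_fst_snd:
  assumes s: "sets \<gamma> = sets borel" and A: "A \<in> sets borel"
  shows "emeasure (distr \<gamma> borel fst) A = emeasure \<gamma> (A \<times> (UNIV :: real set))"
    and "emeasure (distr \<gamma> borel snd) A = emeasure \<gamma> ((UNIV :: real set) \<times> A)"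
proof -
  have "fst -` A \<inter> space \<gamma> = A \<times> UNIV" "snd -` A \<inter> space \<gamma> = UNIV \<times> A"
    using sets_eq_imp_space_eq[OF s] by auto
  then show "emeasure (distr \<gamma> borel fst) A = emeasure \<gamma> (A \<times> (UNIV :: real set))"
    "emeasure (distr \<gamma> borel snd) A = emeasure \<gamma> ((UNIV :: real set) \<times> A)"
    using emeasure_distr[OF measurable_fst_snd_sets_borel(1)[OF s] A]
      emeasure_distr[OF measurable_fst_snd_sets_borel(2)[OF s] A] by simp_all
qed

lemma Marg_emeasure_fst:
  "\<gamma> \<in> Marg \<mu> \<nu> \<Longrightarrow> A \<in> sets borel \<Longrightarrow> emeasure \<gamma> (A \<times> UNIV) = emeasure \<mu> A"
  using emeasure_distr_fst_snd(1)[OF Marg_sets] Marg_distr_fst by metis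

lemma Marg_emeasure_snd:
  "\<gamma> \<in> Marg \<mu> \<nu> \<Longrightarrow> A \<in> sets borel \<Longrightarrow> emeasure \<gamma> (UNIV \<times> A) = emeasure \<nu> A"
  using emeasure_distr_fst_snd(2)[OF Marg_sets] Marg_distr_snd by metis

lemma MargI:
  assumes "sets \<gamma> = sets borel" "sets \<mu> = sets borel" "sets \<nu> = sets borel" "prob_space \<mu>"
    and "\<And>A. A \<in> sets borel \<Longrightarrow> emeasure \<gamma> (A \<times> UNIV) = emeasure \<mu> A"
    and "\<And>A. A \<in> sets borel \<Longrightarrow> emeasure \<gamma> (UNIV \<times> A) = emeasure \<nu> A"
  shows "\<gamma> \<in> Marg \<mu> \<nu>"
proof -
  have sp: "space \<gamma> = UNIV" "space \<mu> = UNIV"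
    using sets_eq_imp_space_eq[OF assms(1)] sets_eq_imp_space_eq[OF assms(2)] by simp_all
  have "prob_space \<gamma>"
    by (rule prob_spaceI) (use assms(5)[of UNIV] sp prob_space.emeasure_space_1[OF assms(4)] in simp)
  moreover have "distr \<gamma> borel fst = \<mu>" "distr \<gamma> borel snd = \<nu>"
    using assms(2,3) emeasure_distr_fst_snd[OF assms(1)] assms(5,6) by (auto intro!: measure_eqI)
  ultimately show ?thesis using assms(1) by (simp add: Marg_def)
qed

lemma emeasure_transpose_plan:
  assumes "sets \<gamma> = sets borel" "A \<in> sets borel" "B \<in> sets borel"
  shows "emeasure (transpose_plan \<gamma>) (A \<times> B) = emeasure \<gamma> (B \<times> A)"
proof -
  have [measurable_cong]: "sets \<gamma> = sets borel" by fact
  have "emeasure (transpose_plan \<gamma>) (A \<times> B) = emeasure \<gamma> (prod.swap -` (A \<times> B) \<inter> space \<gamma>)"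
    unfolding transpose_plan_def 
    using assms by (intro emeasure_distr measurable_fst_snd_sets_borel borel_Times)
  also have "prod.swap -` (A \<times> B) \<inter> space \<gamma> = B \<times> A"
    using sets_eq_imp_space_eq[OF assms(1)] by auto
  finally show ?thesis .
qed

lemma flow_transpose_plan:
  "sets \<gamma> = sets borel \<Longrightarrow> flow (transpose_plan \<gamma>) a b = measure \<gamma> ({b<..} \<times> {..a})"
  unfolding flow_def measure_def by (simp add: emeasure_transpose_plan)

lemma sets_transpose_plan [simp]: "sets (transpose_plan \<gamma>) = sets borel"
  by (simp add: transpose_plan_def)

lemma transpose_transpose_plan:
  assumes "sets \<gamma> = sets borel"
  shows "transpose_plan (transpose_plan \<gamma>) = \<gamma>"
proof -
  have [measurable_cong]: "sets \<gamma> = sets borel" by fact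
  have "transpose_plan (transpose_plan \<gamma>) = distr \<gamma> borel (prod.swap \<circ> prod.swap)"
    unfolding transpose_plan_def by (intro distr_distr) measurable
  also have "\<dots> = distr \<gamma> \<gamma> id"
    by (rule distr_cong) (auto simp: assms)
  finally show ?thesis by (simp add: id_def)
qed

lemma transpose_plan_Marg:
  assumes "\<gamma> \<in> Marg \<mu> \<nu>"
  shows "transpose_plan \<gamma> \<in> Marg \<nu> \<mu>"
proof (rule MargI)
  interpret prob_space \<gamma> using assms by (rule Marg_prob_space)
  have [measurable_cong]: "sets \<gamma> = sets borel" using assms by (rule Marg_sets)
  show "sets \<nu> = sets borel" "sets \<mu> = sets borel"
    using Marg_distr_fst[OF assms] Marg_distr_snd[OF assms] by (metis sets_distr)+
  have "prob_space (distr \<gamma> borel snd)" by (rule prob_space_distr) measurable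
  then show "prob_space \<nu>" using Marg_distr_snd[OF assms] by simp
qed (use Marg_emeasure_fst[OF assms] Marg_emeasure_snd[OF assms] emeasure_transpose_plan Marg_sets[OF assms] in auto)

lemma T_cost_transpose_plan:
  assumes "sets \<gamma> = sets borel"
  shows "T_cost p (transpose_plan \<gamma>) = T_cost p \<gamma>"
proof -
  have [measurable_cong]: "sets \<gamma> = sets borel" by fact
  have "T_cost p (transpose_plan \<gamma>)
      = (\<integral>\<^sup>+ z. (case prod.swap z of (x, y) \<Rightarrow> ennreal (\<bar>x - y\<bar> powr p)) \<partial>\<gamma>)"
    unfolding T_cost_def transpose_plan_def by (rule nn_integral_distr) measurable
  also have "\<dots> = T_cost p \<gamma>"
    unfolding T_cost_def by (intro nn_integral_cong) (auto simp: abs_minus_commute split: prod.splits)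
  finally show ?thesis .
qed

lemma transpose_plan_Marg_opt:
  assumes "\<gamma> \<in> Marg_opt p \<mu> \<nu>"
  shows "transpose_plan \<gamma> \<in> Marg_opt p \<nu> \<mu>"
proof -
  have \<gamma>: "\<gamma> \<in> Marg \<mu> \<nu>" and opt: "\<And>\<pi>. \<pi> \<in> Marg \<mu> \<nu> \<Longrightarrow> T_cost p \<gamma> \<le> T_cost p \<pi>"
    using assms by (auto simp: Marg_opt_def)
  have "T_cost p (transpose_plan \<gamma>) \<le> T_cost p \<pi>" if "\<pi> \<in> Marg \<nu> \<mu>" for \<pi>
    using opt[OF transpose_plan_Marg[OF that]] T_cost_transpose_plan[OF Marg_sets[OF that], of p]
      T_cost_transpose_plan[OF Marg_sets[OF \<gamma>], of p] by simp
  then show ?thesis using transpose_plan_Marg[OF \<gamma>] by (simp add: Marg_opt_def)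
qed

lemma Marg_measure_fst:
  "\<gamma> \<in> Marg \<mu> \<nu> \<Longrightarrow> A \<in> sets borel \<Longrightarrow> measure \<gamma> (A \<times> UNIV) = measure \<mu> A"
  and Marg_measure_snd:
  "\<gamma> \<in> Marg \<mu> \<nu> \<Longrightarrow> A \<in> sets borel \<Longrightarrow> measure \<gamma> (UNIV \<times> A) = measure \<nu> A"
  by (simp_all add: measure_def Marg_emeasure_fst Marg_emeasure_snd)

context
  fixes \<gamma> \<mu> \<nu>
  assumes \<gamma>: "\<gamma> \<in> Marg \<mu> \<nu>"
begin

interpretation prob_space \<gamma> using \<gamma> by (rule Marg_prob_space)

lemma Marg_sets_Times: "A \<in> sets borel \<Longrightarrow> B \<in> sets borel \<Longrightarrow> A \<times> B \<in> sets \<gamma>"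
  using Marg_sets[OF \<gamma>] borel_Times by simp

lemma flow_eq_cdf_minus: "flow \<gamma> a b = cdf \<mu> a - measure \<gamma> ({..a} \<times> {..b})"
proof -
  have "measure \<gamma> ({..a} \<times> UNIV) = measure \<gamma> ({..a} \<times> {..b}) + measure \<gamma> ({..a} \<times> {b<..})"
    by (subst finite_measure_Union[symmetric])
      (auto intro!: Marg_sets_Times arg_cong[where f="measure \<gamma>"])
  then show ?thesis
    by (simp add: flow_def cdf_def Marg_measure_fst[OF \<gamma>])
qed

lemma flow_nonneg: "0 \<le> flow \<gamma> a b"
  by (simp add: flow_def)

lemma flow_mono: "a \<le> a' \<Longrightarrow> b' \<le> b \<Longrightarrow> flow \<gamma> a b \<le> flow \<gamma> a' b'"
  unfolding flow_def by (intro finite_measure_mono Marg_sets_Times) auto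

text \<open>
  A jump over \<open>u\<close> that does not pass over \<open>v\<close> ends in \<open>]u, v]\<close>. This one-sided continuity of the
  flow is uniform over all plans with the same marginals.
\<close>

lemma flow_le_add: 
  assumes "u \<le> v"
  shows "flow \<gamma> u u \<le> flow \<gamma> v v + measure \<nu> {u<..v}"
proof -
  have "flow \<gamma> u u \<le> measure \<gamma> (({..v} \<times> {v<..}) \<union> (UNIV \<times> {u<..v}))"
    unfolding flow_def using assms
    by (intro finite_measure_mono) (auto intro!: sets.Un Marg_sets_Times)
  also have "\<dots> \<le> flow \<gamma> v v + measure \<gamma> (UNIV \<times> {u<..v})"
    unfolding flow_def by (intro measure_Un_le Marg_sets_Times) auto
  finally show ?thesis by (simp add: Marg_measure_snd[OF \<gamma>])
qed

end

lemma flow_minus_flow_transpose: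
  assumes \<gamma>: "\<gamma> \<in> Marg \<mu> \<nu>"
  shows "flow \<gamma> u u - flow (transpose_plan \<gamma>) u u = F_diff \<mu> \<nu> u"
proof -
  have "measure (transpose_plan \<gamma>) ({..u} \<times> {..u}) = measure \<gamma> ({..u} \<times> {..u})"
    using Marg_sets[OF \<gamma>] by (simp add: measure_def emeasure_transpose_plan)
  then show ?thesis
    using flow_eq_cdf_minus[OF \<gamma>, of u u] flow_eq_cdf_minus[OF transpose_plan_Marg[OF \<gamma>], of u u]
    by (simp add: F_diff_def)
qed

lemma F_diff_commute: "F_diff \<nu> \<mu> u = - F_diff \<mu> \<nu> u"
  by (simp add: F_diff_def)

lemma flow_eq_excess:
  assumes \<gamma>: "\<gamma> \<in> Marg \<mu> \<nu>"
  shows "flow \<gamma> u u = max 0 (F_diff \<mu> \<nu> u) + excess \<gamma> u"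
    and "flow (transpose_plan \<gamma>) u u = max 0 (- F_diff \<mu> \<nu> u) + excess \<gamma> u"
  using flow_minus_flow_transpose[OF \<gamma>, of u] by (auto simp: excess_def)

lemma excess_transpose: "sets \<gamma> = sets borel \<Longrightarrow> excess (transpose_plan \<gamma>) u = excess \<gamma> u"
  by (simp add: excess_def transpose_transpose_plan min.commute)

lemma excess_nonneg: "\<gamma> \<in> Marg \<mu> \<nu> \<Longrightarrow> 0 \<le> excess \<gamma> u"
  using flow_nonneg flow_nonneg[OF transpose_plan_Marg] by (auto simp: excess_def)

lemma borel_measurable_flow_shift [measurable]:
  assumes \<gamma>: "\<gamma> \<in> Marg \<mu> \<nu>"
  shows "(\<lambda>s. flow \<gamma> s (s + t)) \<in> borel_measurable borel"
proof -
  interpret prob_space \<gamma> using \<gamma> by (rule Marg_prob_space)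
  have "mono (\<lambda>s. measure \<gamma> ({..s} \<times> {..s + t}))"
    by (intro monoI finite_measure_mono Marg_sets_Times[OF \<gamma>]) auto
  moreover have "mono (\<lambda>s. cdf \<mu> s)"
    unfolding cdf_def by (intro monoI, subst (1 2) Marg_measure_fst[OF \<gamma>, symmetric])
      (auto intro!: finite_measure_mono Marg_sets_Times[OF \<gamma>])
  ultimately show ?thesis
    unfolding flow_eq_cdf_minus[OF \<gamma>] by (intro borel_measurable_diff borel_measurable_mono)
qed

text \<open>
  By Tonelli: a jump from \<open>x\<close> to \<open>y\<close> passes over \<open>[s, s + t]\<close> for a set of \<open>s\<close> of length
  \<open>(\<bar>x - y\<bar> - t)\<^sup>+\<close>.
\<close>

lemma nn_integral_excess_over_length:
  assumes \<gamma>: "\<gamma> \<in> Marg \<mu> \<nu>" and t: "0 \<le> t"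
  shows "(\<integral>\<^sup>+ (x, y). ennreal (\<bar>x - y\<bar> - t) \<partial>\<gamma>)
    = (\<integral>\<^sup>+ s. ennreal (flow \<gamma> s (s + t) + flow (transpose_plan \<gamma>) s (s + t)) \<partial>lborel)"
proof -
  interpret prob_space \<gamma> using \<gamma> by (rule Marg_prob_space)
  have s\<gamma>[measurable_cong]: "sets \<gamma> = sets borel" using \<gamma> by (rule Marg_sets)
  interpret P: pair_sigma_finite lborel \<gamma> ..
  let ?ind = "\<lambda>s x y. (indicator {z. fst z \<le> s \<and> s + t < snd z} (x, y)
       + indicator {z. snd z \<le> s \<and> s + t < fst z} (x, y) :: ennreal)"
  have len: "(\<integral>\<^sup>+ s. ?ind s x y \<partial>lborel) = ennreal (\<bar>x - y\<bar> - t)" for x y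
  proof -
    have "(\<integral>\<^sup>+ s. ?ind s x y \<partial>lborel)
      = (\<integral>\<^sup>+ s. indicator {x..<y - t} s + indicator {y..<x - t} s \<partial>lborel)"
      by (intro nn_integral_cong) (auto simp: indicator_def)
    also have "\<dots> = emeasure lborel {x..<y - t} + emeasure lborel {y..<x - t}"
      by (subst nn_integral_add) auto
    also have "\<dots> = ennreal (\<bar>x - y\<bar> - t)"
      using t by (cases "x \<le> y - t"; cases "y \<le> x - t") (auto simp: ennreal_neg abs_if)
    finally show ?thesis .
  qed
  have "(\<integral>\<^sup>+ (x, y). ennreal (\<bar>x - y\<bar> - t) \<partial>\<gamma>) = (\<integral>\<^sup>+ z. (\<integral>\<^sup>+ s. ?ind s (fst z) (snd z) \<partial>lborel) \<partial>\<gamma>)"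
    unfolding len by (simp add: split_beta')
  also have "\<dots> = (\<integral>\<^sup>+ s. (\<integral>\<^sup>+ z. ?ind s (fst z) (snd z) \<partial>\<gamma>) \<partial>lborel)"
    by (rule P.Fubini'[where f="\<lambda>s z. ?ind s (fst z) (snd z)"]) measurable
  also have "\<dots> = (\<integral>\<^sup>+ s. ennreal (flow \<gamma> s (s + t) + flow (transpose_plan \<gamma>) s (s + t)) \<partial>lborel)"
  proof (rule nn_integral_cong)
    fix s
    have 1: "{z. fst z \<le> s \<and> s + t < snd z} = {..s} \<times> {s + t<..}"
      and 2: "{z. snd z \<le> s \<and> s + t < fst z} = {s + t<..} \<times> {..s}" by auto
    have "(\<integral>\<^sup>+ z. ?ind s (fst z) (snd z) \<partial>\<gamma>) = emeasure \<gamma> ({..s} \<times> {s + t<..}) + emeasure \<gamma> ({s + t<..} \<times> {..s})"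
      unfolding 1 2 prod.collapse by (subst nn_integral_add) (auto intro!: Marg_sets_Times[OF \<gamma>])
    then show "(\<integral>\<^sup>+ z. ?ind s (fst z) (snd z) \<partial>\<gamma>) = ennreal (flow \<gamma> s (s + t) + flow (transpose_plan \<gamma>) s (s + t))"
      unfolding flow_transpose_plan[OF s\<gamma>] unfolding flow_def by (simp add: emeasure_eq_measure)
  qed
  finally show ?thesis .
qed

lemma T_cost_1_eq:
  assumes \<gamma>: "\<gamma> \<in> Marg \<mu> \<nu>"
  shows "T_cost 1 \<gamma> = (\<integral>\<^sup>+ u. ennreal \<bar>F_diff \<mu> \<nu> u\<bar> \<partial>lborel) + 2 * (\<integral>\<^sup>+ u. ennreal (excess \<gamma> u) \<partial>lborel)"
proof -
  have [measurable]: "(\<lambda>u. flow \<gamma> u u) \<in> borel_measurable borel"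
      "(\<lambda>u. flow (transpose_plan \<gamma>) u u) \<in> borel_measurable borel"
    using borel_measurable_flow_shift[OF \<gamma>, of 0]
      borel_measurable_flow_shift[OF transpose_plan_Marg[OF \<gamma>], of 0] by simp_all
  have mF: "F_diff \<mu> \<nu> \<in> borel_measurable borel"
  proof -
    have "F_diff \<mu> \<nu> = (\<lambda>u. flow \<gamma> u u - flow (transpose_plan \<gamma>) u u)"
      using flow_minus_flow_transpose[OF \<gamma>] by auto
    then show ?thesis by simp
  qed
  have mE: "excess \<gamma> \<in> borel_measurable borel"
    unfolding excess_def[abs_def] by measurable
  have "T_cost 1 \<gamma> = (\<integral>\<^sup>+ (x, y). ennreal (\<bar>x - y\<bar> - 0) \<partial>\<gamma>)"
    unfolding T_cost_def by simp
  also have "\<dots> = (\<integral>\<^sup>+ u. ennreal (flow \<gamma> u (u + 0) + flow (transpose_plan \<gamma>) u (u + 0)) \<partial>lborel)"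
    by (rule nn_integral_excess_over_length[OF \<gamma>]) simp
  also have "\<dots> = (\<integral>\<^sup>+ u. ennreal \<bar>F_diff \<mu> \<nu> u\<bar> + 2 * ennreal (excess \<gamma> u) \<partial>lborel)"
  proof (rule nn_integral_cong)
    fix u
    have "2 * ennreal (excess \<gamma> u) = ennreal (2 * excess \<gamma> u)"
      by (simp add: ennreal_mult' )
    then show "ennreal (flow \<gamma> u (u + 0) + flow (transpose_plan \<gamma>) u (u + 0)) = ennreal \<bar>F_diff \<mu> \<nu> u\<bar> + 2 * ennreal (excess \<gamma> u)"
      using excess_nonneg[OF \<gamma>, of u]
      by (simp add: flow_eq_excess[OF \<gamma>] ennreal_plus[symmetric] max_def abs_if del: ennreal_plus)
  qed
  also have "\<dots> = (\<integral>\<^sup>+ u. ennreal \<bar>F_diff \<mu> \<nu> u\<bar> \<partial>lborel) + 2 * (\<integral>\<^sup>+ u. ennreal (excess \<gamma> u) \<partial>lborel)"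
    using mF mE by (subst nn_integral_add) (auto simp: nn_integral_cmult)
  finally show ?thesis .
qed

text \<open>
  The excess drops on \<open>[u, u + \<delta>]\<close> by no more than the marginal masses of that interval, so a
  large value at \<open>u\<close> forces a large integral. This turns convergence in mean of the excess into
  pointwise convergence.
\<close>

lemma excess_le_nn_integral:
  assumes \<gamma>: "\<gamma> \<in> Marg \<mu> \<nu>" and \<delta>: "0 < \<delta>"
  shows "ennreal (\<delta> * (excess \<gamma> u - measure \<mu> {u<..u+\<delta>} - measure \<nu> {u<..u+\<delta>}))
    \<le> (\<integral>\<^sup>+ v. ennreal (excess \<gamma> v) \<partial>lborel)"
proof -
  interpret prob_space \<gamma> using \<gamma> by (rule Marg_prob_space)
  let ?c = "excess \<gamma> u - measure \<mu> {u<..u+\<delta>} - measure \<nu> {u<..u+\<delta>}"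
  have low: "?c \<le> excess \<gamma> v" if "u \<le> v" "v \<le> u + \<delta>" for v
  proof -
    have "measure \<nu> {u<..v} \<le> measure \<nu> {u<..u+\<delta>}" "measure \<mu> {u<..v} \<le> measure \<mu> {u<..u+\<delta>}"
      using that
      by (auto simp: Marg_measure_fst[OF \<gamma>, symmetric] Marg_measure_snd[OF \<gamma>, symmetric]
          intro!: finite_measure_mono Marg_sets_Times[OF \<gamma>])
    then show ?thesis
      using flow_le_add[OF \<gamma> that(1)] flow_le_add[OF transpose_plan_Marg[OF \<gamma>] that(1)]
        measure_nonneg[of \<mu> "{u<..u+\<delta>}"] measure_nonneg[of \<nu> "{u<..u+\<delta>}"]
      unfolding excess_def by linarith
  qed
  have "ennreal (\<delta> * ?c) = ennreal ?c * emeasure lborel {u..u+\<delta>}"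
    using \<delta> by (cases "?c \<ge> 0") (auto simp: ennreal_mult' mult.commute ennreal_neg mult_nonneg_nonpos)
  also have "\<dots> = (\<integral>\<^sup>+ v. ennreal ?c * indicator {u..u+\<delta>} v \<partial>lborel)"
    by (simp add: nn_integral_cmult_indicator)
  also have "\<dots> \<le> (\<integral>\<^sup>+ v. ennreal (excess \<gamma> v) \<partial>lborel)"
    using low by (intro nn_integral_mono) (auto simp: indicator_def intro!: ennreal_leI)
  finally show ?thesis .
qed

section \<open>Optimal plans for concave costs do not cross\<close>

text \<open>
  The increments of the strictly concave function \<open>t \<mapsto> t\<^sup>p\<close> over intervals of length \<open>c\<close>
  decrease strictly. The case \<open>b = 0\<close> is strict subadditivity.
\<close>

lemma powr_sum_less_swap:
  fixes a b c p :: real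
  assumes p: "0 < p" "p < 1" and "0 < a" "0 \<le> b" "0 < c"
  shows "(a + b + c) powr p + b powr p < (a + b) powr p + (b + c) powr p"
proof -
  define f where "f t = (t + c) powr p - t powr p" for t
  have "f (a + b) < f b"
  proof (rule DERIV_neg_imp_decreasing_open[where f = f and a = b and b = "a + b"])
    show "b < a + b" using assms by simp
    fix t assume t: "b < t" "t < a + b"
    have "(f has_real_derivative (p * (t + c) powr (p - 1) - p * t powr (p - 1))) (at t)"
      unfolding f_def using t assms by (auto intro!: derivative_eq_intros simp: has_field_derivative_powr)
    moreover have "(t + c) powr (p - 1) < t powr (p - 1)"
      using t assms by (intro powr_less_mono2_neg) auto
    ultimately show "\<exists>y. (f has_real_derivative y) (at t) \<and> y < 0"
      using p by (intro exI[of _ "p * (t + c) powr (p - 1) - p * t powr (p - 1)"])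
        (simp add: right_diff_distrib[symmetric] mult_pos_neg)
  next
    show "continuous_on {b..a + b} f"
      unfolding f_def using p assms by (intro continuous_intros continuous_on_powr') auto
  qed
  then show ?thesis by (simp add: f_def algebra_simps)
qed

lemma T_cost_finite:
  assumes \<mu>: "\<mu> \<in> P1" and \<nu>: "\<nu> \<in> P1" and \<gamma>: "\<gamma> \<in> Marg \<mu> \<nu>" and p: "0 < p" "p \<le> 1"
  shows "T_cost p \<gamma> < \<infinity>"
proof -
  interpret prob_space \<gamma> using \<gamma> by (rule Marg_prob_space)
  have s\<gamma>: "sets \<gamma> = sets borel" using \<gamma> by (rule Marg_sets)
  have [measurable_cong]: "sets \<gamma> = sets borel" by fact
  have fin: "(\<integral>\<^sup>+ x. ennreal \<bar>x\<bar> \<partial>\<rho>) < \<infinity>" if "\<rho> \<in> P1" for \<rho>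
    using that by (auto simp: P1_def integrable_iff_bounded)
  have "T_cost p \<gamma> \<le> (\<integral>\<^sup>+ z. 1 + (ennreal \<bar>fst z\<bar> + ennreal \<bar>snd z\<bar>) \<partial>\<gamma>)"
    unfolding T_cost_def split_beta'
  proof (rule nn_integral_mono)
    fix z :: "real \<times> real"
    define d where "d = \<bar>fst z - snd z\<bar>"
    have "d powr p \<le> 1 + d"
    proof (cases "d \<le> 1")
      case True
      then have "d powr p \<le> 1 powr p" using p by (intro powr_mono2) (auto simp: d_def)
      then show ?thesis by (simp add: d_def)
    next
      case False
      then have "d powr p \<le> d powr 1" using p by (intro powr_mono) auto
      then show ?thesis using False by simp
    qed
    also have "\<dots> \<le> 1 + (\<bar>fst z\<bar> + \<bar>snd z\<bar>)" by (simp add: d_def)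
    finally show "ennreal (\<bar>fst z - snd z\<bar> powr p) \<le> 1 + (ennreal \<bar>fst z\<bar> + ennreal \<bar>snd z\<bar>)"
      unfolding d_def by (metis abs_ge_zero add_nonneg_nonneg ennreal_1 ennreal_leI ennreal_plus zero_le_one)
  qed
  also have "\<dots> = 1 + ((\<integral>\<^sup>+ z. ennreal \<bar>fst z\<bar> \<partial>\<gamma>) + (\<integral>\<^sup>+ z. ennreal \<bar>snd z\<bar> \<partial>\<gamma>))"
    by (subst nn_integral_add, simp, simp, subst nn_integral_add) (auto simp: emeasure_space_1)
  also have "(\<integral>\<^sup>+ z. ennreal \<bar>fst z\<bar> \<partial>\<gamma>) = (\<integral>\<^sup>+ x. ennreal \<bar>x\<bar> \<partial>distr \<gamma> borel fst)"
    by (rule nn_integral_distr[symmetric]) (auto intro: measurable_fst_snd_sets_borel s\<gamma>)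
  also have "(\<integral>\<^sup>+ z. ennreal \<bar>snd z\<bar> \<partial>\<gamma>) = (\<integral>\<^sup>+ x. ennreal \<bar>x\<bar> \<partial>distr \<gamma> borel snd)"
    by (rule nn_integral_distr[symmetric]) (auto intro: measurable_fst_snd_sets_borel s\<gamma>)
  finally show ?thesis
    using fin[OF \<mu>] fin[OF \<nu>] Marg_distr_fst[OF \<gamma>] Marg_distr_snd[OF \<gamma>]
    by (auto simp: order_le_less_trans)
qed

lemma sets_add_measure [simp]: "sets (add_measure M N) = sets M"
  and space_add_measure [simp]: "space (add_measure M N) = space M"
  by (simp_all add: add_measure_def)

lemma emeasure_add_measure:
  assumes "sets M = sets N" "A \<in> sets M"
  shows "emeasure (add_measure M N) A = emeasure M A + emeasure N A"
  unfolding add_measure_def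
proof (rule emeasure_measure_of_sigma)
  show "countably_additive (sets M) (\<lambda>A. emeasure M A + emeasure N A)"
  proof (rule countably_additiveI)
    fix B :: "nat \<Rightarrow> _" assume B: "range B \<subseteq> sets M" "disjoint_family B"
    then show "(\<Sum>i. emeasure M (B i) + emeasure N (B i)) = emeasure M (\<Union>i. B i) + emeasure N (\<Union>i. B i)"
      using assms(1) by (subst suminf_add[symmetric]) (auto simp: suminf_emeasure)
  qed
qed (use assms(2) sets.sigma_algebra_axioms[of M] in \<open>auto simp: positive_def\<close>)

lemma nn_integral_add_measure:
  assumes "sets M = sets N" and "f \<in> borel_measurable M"
  shows "(\<integral>\<^sup>+ x. f x \<partial>add_measure M N) = (\<integral>\<^sup>+ x. f x \<partial>M) + (\<integral>\<^sup>+ x. f x \<partial>N)"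
  using assms(2)
proof (induction rule: borel_measurable_induct)
  case (cong f g)
  have "space M = space N" using assms(1) by (rule sets_eq_imp_space_eq)
  then have eqs: "(\<integral>\<^sup>+ x. f x \<partial>N) = (\<integral>\<^sup>+ x. g x \<partial>N)" "(\<integral>\<^sup>+ x. f x \<partial>M) = (\<integral>\<^sup>+ x. g x \<partial>M)"
    "(\<integral>\<^sup>+ x. f x \<partial>add_measure M N) = (\<integral>\<^sup>+ x. g x \<partial>add_measure M N)"
    by (auto intro!: nn_integral_cong simp: cong(3) \<open>space M = space N\<close>[symmetric])
  show ?case unfolding eqs by fact
next
  case (set A)
  then show ?case using assms(1) emeasure_add_measure[OF assms(1)] by simp
next
  case (mult u c)
  then have "u \<in> borel_measurable N" "u \<in> borel_measurable (add_measure M N)"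
    using assms(1) by (simp_all cong: measurable_cong_sets)
  then show ?case using mult by (simp add: nn_integral_cmult distrib_left)
next
  case (add u v)
  then have "u \<in> borel_measurable N" "u \<in> borel_measurable (add_measure M N)"
     "v \<in> borel_measurable N" "v \<in> borel_measurable (add_measure M N)"
    using assms(1) by (simp_all cong: measurable_cong_sets)
  then show ?case using add by (simp add: nn_integral_add ac_simps)
next
  case (seq U)
  then have m: "U i \<in> borel_measurable N" "U i \<in> borel_measurable (add_measure M N)" for i
    using assms(1) by (simp_all cong: measurable_cong_sets)
  have "(\<integral>\<^sup>+ x. (SUP i. U i x) \<partial>add_measure M N) = (SUP i. \<integral>\<^sup>+ x. U i x \<partial>add_measure M N)"
    by (rule nn_integral_monotone_convergence_SUP) (use m seq in auto)
  also have "\<dots> = (SUP i. (\<integral>\<^sup>+ x. U i x \<partial>M) + (\<integral>\<^sup>+ x. U i x \<partial>N))"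
    using seq by simp
  also have "\<dots> = (SUP i. \<integral>\<^sup>+ x. U i x \<partial>M) + (SUP i. \<integral>\<^sup>+ x. U i x \<partial>N)"
    using seq by (intro ennreal_SUP_add) (auto simp: incseq_def le_fun_def intro!: nn_integral_mono)
  also have "\<dots> = (\<integral>\<^sup>+ x. (SUP i. U i x) \<partial>M) + (\<integral>\<^sup>+ x. (SUP i. U i x) \<partial>N)"
    using m seq by (simp add: nn_integral_monotone_convergence_SUP)
  finally show ?case by (simp add: SUP_apply image_comp)
qed

lemma distr_pair_snd:
  assumes "prob_space M" "prob_space N"
  shows "distr (M \<Otimes>\<^sub>M N) N snd = N"
proof (intro measure_eqI)
  interpret M: prob_space M by fact
  interpret N: prob_space N by fact
  fix A assume A: "A \<in> sets (distr (M \<Otimes>\<^sub>M N) N snd)"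
  then have "emeasure (distr (M \<Otimes>\<^sub>M N) N snd) A = emeasure (M \<Otimes>\<^sub>M N) (space M \<times> A)"
    by (auto simp add: emeasure_distr space_pair_measure dest: sets.sets_into_space intro!: arg_cong2[where f=emeasure])
  with A show "emeasure (distr (M \<Otimes>\<^sub>M N) N snd) A = emeasure N A"
    by (simp add: N.emeasure_pair_measure_Times M.emeasure_space_1)
qed simp

text \<open>
  If both rectangles carried mass, one could take the same mass \<open>m\<close> from each of them and couple
  the sources of one part with the targets of the other part, independently. The marginals stay
  the same and the cost becomes strictly smaller. This is cyclical monotonicity for two jumps,
  stated for rectangles of positive mass.
\<close>

lemma Marg_opt_no_improving_swap:
  assumes opt: "\<gamma> \<in> Marg_opt p \<mu> \<nu>" and fin: "T_cost p \<gamma> < \<infinity>"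
    and [measurable]: "I1 \<in> sets borel" "J1 \<in> sets borel" "I2 \<in> sets borel" "J2 \<in> sets borel"
    and disj: "I1 \<inter> I2 = {}"
    and improve: "\<And>x y x' y'. x \<in> I1 \<Longrightarrow> y \<in> J1 \<Longrightarrow> x' \<in> I2 \<Longrightarrow> y' \<in> J2 \<Longrightarrow>
      \<bar>x - y'\<bar> powr p + \<bar>x' - y\<bar> powr p < \<bar>x - y\<bar> powr p + \<bar>x' - y'\<bar> powr p"
  shows "measure \<gamma> (I1 \<times> J1) = 0 \<or> measure \<gamma> (I2 \<times> J2) = 0"
proof (rule ccontr)
  assume not_null: "\<not> (measure \<gamma> (I1 \<times> J1) = 0 \<or> measure \<gamma> (I2 \<times> J2) = 0)"
  define R1 where "R1 = I1 \<times> J1"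
  define R2 where "R2 = I2 \<times> J2"
  define m1 where "m1 = measure \<gamma> R1"
  define m2 where "m2 = measure \<gamma> R2"
  define m where "m = min m1 m2"
  have pos: "0 < m1" "0 < m2" "0 < m" and m_le: "m \<le> m1" "m \<le> m2"
    using not_null by (auto simp: m1_def m2_def m_def R1_def R2_def zero_less_measure_iff)
  have \<gamma>: "\<gamma> \<in> Marg \<mu> \<nu>" using opt by (simp add: Marg_opt_def)
  interpret prob_space \<gamma> using \<gamma> by (rule Marg_prob_space)
  have s\<gamma>: "sets \<gamma> = sets borel" using \<gamma> by (rule Marg_sets)
  note [measurable_cong] = s\<gamma>
  have [measurable]: "R1 \<in> sets borel" "R2 \<in> sets borel" by (simp_all add: R1_def R2_def)
  have R_disj: "R1 \<inter> R2 = {}" using disj by (auto simp: R1_def R2_def)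
  define c where "c z = ennreal (\<bar>fst z - snd z\<bar> powr p)" for z :: "real \<times> real"
  have c[measurable]: "c \<in> borel_measurable borel" unfolding c_def by measurable
  have T: "T_cost p \<rho> = (\<integral>\<^sup>+ z. c z \<partial>\<rho>)" for \<rho> by (simp add: T_cost_def c_def split_beta')
  define g1 where "g1 = density \<gamma> (\<lambda>z. ennreal (1 / m1) * indicator R1 z)"
  define g2 where "g2 = density \<gamma> (\<lambda>z. ennreal (1 / m2) * indicator R2 z)"
  define r where "r = density \<gamma> (\<lambda>z. ennreal (1 - m / m1 * indicator R1 z - m / m2 * indicator R2 z))"
  have sg[measurable_cong]: "sets g1 = sets borel" "sets g2 = sets borel" "sets r = sets borel"
    by (simp_all add: g1_def g2_def r_def s\<gamma>)
  have p1: "prob_space g1"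
    by (rule prob_spaceI) (simp add: g1_def emeasure_density nn_integral_cmult Marg_space[OF \<gamma>]
        emeasure_eq_measure m1_def[symmetric] ennreal_mult'[symmetric] less_imp_le pos less_imp_neq[OF pos(1), symmetric])
  have p2: "prob_space g2"
    by (rule prob_spaceI) (simp add: g2_def emeasure_density nn_integral_cmult Marg_space[OF \<gamma>]
        emeasure_eq_measure m2_def[symmetric] ennreal_mult'[symmetric] less_imp_le pos less_imp_neq[OF pos(2), symmetric])
  interpret g1: prob_space g1 by (rule p1)
  interpret g2: prob_space g2 by (rule p2)
  \<comment> \<open>\<open>\<gamma>\<close> is the remainder plus mass \<open>m\<close> taken from each of the two rectangles\<close>
  have split: "(\<integral>\<^sup>+ z. f z \<partial>\<gamma>) = (\<integral>\<^sup>+ z. f z \<partial>r) + ennreal m * ((\<integral>\<^sup>+ z. f z \<partial>g1) + (\<integral>\<^sup>+ z. f z \<partial>g2))"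
    if [measurable]: "f \<in> borel_measurable borel" for f :: "real \<times> real \<Rightarrow> ennreal"
  proof -
    have "(\<integral>\<^sup>+ z. f z \<partial>r) + ennreal m * ((\<integral>\<^sup>+ z. f z \<partial>g1) + (\<integral>\<^sup>+ z. f z \<partial>g2))
      = (\<integral>\<^sup>+ z. ennreal (1 - m / m1 * indicator R1 z - m / m2 * indicator R2 z) * f z
         + ennreal m * ((ennreal (1 / m1) * indicator R1 z) * f z + (ennreal (1 / m2) * indicator R2 z) * f z) \<partial>\<gamma>)"
      unfolding r_def g1_def g2_def
      by (simp add: nn_integral_density nn_integral_add nn_integral_cmult)
    also have "\<dots> = (\<integral>\<^sup>+ z. f z \<partial>\<gamma>)"
    proof (rule nn_integral_cong)
      fix z
      have "ennreal (1 - m / m1 * indicator R1 z - m / m2 * indicator R2 z)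
        + ennreal m * (ennreal (1 / m1) * indicator R1 z + ennreal (1 / m2) * indicator R2 z) = 1"
        using pos m_le R_disj
        by (cases "z \<in> R1"; cases "z \<in> R2")
          (auto simp: ennreal_mult'[symmetric] ennreal_plus[symmetric] simp del: ennreal_plus)
      then show "ennreal (1 - m / m1 * indicator R1 z - m / m2 * indicator R2 z) * f z
         + ennreal m * ((ennreal (1 / m1) * indicator R1 z) * f z + (ennreal (1 / m2) * indicator R2 z) * f z) = f z"
        by (metis distrib_right mult.assoc mult_1)
    qed
    finally show ?thesis by simp
  qed
  define P where "P = g1 \<Otimes>\<^sub>M g2"
  have sP[measurable_cong]: "sets P = sets (borel \<Otimes>\<^sub>M borel)"
    unfolding P_def by (intro sets_pair_measure_cong sg)
  have P1: "distr P g1 fst = g1" unfolding P_def by (rule g2.distr_pair_fst)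
  have P2: "distr P g2 snd = g2" unfolding P_def by (rule distr_pair_snd[OF p1 p2])
  have I1: "(\<integral>\<^sup>+ z. f (fst z) \<partial>P) = (\<integral>\<^sup>+ z. f z \<partial>g1)"
    if [measurable]: "f \<in> borel_measurable borel" for f :: "real \<times> real \<Rightarrow> ennreal"
  proof -
    have "(\<integral>\<^sup>+ z. f z \<partial>distr P g1 fst) = (\<integral>\<^sup>+ z. f (fst z) \<partial>P)"
      by (intro nn_integral_distr) (simp_all add: P_def)
    then show ?thesis unfolding P1 by simp
  qed
  have I2: "(\<integral>\<^sup>+ z. f (snd z) \<partial>P) = (\<integral>\<^sup>+ z. f z \<partial>g2)"
    if [measurable]: "f \<in> borel_measurable borel" for f :: "real \<times> real \<Rightarrow> ennreal"
  proof -
    have "(\<integral>\<^sup>+ z. f z \<partial>distr P g2 snd) = (\<integral>\<^sup>+ z. f (snd z) \<partial>P)"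
      by (intro nn_integral_distr) (simp_all add: P_def)
    then show ?thesis unfolding P2 by simp
  qed
  define s12 where "s12 = distr P borel (\<lambda>z. (fst (fst z), snd (snd z)))"
  define s21 where "s21 = distr P borel (\<lambda>z. (fst (snd z), snd (fst z)))"
  define \<gamma>' where "\<gamma>' = add_measure r (scale_measure (ennreal m) (add_measure s12 s21))"
  have mP[measurable]: "(\<lambda>z. (fst (fst z), snd (snd z))) \<in> P \<rightarrow>\<^sub>M (borel :: (real \<times> real) measure)"
    "(\<lambda>z. (fst (snd z), snd (fst z))) \<in> P \<rightarrow>\<^sub>M (borel :: (real \<times> real) measure)"
    unfolding borel_prod[symmetric] by measurable
  have int': "(\<integral>\<^sup>+ z. f z \<partial>\<gamma>') = (\<integral>\<^sup>+ z. f z \<partial>r) + ennreal m * (\<integral>\<^sup>+ z. f (fst (fst z), snd (snd z)) + f (fst (snd z), snd (fst z)) \<partial>P)"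
    if [measurable]: "f \<in> borel_measurable borel" for f :: "real \<times> real \<Rightarrow> ennreal"
  proof -
    have "(\<integral>\<^sup>+ z. f z \<partial>\<gamma>') = (\<integral>\<^sup>+ z. f z \<partial>r) + (\<integral>\<^sup>+ z. f z \<partial>scale_measure (ennreal m) (add_measure s12 s21))"
      unfolding \<gamma>'_def by (intro nn_integral_add_measure) (simp_all add: sg s12_def)
    also have "(\<integral>\<^sup>+ z. f z \<partial>scale_measure (ennreal m) (add_measure s12 s21)) = ennreal m * (\<integral>\<^sup>+ z. f z \<partial>add_measure s12 s21)"
      by (intro nn_integral_scale_measure)
        (simp add: measurable_cong_sets[OF sets_add_measure refl] s12_def)
    also have "(\<integral>\<^sup>+ z. f z \<partial>add_measure s12 s21) = (\<integral>\<^sup>+ z. f z \<partial>s12) + (\<integral>\<^sup>+ z. f z \<partial>s21)"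
      by (intro nn_integral_add_measure) (simp_all add: s12_def s21_def)
    also have "\<dots> = (\<integral>\<^sup>+ z. f (fst (fst z), snd (snd z)) + f (fst (snd z), snd (fst z)) \<partial>P)"
      unfolding s12_def s21_def by (simp add: nn_integral_distr nn_integral_add)
    finally show ?thesis .
  qed
  have marg: "(\<integral>\<^sup>+ z. f z \<partial>\<gamma>') = (\<integral>\<^sup>+ z. f z \<partial>\<gamma>)"
    if [measurable]: "f \<in> borel_measurable borel"
      and sym: "\<And>a b a' b'. f (a, b') + f (a', b) = f (a, b) + f (a', b')" for f :: "real \<times> real \<Rightarrow> ennreal"
  proof -
    have "(\<integral>\<^sup>+ z. f (fst (fst z), snd (snd z)) + f (fst (snd z), snd (fst z)) \<partial>P)
       = (\<integral>\<^sup>+ z. f (fst z) + f (snd z) \<partial>P)"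
      using sym by (intro nn_integral_cong) (metis prod.collapse)
    also have "\<dots> = (\<integral>\<^sup>+ z. f z \<partial>g1) + (\<integral>\<^sup>+ z. f z \<partial>g2)"
      by (subst nn_integral_add) (simp_all add: I1 I2)
    finally show ?thesis using int'[of f] split[of f] by simp
  qed
  have "\<gamma>' \<in> Marg \<mu> \<nu>"
  proof (rule MargI)
    show s\<gamma>': "sets \<gamma>' = sets borel" by (simp add: \<gamma>'_def sg)
    show "sets \<mu> = sets borel" "sets \<nu> = sets borel"
      using Marg_distr_fst[OF \<gamma>] Marg_distr_snd[OF \<gamma>] by (metis sets_distr)+
    show "prob_space \<mu>"
      using Marg_distr_fst[OF \<gamma>] prob_space_distr[OF measurable_fst_snd_sets_borel(1)[OF s\<gamma>]] by simp
    fix A :: "real set" assume [measurable]: "A \<in> sets borel"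
    have "emeasure \<gamma>' B = emeasure \<gamma> B" if "B = A \<times> UNIV \<or> B = UNIV \<times> A" for B
    proof -
      have [measurable]: "B \<in> sets borel" using that by auto
      have "(\<integral>\<^sup>+ z. indicator B z \<partial>\<gamma>') = (\<integral>\<^sup>+ z. indicator B z \<partial>\<gamma>)"
        by (rule marg) (use that in \<open>auto simp: indicator_def add.commute\<close>)
      then show ?thesis by (simp add: s\<gamma>' s\<gamma>)
    qed
    then show "emeasure \<gamma>' (A \<times> UNIV) = emeasure \<mu> A" "emeasure \<gamma>' (UNIV \<times> A) = emeasure \<nu> A"
      using Marg_emeasure_fst[OF \<gamma>] Marg_emeasure_snd[OF \<gamma>] \<open>A \<in> sets borel\<close> by auto
  qed
  then have le: "T_cost p \<gamma> \<le> T_cost p \<gamma>'" using opt by (simp add: Marg_opt_def)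
  have finC: "(\<integral>\<^sup>+ z. c z \<partial>r) < \<infinity>" "(\<integral>\<^sup>+ z. c z \<partial>g1) + (\<integral>\<^sup>+ z. c z \<partial>g2) < \<infinity>"
    using fin split[OF c] pos(3) by (auto simp: T ennreal_mult_less_top)
  interpret PP: prob_space P unfolding P_def by (rule prob_space_pair[OF p1 p2])
  have "AE z in g1. z \<in> R1" "AE z in g2. z \<in> R2"
    unfolding g1_def g2_def by (subst AE_density, auto simp: indicator_def)+
  then have D: "AE z in distr P g1 fst. z \<in> R1" "AE z in distr P g2 snd. z \<in> R2"
    unfolding P1 P2 .
  have prj: "fst \<in> P \<rightarrow>\<^sub>M g1" "snd \<in> P \<rightarrow>\<^sub>M g2" by (simp_all add: P_def)
  have in1: "AE z in P. fst z \<in> R1" by (rule AE_distrD[OF prj(1) D(1)])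
  have in2: "AE z in P. snd z \<in> R2" by (rule AE_distrD[OF prj(2) D(2)])
  have strict: "AE z in P. c (fst (fst z), snd (snd z)) + c (fst (snd z), snd (fst z)) < c (fst z) + c (snd z)"
    using in1 in2
  proof eventually_elim
    case (elim z)
    then have "\<bar>fst (fst z) - snd (snd z)\<bar> powr p + \<bar>fst (snd z) - snd (fst z)\<bar> powr p
      < \<bar>fst (fst z) - snd (fst z)\<bar> powr p + \<bar>fst (snd z) - snd (snd z)\<bar> powr p"
      by (intro improve) (auto simp: R1_def R2_def)
    then show ?case
      by (simp add: c_def ennreal_plus[symmetric] ennreal_less_iff del: ennreal_plus)
  qed
  have "(\<integral>\<^sup>+ z. c (fst (fst z), snd (snd z)) + c (fst (snd z), snd (fst z)) \<partial>P) < (\<integral>\<^sup>+ z. c (fst z) + c (snd z) \<partial>P)"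
  proof (rule nn_integral_less)
    have sum: "(\<integral>\<^sup>+ z. c (fst z) + c (snd z) \<partial>P) = (\<integral>\<^sup>+ z. c z \<partial>g1) + (\<integral>\<^sup>+ z. c z \<partial>g2)"
      by (subst nn_integral_add) (simp_all add: I1 I2)
    show "AE z in P. c (fst (fst z), snd (snd z)) + c (fst (snd z), snd (fst z)) \<le> c (fst z) + c (snd z)"
      using strict by eventually_elim simp
    then have "(\<integral>\<^sup>+ z. c (fst (fst z), snd (snd z)) + c (fst (snd z), snd (fst z)) \<partial>P) \<le> (\<integral>\<^sup>+ z. c (fst z) + c (snd z) \<partial>P)"
      by (rule nn_integral_mono_AE)
    also have "\<dots> < \<infinity>" using finC(2) by (simp only: sum)
    finally show "(\<integral>\<^sup>+ z. c (fst (fst z), snd (snd z)) + c (fst (snd z), snd (fst z)) \<partial>P) \<noteq> \<infinity>"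
      by simp
    show "\<not> (AE z in P. c (fst z) + c (snd z) \<le> c (fst (fst z), snd (snd z)) + c (fst (snd z), snd (fst z)))"
    proof
      assume "AE z in P. c (fst z) + c (snd z) \<le> c (fst (fst z), snd (snd z)) + c (fst (snd z), snd (fst z))"
      with strict have "AE z in P. False" by eventually_elim simp
      then show False by simp
    qed
  qed measurable
  also have "\<dots> = (\<integral>\<^sup>+ z. c z \<partial>g1) + (\<integral>\<^sup>+ z. c z \<partial>g2)"
    by (subst nn_integral_add) (simp_all add: I1 I2)
  finally have "T_cost p \<gamma>' < T_cost p \<gamma>"
    unfolding T int'[OF c] split[OF c] using finC(1) pos(3)
    by (intro ennreal_add_left_cancel_less[THEN iffD2] conjI ennreal_mult_strict_left_mono) (auto simp: less_top)
  with le show False by simp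
qed

text \<open>
  The middle inequality is not strict, so that chains \<open>x \<rightarrow> y \<rightarrow> y'\<close> through an atom \<open>y\<close> are
  excluded as well.
\<close>

definition noncrossing :: "(real \<times> real) measure \<Rightarrow> bool" where
  "noncrossing \<gamma> \<longleftrightarrow> (\<forall>I1\<in>sets borel. \<forall>J1\<in>sets borel. \<forall>I2\<in>sets borel. \<forall>J2\<in>sets borel.
     (\<forall>x\<in>I1. \<forall>y\<in>J1. \<forall>x'\<in>I2. \<forall>y'\<in>J2. x < x' \<and> x' \<le> y \<and> y < y') \<longrightarrow>
     measure \<gamma> (I1 \<times> J1) = 0 \<or> measure \<gamma> (I2 \<times> J2) = 0)"

lemma Marg_opt_noncrossing:
  assumes "\<mu> \<in> P1" "\<nu> \<in> P1" and p: "0 < p" "p < 1" and opt: "\<gamma> \<in> Marg_opt p \<mu> \<nu>"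
  shows "noncrossing \<gamma>"
  unfolding noncrossing_def
proof (intro ballI impI)
  fix I1 J1 I2 J2 :: "real set"
  assume m: "I1 \<in> sets borel" "J1 \<in> sets borel" "I2 \<in> sets borel" "J2 \<in> sets borel"
    and ord: "\<forall>x\<in>I1. \<forall>y\<in>J1. \<forall>x'\<in>I2. \<forall>y'\<in>J2. x < x' \<and> x' \<le> y \<and> y < y'"
  have fin: "T_cost p \<gamma> < \<infinity>"
    using opt p by (intro T_cost_finite[OF assms(1,2)]) (auto simp: Marg_opt_def)
  show "measure \<gamma> (I1 \<times> J1) = 0 \<or> measure \<gamma> (I2 \<times> J2) = 0"
  proof (cases "J1 = {} \<or> J2 = {}")
    case False
    show ?thesis
    proof (rule Marg_opt_no_improving_swap[OF opt fin m])
      show "I1 \<inter> I2 = {}" using ord False by fastforce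
      fix x y x' y' assume "x \<in> I1" "y \<in> J1" "x' \<in> I2" "y' \<in> J2"
      then have "x < x'" "x' \<le> y" "y < y'" using ord by auto
      then show "\<bar>x - y'\<bar> powr p + \<bar>x' - y\<bar> powr p < \<bar>x - y\<bar> powr p + \<bar>x' - y'\<bar> powr p"
        using powr_sum_less_swap[OF p, of "x' - x" "y - x'" "y' - y"]
        by (simp add: abs_minus_commute[of x] abs_minus_commute[of x'])
    qed
  qed auto
qed

lemma measure_Un_le_add:
  "A \<in> sets M \<Longrightarrow> B \<in> sets M \<Longrightarrow> measure M B \<le> c \<Longrightarrow> measure M (A \<union> B) \<le> measure M A + c"
  by (rule order_trans[OF measure_Un_le]) auto

text \<open>
  Suppose that the flow over \<open>[a, b]\<close> were smaller than \<open>h\<close>, and let \<open>s\<close> be the supremum of the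
  end points in \<open>]a, b]\<close> of the jumps that start in \<open>]-\<infinity>, a]\<close>. Jumps that start in \<open>]a, s[\<close> and
  end beyond \<open>s\<close> would cross some of these jumps. The pointwise flows at \<open>s\<close> and just before
  \<open>s\<close>, both at least \<open>h\<close>, therefore need mass that starts exactly at \<open>s\<close> and mass that ends
  exactly at \<open>s\<close>; these two masses cross at \<open>s\<close>.
\<close>

lemma noncrossing_le_flow:
  assumes \<gamma>: "\<gamma> \<in> Marg \<mu> \<nu>" and nc: "noncrossing \<gamma>"
    and ab: "a \<le> b" and h: "\<And>u. a \<le> u \<Longrightarrow> u \<le> b \<Longrightarrow> h \<le> flow \<gamma> u u"
  shows "h \<le> flow \<gamma> a b"
proof (rule ccontr)
  assume "\<not> h \<le> flow \<gamma> a b"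
  then have less: "flow \<gamma> a b < h" by simp
  interpret prob_space \<gamma> using \<gamma> by (rule Marg_prob_space)
  note T = Marg_sets_Times[OF \<gamma>]
  define M where "M y = measure \<gamma> ({..a} \<times> {y<..b})" for y
  have M_mono: "M y' \<le> M y" if "y \<le> y'" for y y'
    unfolding M_def using that by (intro finite_measure_mono T) auto
  have "flow \<gamma> a a \<le> measure \<gamma> (({..a} \<times> {a<..b}) \<union> ({..a} \<times> {b<..}))"
    unfolding flow_def by (intro finite_measure_mono sets.Un T) auto
  also have "\<dots> \<le> M a + flow \<gamma> a b"
    unfolding flow_def M_def by (intro measure_Un_le T) auto
  finally have Ma: "0 < M a" using h[of a] ab less by simp
  \<comment> \<open>\<open>Inf S\<close> is the essential supremum of the end points in \<open>]a, b]\<close> of the jumps starting in \<open>]-\<infinity>, a]\<close>\<close>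
  define S where "S = {y \<in> {a..b}. M y = 0}"
  have bS: "b \<in> S" using ab by (simp add: S_def M_def)
  have S_bdd: "bdd_below S" by (auto simp: S_def intro!: bdd_belowI[of _ a])
  define s where "s = Inf S"
  have s_bounds: "a \<le> s" "s \<le> b"
    using bS S_bdd by (auto simp: s_def S_def intro!: cInf_greatest cInf_lower)
  have Ms: "M s = 0"
  proof -
    have "{..a} \<times> {s<..b} = (\<Union>n. {..a} \<times> {s + 1 / Suc n<..b})"
    proof safe
      fix y assume "y \<in> {s<..b}"
      then obtain n where "1 / Suc n < y - s" using nat_approx_posE[of "y - s"] by auto
      then show "\<And>x. x \<le> a \<Longrightarrow> (x, y) \<in> (\<Union>n. {..a} \<times> {s + 1 / Suc n<..b})"
        using \<open>y \<in> {s<..b}\<close> by (auto intro!: exI[of _ n])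
    next
      fix y :: real and n :: nat assume "y \<in> {s + 1 / Suc n<..b}"
      then show "y \<in> {s<..b}" by (auto intro: less_trans[rotated] simp: less_le_trans add_pos_pos)
    qed
    moreover have "emeasure \<gamma> ({..a} \<times> {s + 1 / Suc n<..b}) = 0" for n
    proof -
      obtain y where "y \<in> S" "y < s + 1 / Suc n"
        using cInf_lessD[of S "s + 1 / Suc n"] bS by (auto simp: s_def)
      then have "M (s + 1 / Suc n) \<le> 0" using M_mono[of y "s + 1 / Suc n"] by (simp add: S_def)
      then show ?thesis by (simp add: M_def emeasure_eq_measure measure_le_0_iff)
    qed
    ultimately have "emeasure \<gamma> ({..a} \<times> {s<..b}) = 0"
      by (simp only:) (rule emeasure_UN_eq_0, auto intro!: T)
    then show ?thesis by (simp add: M_def measure_def)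
  qed
  have as: "a < s" using Ma Ms s_bounds(1) by (cases "a = s") auto
  have pos: "0 < measure \<gamma> ({..a} \<times> {c<..s})" if c: "a \<le> c" "c < s" for c
  proof -
    have "c \<notin> S" using c cInf_lower[OF _ S_bdd] by (force simp: s_def)
    then have "0 < M c" using c s_bounds by (auto simp: S_def M_def zero_less_measure_iff)
    also have "M c \<le> measure \<gamma> (({..a} \<times> {c<..s}) \<union> ({..a} \<times> {s<..b}))"
      unfolding M_def by (intro finite_measure_mono sets.Un T) auto
    also have "\<dots> \<le> measure \<gamma> ({..a} \<times> {c<..s}) + M s"
      unfolding M_def by (intro measure_Un_le T) auto
    finally show ?thesis using Ms by simp
  qed
  have null: "measure \<gamma> ({a<..<s} \<times> {s<..}) = 0"
  proof -
    have "{a<..<s} \<times> {s<..} = (\<Union>n. {a<..s - 1 / Suc n} \<times> {s<..})"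
    proof safe
      fix x :: real assume "x \<in> {a<..<s}"
      then obtain n where "1 / Suc n < s - x" using nat_approx_posE[of "s - x"] by auto
      then show "\<And>y. s < y \<Longrightarrow> (x, y) \<in> (\<Union>n. {a<..s - 1 / Suc n} \<times> {s<..})"
        using \<open>x \<in> {a<..<s}\<close> by (auto intro!: exI[of _ n])
    next
      fix x :: real and n :: nat assume "x \<in> {a<..s - 1 / Suc n}"
      moreover have "0 < 1 / real (Suc n)" by simp
      ultimately show "x \<in> {a<..<s}" unfolding greaterThanAtMost_iff greaterThanLessThan_iff by linarith
    qed
    moreover have "emeasure \<gamma> ({a<..s - 1 / Suc n} \<times> {s<..}) = 0" for n
    proof -
      let ?c = "max a (s - 1 / Suc n)"
      have c: "a \<le> ?c" "?c < s" using as by auto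
      have "measure \<gamma> ({..a} \<times> {?c<..s}) = 0 \<or> measure \<gamma> ({a<..?c} \<times> {s<..}) = 0"
        by (rule nc[unfolded noncrossing_def, rule_format]) auto
      then have "measure \<gamma> ({a<..?c} \<times> {s<..}) = 0" using pos[OF c] by auto
      moreover have "measure \<gamma> ({a<..s - 1 / Suc n} \<times> {s<..}) \<le> measure \<gamma> ({a<..?c} \<times> {s<..})"
        by (intro finite_measure_mono T) auto
      ultimately show ?thesis by (simp add: emeasure_eq_measure measure_le_0_iff)
    qed
    ultimately have "emeasure \<gamma> ({a<..<s} \<times> {s<..}) = 0"
      by (simp only:) (rule emeasure_UN_eq_0, auto intro!: T)
    then show ?thesis by (simp add: measure_def)
  qed
  have out: "0 < measure \<gamma> ({s} \<times> {s<..})"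
  proof -
    have "h \<le> flow \<gamma> s s" using h as s_bounds by simp
    also have "\<dots> \<le> measure \<gamma> (({..a} \<times> {s<..b}) \<union> (({..a} \<times> {b<..}) \<union> (({a<..<s} \<times> {s<..}) \<union> ({s} \<times> {s<..}))))"
      unfolding flow_def using as by (intro finite_measure_mono sets.Un T) auto
    also have "\<dots> \<le> M s + (flow \<gamma> a b + (measure \<gamma> ({a<..<s} \<times> {s<..}) + measure \<gamma> ({s} \<times> {s<..})))"
      unfolding flow_def M_def
      by (rule measure_Un_le_add, (intro sets.Un T; simp)+)+ (rule order_refl)
    finally show ?thesis using Ms null less by simp
  qed
  have into: "0 < measure \<gamma> ({..<s} \<times> {s})"
  proof -
    \<comment> \<open>the flow is right continuous only, so the left limit at \<open>s\<close> is taken along \<open>s - 1 / Suc n\<close>\<close>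
    define gap where "gap n = measure \<gamma> (UNIV \<times> {s - 1 / Suc n<..<s})" for n :: nat
    have bound: "h \<le> measure \<gamma> ({..<s} \<times> {s}) + flow \<gamma> a b + gap n" for n
    proof -
      define e where "e = s - 1 / Suc n"
      define u where "u = max a e"
      have u: "a \<le> u" "u < s" "e \<le> u" using as by (auto simp: u_def e_def)
      have gap: "gap n = measure \<gamma> (UNIV \<times> {e<..<s})" by (simp add: gap_def e_def)
      have "h \<le> flow \<gamma> u u" by (rule h) (use u s_bounds in linarith)+
      also have "\<dots> \<le> measure \<gamma> (({..a} \<times> {s<..b}) \<union> (({..a} \<times> {b<..}) \<union> (({a<..<s} \<times> {s<..})
           \<union> (({..<s} \<times> {s}) \<union> (UNIV \<times> {e<..<s})))))"
        unfolding flow_def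
      proof (intro finite_measure_mono sets.Un T)
        show "{..u} \<times> {u<..} \<subseteq> ({..a} \<times> {s<..b}) \<union> (({..a} \<times> {b<..}) \<union> (({a<..<s} \<times> {s<..})
           \<union> (({..<s} \<times> {s}) \<union> (UNIV \<times> {e<..<s}))))"
        proof (rule subsetI, rule ccontr)
          fix z assume "z \<in> {..u} \<times> {u<..}" and no: "z \<notin> ({..a} \<times> {s<..b}) \<union> (({..a} \<times> {b<..}) \<union> (({a<..<s} \<times> {s<..})
           \<union> (({..<s} \<times> {s}) \<union> (UNIV \<times> {e<..<s}))))"
          then have n: "\<not> (fst z \<le> a \<and> s < snd z \<and> snd z \<le> b)" "\<not> (fst z \<le> a \<and> b < snd z)"
              "\<not> (a < fst z \<and> fst z < s \<and> s < snd z)" "\<not> (fst z < s \<and> snd z = s)" "\<not> (e < snd z \<and> snd z < s)"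
            and z: "fst z \<le> u" "u < snd z"
            unfolding mem_Times_iff Un_iff greaterThanLessThan_iff greaterThanAtMost_iff atMost_iff
              greaterThan_iff lessThan_iff singleton_iff by blast+
          have "fst z < s" "e < snd z" using z u by linarith+
          then have "s < snd z" using n(4,5) by linarith
          moreover have "\<not> fst z \<le> a" using n(1,2) \<open>s < snd z\<close> by linarith
          ultimately show False using n(3) \<open>fst z < s\<close> by linarith
        qed
      qed auto
      also have "\<dots> \<le> M s + (flow \<gamma> a b + (measure \<gamma> ({a<..<s} \<times> {s<..})
           + (measure \<gamma> ({..<s} \<times> {s}) + gap n)))"
        unfolding flow_def M_def gap
        by (rule measure_Un_le_add, (intro sets.Un T; simp)+)+ (rule order_refl)
      finally show ?thesis using Ms null by simp
    qed
    have "gap \<longlonglongrightarrow> measure \<gamma> (\<Inter>n. UNIV \<times> {s - 1 / Suc n<..<s})"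
      unfolding gap_def
    proof (intro finite_Lim_measure_decseq decseq_SucI Sigma_mono order_refl)
      fix n :: nat
      have "1 / real (Suc (Suc n)) \<le> 1 / real (Suc n)" by (simp add: frac_le)
      then show "{s - 1 / Suc (Suc n)<..<s} \<subseteq> {s - 1 / Suc n<..<s}"
        by (intro subsetI) (unfold greaterThanLessThan_iff, linarith)
    qed (auto intro!: T)
    moreover have "(\<Inter>n. UNIV \<times> {s - 1 / Suc n<..<s}) = ({} :: (real \<times> real) set)"
    proof safe
      fix x y assume in_all: "(x, y) \<in> (\<Inter>n. UNIV \<times> {s - 1 / Suc n<..<s})"
      then have "y < s" by auto
      then obtain n where "1 / Suc n < s - y" using nat_approx_posE[of "s - y"] by auto
      moreover have "s - 1 / Suc n < y" using in_all by auto
      ultimately show "(x, y) \<in> {}" by simp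
    qed
    ultimately have "(\<lambda>n. measure \<gamma> ({..<s} \<times> {s}) + flow \<gamma> a b + gap n) \<longlonglongrightarrow> measure \<gamma> ({..<s} \<times> {s}) + flow \<gamma> a b + 0"
      by (intro tendsto_intros) simp
    then have "h \<le> measure \<gamma> ({..<s} \<times> {s}) + flow \<gamma> a b + 0"
      by (rule LIMSEQ_le_const) (use bound in auto)
    then show ?thesis using less by simp
  qed
  have "measure \<gamma> ({..<s} \<times> {s}) = 0 \<or> measure \<gamma> ({s} \<times> {s<..}) = 0"
    by (rule nc[unfolded noncrossing_def, rule_format]) auto
  then show False using into out by auto
qed

section \<open>Weak convergence from joint distribution functions\<close>

text \<open>
  The error of replacing a function by its value at the corner of a grid cell is bounded by the
  oscillation on the cells and by the mass outside the square, which depends on the marginals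
  alone. So it is uniform over all plans with these marginals.
\<close>

lemma grid_approximation:
  fixes f :: "real \<times> real \<Rightarrow> real"
  assumes \<gamma>: "\<gamma> \<in> Marg \<mu> \<nu>" and f: "continuous_on UNIV f" and B: "\<And>z. \<bar>f z\<bar> \<le> B"
    and K: "0 < K" and R: "\<And>x y. \<lbrakk>-R < x; x \<le> R; -R < y; y \<le> R\<rbrakk> \<Longrightarrow>
       \<bar>f (x, y) - f (\<lceil>real K * x\<rceil> / K, \<lceil>real K * y\<rceil> / K)\<bar> \<le> e"
    and tail: "measure \<mu> (- {-real R<..real R}) \<le> e" "measure \<nu> (- {-real R<..real R}) \<le> e"
  shows "\<bar>(\<integral>z. f z \<partial>\<gamma>) - (\<Sum>p\<in>{- int (R * K)<..int (R * K)} \<times> {- int (R * K)<..int (R * K)}.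
      f (of_int (fst p) / K, of_int (snd p) / K) *
      measure \<gamma> ({(of_int (fst p) - 1) / K<..of_int (fst p) / K} \<times> {(of_int (snd p) - 1) / K<..of_int (snd p) / K}))\<bar>
    \<le> e + 2 * B * e"
proof -
  interpret prob_space \<gamma> using \<gamma> by (rule Marg_prob_space)
  have s\<gamma>: "sets \<gamma> = sets borel" using \<gamma> by (rule Marg_sets)
  note T = Marg_sets_Times[OF \<gamma>]
  let ?J = "{- int (R * K)<..int (R * K)}"
  let ?cell = "\<lambda>p. {(real_of_int (fst p) - 1) / K<..of_int (fst p) / K} \<times> {(real_of_int (snd p) - 1) / K<..of_int (snd p) / K}"
  let ?c = "\<lambda>p. f (real_of_int (fst p) / K, real_of_int (snd p) / K)"
  let ?Q = "{-real R<..real R} \<times> {-real R<..real R}"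
  define s where "s z = (\<Sum>p\<in>?J \<times> ?J. ?c p * indicator (?cell p) z)" for z
  have cell: "z \<in> ?cell p \<longleftrightarrow> p = (\<lceil>real K * fst z\<rceil>, \<lceil>real K * snd z\<rceil>)" for z p
  proof -
    have "(real_of_int i - 1) / K < x \<and> x \<le> of_int i / K \<longleftrightarrow> i = \<lceil>real K * x\<rceil>" for x i
      using K by (auto simp: field_simps ceiling_eq_iff eq_commute[of i])
    then show ?thesis by (cases p) (auto simp: mem_Times_iff)
  qed
  have J: "\<lceil>real K * x\<rceil> \<in> ?J \<longleftrightarrow> x \<in> {-real R<..real R}" for x
  proof -
    have "- int (R * K) < \<lceil>real K * x\<rceil> \<longleftrightarrow> - real R < x"
    proof -
      have "- int (R * K) < \<lceil>real K * x\<rceil> \<longleftrightarrow> (- real R) * real K < x * real K"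
        by (simp add: less_ceiling_iff mult.commute)
      also have "\<dots> \<longleftrightarrow> - real R < x" using K by (intro mult_less_cancel_right_pos) simp
      finally show ?thesis .
    qed
    moreover have "\<lceil>real K * x\<rceil> \<le> int (R * K) \<longleftrightarrow> x \<le> real R"
      using K by (simp add: ceiling_le_iff mult.commute)
    ultimately show ?thesis by simp
  qed
  have s_eq: "s z = (if z \<in> ?Q then f (\<lceil>real K * fst z\<rceil> / K, \<lceil>real K * snd z\<rceil> / K) else 0)" for z
  proof -
    have "s z = (\<Sum>p\<in>?J \<times> ?J. if p = (\<lceil>real K * fst z\<rceil>, \<lceil>real K * snd z\<rceil>) then ?c p else 0)"
      unfolding s_def by (intro sum.cong refl) (simp add: indicator_def cell)
    then show ?thesis using J[of "fst z"] J[of "snd z"] by (simp add: mem_Times_iff del: greaterThanAtMost_iff)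
  qed
  have si: "integrable \<gamma> s" unfolding s_def
    by (intro Bochner_Integration.integrable_sum integrable_mult_right) (auto simp: integrable_indicator_iff less_top[symmetric] intro!: T)
  have ints: "(\<integral>z. s z \<partial>\<gamma>) = (\<Sum>p\<in>?J \<times> ?J. ?c p * measure \<gamma> (?cell p))"
    unfolding s_def
    by (subst Bochner_Integration.integral_sum) 
      (auto simp: integrable_indicator_iff less_top[symmetric] T Int_absorb2 Marg_space[OF \<gamma>] intro!: T integrable_mult_right)
  have fm: "f \<in> borel_measurable \<gamma>"
    using borel_measurable_continuous_onI[OF f] by (simp add: measurable_cong_sets[OF s\<gamma> refl])
  have fi: "integrable \<gamma> f"
    by (rule integrable_const_bound[where B=B]) (use B fm in auto)
  have B0: "0 \<le> B" using B[of "(0, 0)"] by linarith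
  have pt: "\<bar>f z - s z\<bar> \<le> e + B * indicator (- ?Q) z" for z
  proof (cases "z \<in> ?Q")
    case True
    then show ?thesis using R[of "fst z" "snd z"] by (simp add: s_eq mem_Times_iff)
  next
    case False
    have "0 \<le> e" using tail(1) measure_nonneg[of \<mu>] by (meson order_trans)
    then show ?thesis using False B[of z] by (simp add: s_eq)
  qed
  have prob1: "measure \<gamma> UNIV = 1" using prob_space by (simp add: Marg_space[OF \<gamma>])
  have Qm: "- ?Q \<in> sets \<gamma>"
    using sets.compl_sets[OF T[of "{-real R<..real R}" "{-real R<..real R}"]]
    by (simp add: Marg_space[OF \<gamma>] Compl_eq_Diff_UNIV)
  have "\<bar>(\<integral>z. f z \<partial>\<gamma>) - (\<integral>z. s z \<partial>\<gamma>)\<bar> = \<bar>\<integral>z. f z - s z \<partial>\<gamma>\<bar>"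
    using fi si by simp
  also have "\<dots> \<le> (\<integral>z. \<bar>f z - s z\<bar> \<partial>\<gamma>)" by (rule integral_abs_bound)
  also have "\<dots> \<le> (\<integral>z. e + B * indicator (- ?Q) z \<partial>\<gamma>)"
    using fi si pt Qm by (intro integral_mono) (auto intro!: integrable_add integrable_mult_right simp: integrable_indicator_iff less_top[symmetric])
  also have "\<dots> = e + B * measure \<gamma> (- ?Q)"
    using Qm by (subst Bochner_Integration.integral_add) (auto intro!: integrable_mult_right simp: prob1 integrable_indicator_iff less_top[symmetric] Marg_space[OF \<gamma>])
  finally have le: "\<bar>(\<integral>z. f z \<partial>\<gamma>) - (\<integral>z. s z \<partial>\<gamma>)\<bar> \<le> e + B * measure \<gamma> (- ?Q)" .
  have "measure \<gamma> (- ?Q) \<le> 2 * e"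
  proof -
    have "measure \<gamma> (- ?Q) \<le> measure \<gamma> (((- {-real R<..real R}) \<times> UNIV) \<union> (UNIV \<times> (- {-real R<..real R})))"
      by (intro finite_measure_mono sets.Un T) auto
    also have "\<dots> \<le> measure \<gamma> ((- {-real R<..real R}) \<times> UNIV) + measure \<gamma> (UNIV \<times> (- {-real R<..real R}))"
      by (intro measure_Un_le T) auto
    also have "\<dots> \<le> 2 * e"
      using tail by (simp add: Marg_measure_fst[OF \<gamma>] Marg_measure_snd[OF \<gamma>])
    finally show ?thesis .
  qed
  then have "B * measure \<gamma> (- ?Q) \<le> B * (2 * e)" using B0 by (rule mult_left_mono)
  then have "\<bar>(\<integral>z. f z \<partial>\<gamma>) - (\<integral>z. s z \<partial>\<gamma>)\<bar> \<le> e + 2 * B * e" using le by simp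
  then show ?thesis unfolding ints .
qed

lemma measure_box_eq:
  assumes \<gamma>: "\<gamma> \<in> Marg \<mu> \<nu>" and "a \<le> b" "c \<le> d"
  shows "measure \<gamma> ({a<..b} \<times> {c<..d}) = measure \<gamma> ({..b} \<times> {..d}) - measure \<gamma> ({..a} \<times> {..d})
    - (measure \<gamma> ({..b} \<times> {..c}) - measure \<gamma> ({..a} \<times> {..c}))"
proof -
  interpret prob_space \<gamma> using \<gamma> by (rule Marg_prob_space)
  note T = Marg_sets_Times[OF \<gamma>]
  have strip: "measure \<gamma> ({a<..b} \<times> {..y}) = measure \<gamma> ({..b} \<times> {..y}) - measure \<gamma> ({..a} \<times> {..y})" for y
  proof -
    have eq: "{a<..b} \<times> {..y} = ({..b} \<times> {..y}) - ({..a} \<times> {..y})" using assms by auto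
    show ?thesis unfolding eq
      by (intro finite_measure_Diff T Sigma_mono order_refl) (use assms in simp_all)
  qed
  have eq: "{a<..b} \<times> {c<..d} = ({a<..b} \<times> {..d}) - ({a<..b} \<times> {..c})" using assms by auto
  have "measure \<gamma> ({a<..b} \<times> {c<..d}) = measure \<gamma> ({a<..b} \<times> {..d}) - measure \<gamma> ({a<..b} \<times> {..c})"
    unfolding eq by (intro finite_measure_Diff T Sigma_mono order_refl) (use assms in simp_all)
  then show ?thesis by (simp only: strip)
qed

text \<open>
  Convergence of the joint distribution functions at every point gives convergence of the masses
  of all half-open rectangles, hence of the integrals of grid functions.
\<close>

lemma weakly_converges_if_joint_cdf_converges:
  assumes \<gamma>: "\<And>n. \<gamma> n \<in> Marg \<mu> \<nu>" and \<pi>: "\<pi> \<in> Marg \<mu> \<nu>"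
    and conv: "\<And>a b. (\<lambda>n. measure (\<gamma> n) ({..a} \<times> {..b})) \<longlonglongrightarrow> measure \<pi> ({..a} \<times> {..b})"
  shows "weakly_converges \<gamma> \<pi>"
  unfolding weakly_converges_def
proof (intro allI impI, elim conjE)
  fix f :: "real \<times> real \<Rightarrow> real"
  assume f: "continuous_on UNIV f" and "bounded (range f)"
  then obtain B0 where B0: "\<And>z. \<bar>f z\<bar> \<le> B0" by (auto simp: bounded_iff)
  define B where "B = max B0 1"
  have B: "\<bar>f z\<bar> \<le> B" and B1: "1 \<le> B" for z using B0[of z] by (auto simp: B_def)
  interpret \<pi>: prob_space \<pi> using \<pi> by (rule Marg_prob_space)
  have tail: "\<exists>R0. \<forall>R\<ge>R0. measure \<rho> (- {-real R<..real R}) < e"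
    if "0 < e" "prob_space \<rho>" and sr: "sets \<rho> = sets borel" for \<rho> :: "real measure" and e
  proof -
    interpret prob_space \<rho> by fact
    have "(\<lambda>R. measure \<rho> (- {-real R<..real R})) \<longlonglongrightarrow> measure \<rho> (\<Inter>R. - {-real R<..real R})"
      by (intro finite_Lim_measure_decseq) (auto simp: sr decseq_def)
    moreover have "(\<Inter>R. - {-real R<..real R}) = ({} :: real set)"
    proof safe
      fix x :: real assume x: "x \<in> (\<Inter>R. - {-real R<..real R})"
      obtain R :: nat where "\<bar>x\<bar> < R" using reals_Archimedean2 by blast
      then have "x \<in> {-real R<..real R}" by auto
      then show "x \<in> {}" using x by blast
    qed
    ultimately have "(\<lambda>R. measure \<rho> (- {-real R<..real R})) \<longlonglongrightarrow> 0" by simp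
    from order_tendstoD(2)[OF this that(1)] show ?thesis by (simp add: eventually_sequentially)
  qed
  have "prob_space (distr \<pi> borel fst)" "prob_space (distr \<pi> borel snd)"
    using measurable_fst_snd_sets_borel[OF Marg_sets[OF \<pi>]] by (auto intro: \<pi>.prob_space_distr)
  moreover have "sets (distr \<pi> borel fst) = sets borel" "sets (distr \<pi> borel snd) = sets borel" by simp_all
  ultimately have prob: "prob_space \<mu>" "prob_space \<nu>" and sets: "sets \<mu> = sets borel" "sets \<nu> = sets borel"
    by (simp_all only: Marg_distr_fst[OF \<pi>] Marg_distr_snd[OF \<pi>])
  show "(\<lambda>n. integral\<^sup>L (\<gamma> n) f) \<longlonglongrightarrow> integral\<^sup>L \<pi> f"
  proof (rule LIMSEQ_I)
    fix r :: real assume r: "0 < r"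
    \<comment> \<open>two grid errors \<open>e + 2 * B * e\<close> and one comparison of grid sums\<close>
    define e where "e = r / (3 + 4 * B)"
    have e: "0 < e" using r B1 by (simp add: e_def)
    obtain R1 R2 where "\<forall>R\<ge>R1. measure \<mu> (- {-real R<..real R}) < e" "\<forall>R\<ge>R2. measure \<nu> (- {-real R<..real R}) < e"
      using tail[OF e prob(1) sets(1)] tail[OF e prob(2) sets(2)] by blast
    then have R: "measure \<mu> (- {-real R<..real R}) \<le> e" "measure \<nu> (- {-real R<..real R}) \<le> e" if "R = max R1 R2" for R
      using that by (auto intro!: less_imp_le)
    define R where "R = max R1 R2"
    let ?S = "cbox (-real R, -real R) (real R, real R)"
    have "uniformly_continuous_on ?S f"
      by (rule compact_uniformly_continuous[OF continuous_on_subset[OF f]]) auto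
    then obtain \<delta> where \<delta>: "0 < \<delta>" "\<And>z z'. \<lbrakk>z \<in> ?S; z' \<in> ?S; dist z' z < \<delta>\<rbrakk> \<Longrightarrow> dist (f z') (f z) < e"
      unfolding uniformly_continuous_on_def using e by metis
    obtain K :: nat where K: "2 / \<delta> < real K" using reals_Archimedean2 by blast
    have K0: "0 < real K" using \<delta>(1) K by (meson divide_pos_pos less_trans zero_less_numeral)
    have K1: "2 / K < \<delta>" using \<delta>(1) K K0 by (simp add: field_simps)
    have round: "-real R \<le> \<lceil>real K * x\<rceil> / K \<and> \<lceil>real K * x\<rceil> / K \<le> R \<and> \<bar>x - \<lceil>real K * x\<rceil> / K\<bar> < 1 / K"
      if "-real R < x" "x \<le> R" for x :: real
    proof -
      have "real K * x \<le> real K * R" using that K0 by simp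
      then have "\<lceil>real K * x\<rceil> \<le> int (K * R)" by (simp add: ceiling_le_iff)
      then have "real_of_int \<lceil>real K * x\<rceil> \<le> real_of_int (int (K * R))" by (rule of_int_le_iff[THEN iffD2])
      then have "\<lceil>real K * x\<rceil> / K \<le> R" using K0 by (simp add: field_simps)
      moreover have "x \<le> \<lceil>real K * x\<rceil> / K" using K0 le_of_int_ceiling[of "real K * x"] by (simp add: field_simps)
      moreover have "\<lceil>real K * x\<rceil> / K < x + 1 / K" using K0 ceiling_correct[of "real K * x"] by (simp add: field_simps)
      ultimately show ?thesis using that by (intro conjI; linarith)
    qed
    have unif: "\<bar>f (x, y) - f (\<lceil>real K * x\<rceil> / K, \<lceil>real K * y\<rceil> / K)\<bar> \<le> e"
      if "-real R < x" "x \<le> R" "-real R < y" "y \<le> R" for x y :: real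
    proof -
      have "dist (x, y) (\<lceil>real K * x\<rceil> / K, \<lceil>real K * y\<rceil> / K) \<le> \<bar>x - \<lceil>real K * x\<rceil> / K\<bar> + \<bar>y - \<lceil>real K * y\<rceil> / K\<bar>"
        unfolding dist_Pair_Pair dist_real_def by (rule sqrt_sum_squares_le_sum) simp_all
      also have "\<dots> < 1 / K + 1 / K" using round[OF that(1,2)] round[OF that(3,4)] by linarith
      also have "\<dots> < \<delta>" using K1 by simp
      finally have "dist (f (x, y)) (f (\<lceil>real K * x\<rceil> / K, \<lceil>real K * y\<rceil> / K)) < e"
      proof (intro \<delta>(2))
        show "(x, y) \<in> ?S" using that by (simp add: cbox_Pair_eq less_imp_le)
        show "(\<lceil>real K * x\<rceil> / K, \<lceil>real K * y\<rceil> / K) \<in> ?S"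
          using round[OF that(1,2)] round[OF that(3,4)] by (simp add: cbox_Pair_eq)
      qed
      then show ?thesis by (simp add: dist_real_def)
    qed
    let ?J = "{- int (R * K)<..int (R * K)}"
    let ?cell = "\<lambda>p. {(real_of_int (fst p) - 1) / K<..of_int (fst p) / K} \<times> {(real_of_int (snd p) - 1) / K<..of_int (snd p) / K}"
    let ?s = "\<lambda>\<gamma>. (\<Sum>p\<in>?J \<times> ?J. f (real_of_int (fst p) / K, real_of_int (snd p) / K) * measure \<gamma> (?cell p))"
    have approx: "\<bar>(\<integral>z. f z \<partial>\<rho>) - ?s \<rho>\<bar> \<le> e + 2 * B * e" if "\<rho> \<in> Marg \<mu> \<nu>" for \<rho>
      using K0 by (intro grid_approximation[OF that f B _ unif] R) (auto simp: R_def)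
    have "(\<lambda>n. ?s (\<gamma> n)) \<longlonglongrightarrow> ?s \<pi>"
    proof (intro tendsto_sum tendsto_mult tendsto_const)
      fix p :: "int \<times> int"
      have le: "(real_of_int i - 1) / K \<le> of_int i / K" for i using K0 by (simp add: divide_right_mono)
      show "(\<lambda>n. measure (\<gamma> n) (?cell p)) \<longlonglongrightarrow> measure \<pi> (?cell p)"
        unfolding measure_box_eq[OF \<gamma> le le] measure_box_eq[OF \<pi> le le] by (intro tendsto_diff conv)
    qed
    from LIMSEQ_D[OF this e, unfolded real_norm_def]
    obtain N where N: "\<And>n. N \<le> n \<Longrightarrow> \<bar>?s (\<gamma> n) - ?s \<pi>\<bar> < e" by blast
    have "norm (integral\<^sup>L (\<gamma> n) f - integral\<^sup>L \<pi> f) < r" if "N \<le> n" for n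
    proof -
      have "\<bar>integral\<^sup>L (\<gamma> n) f - integral\<^sup>L \<pi> f\<bar> < e + 2 * B * e + e + (e + 2 * B * e)"
        using approx[OF \<gamma>[of n]] approx[OF \<pi>] N[OF that] by linarith
      also have "\<dots> = (3 + 4 * B) * e" by (simp add: algebra_simps)
      also have "\<dots> = r" using B1 by (simp add: e_def)
      finally show ?thesis by simp
    qed
    then show "\<exists>no. \<forall>n\<ge>no. norm (integral\<^sup>L (\<gamma> n) f - integral\<^sup>L \<pi> f) < r" by blast
  qed
qed

section \<open>Plans with maximal flow\<close>

text \<open>
  The first part says that there is no excess. The second part says that the flow over \<open>[a, b]\<close>
  is not smaller than the infimum of \<open>F\<^sup>+\<close> over \<open>[a, b]\<close>; it is phrased with lower bounds \<open>h\<close> so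
  that no infimum has to be formed.
\<close>

definition maximal_flow :: "(real \<Rightarrow> real) \<Rightarrow> (real \<times> real) measure \<Rightarrow> bool" where
  "maximal_flow F \<pi> \<longleftrightarrow> (\<forall>u. flow \<pi> u u \<le> max 0 (F u))
     \<and> (\<forall>a b h. a \<le> b \<longrightarrow> (\<forall>u\<in>{a..b}. h \<le> max 0 (F u)) \<longrightarrow> h \<le> flow \<pi> a b)"

lemma excess_zero_if_maximal_flow:
  assumes "\<pi> \<in> Marg \<mu> \<nu>" "maximal_flow (F_diff \<mu> \<nu>) \<pi>"
  shows "excess \<pi> u = 0"
proof -
  have "flow \<pi> u u \<le> max 0 (F_diff \<mu> \<nu> u)" using assms(2) by (simp add: maximal_flow_def)
  then show ?thesis
    using excess_nonneg[OF assms(1), of u] flow_eq_excess(1)[OF assms(1), of u] by linarith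
qed

lemma T_cost_1_eq_add_excess:
  assumes "\<pi> \<in> Marg \<mu> \<nu>" "maximal_flow (F_diff \<mu> \<nu>) \<pi>" "\<gamma> \<in> Marg \<mu> \<nu>"
  shows "T_cost 1 \<gamma> = T_cost 1 \<pi> + 2 * (\<integral>\<^sup>+ u. ennreal (excess \<gamma> u) \<partial>lborel)"
  unfolding T_cost_1_eq[OF assms(1)] T_cost_1_eq[OF assms(3)] excess_zero_if_maximal_flow[OF assms(1,2)]
  by (simp only: ennreal_0 nn_integral_const mult_zero_left mult_zero_right add_0_right)

lemma measure_Ioc_small:
  fixes u :: real
  assumes "prob_space \<mu>" "sets \<mu> = sets borel" and \<epsilon>: "0 < \<epsilon>"
  shows "\<exists>\<delta>0>0. \<forall>\<delta>. 0 < \<delta> \<and> \<delta> \<le> \<delta>0 \<longrightarrow> measure \<mu> {u<..u+\<delta>} < \<epsilon>"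
proof -
  interpret prob_space \<mu> by fact
  have "(\<lambda>n. measure \<mu> {u<..u + 1 / Suc n}) \<longlonglongrightarrow> measure \<mu> (\<Inter>n. {u<..u + 1 / Suc n})"
  proof (intro finite_Lim_measure_decseq decseq_SucI)
    fix n :: nat
    have "1 / real (Suc (Suc n)) \<le> 1 / real (Suc n)" by (simp add: frac_le)
    then show "{u<..u + 1 / Suc (Suc n)} \<subseteq> {u<..u + 1 / Suc n}"
      by (intro subsetI) (unfold greaterThanAtMost_iff, linarith)
  qed (auto simp: assms)
  moreover have "(\<Inter>n. {u<..u + 1 / Suc n}) = {}"
  proof (intro equals0I)
    fix x assume x: "x \<in> (\<Inter>n. {u<..u + 1 / Suc n})"
    then have "u < x" by auto
    then obtain n where "1 / Suc n < x - u" using nat_approx_posE[of "x - u"] by auto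
    moreover have "x \<le> u + 1 / Suc n" using x by auto
    ultimately show False by linarith
  qed
  ultimately have "(\<lambda>n. measure \<mu> {u<..u + 1 / Suc n}) \<longlonglongrightarrow> 0" by simp
  from order_tendstoD(2)[OF this \<epsilon>] obtain n where n: "measure \<mu> {u<..u + 1 / Suc n} < \<epsilon>"
    by (auto simp: eventually_sequentially)
  have "measure \<mu> {u<..u + \<delta>} < \<epsilon>" if "\<delta> \<le> 1 / Suc n" for \<delta>
    by (rule le_less_trans[OF finite_measure_mono n]) (use that in \<open>auto simp: assms\<close>)
  then show ?thesis by (intro exI[of _ "1 / Suc n"]) auto
qed

text \<open>
  Choose \<open>\<delta>\<close> such that the marginals charge \<open>]u, u + \<delta>]\<close> with little mass; then
  \<open>excess_le_nn_integral\<close> applies.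
\<close>

lemma excess_tendsto_zero:
  assumes \<gamma>: "\<And>n. \<gamma> n \<in> Marg \<mu> \<nu>"
    and lim: "\<And>e. 0 < e \<Longrightarrow> \<forall>\<^sub>F n in sequentially. (\<integral>\<^sup>+ u. ennreal (excess (\<gamma> n) u) \<partial>lborel) \<le> ennreal e"
    and prob: "prob_space \<mu>" "prob_space \<nu>" and sets: "sets \<mu> = sets borel" "sets \<nu> = sets borel"
  shows "(\<lambda>n. excess (\<gamma> n) u) \<longlonglongrightarrow> 0"
proof (rule order_tendstoI)
  fix c :: real assume "c < 0"
  then show "\<forall>\<^sub>F n in sequentially. c < excess (\<gamma> n) u"
    using excess_nonneg[OF \<gamma>] by (intro always_eventually) (auto intro: less_le_trans)
next
  fix c :: real assume c: "0 < c"
  obtain d1 d2 where d1: "0 < d1" "\<And>\<delta>. 0 < \<delta> \<Longrightarrow> \<delta> \<le> d1 \<Longrightarrow> measure \<mu> {u<..u+\<delta>} < c / 4"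
    and d2: "0 < d2" "\<And>\<delta>. 0 < \<delta> \<Longrightarrow> \<delta> \<le> d2 \<Longrightarrow> measure \<nu> {u<..u+\<delta>} < c / 4"
    using measure_Ioc_small[OF prob(1) sets(1), of "c / 4" u] measure_Ioc_small[OF prob(2) sets(2), of "c / 4" u] c
    by (auto 4 4)
  define \<delta> where "\<delta> = min d1 d2"
  have \<delta>: "0 < \<delta>" "measure \<mu> {u<..u+\<delta>} < c / 4" "measure \<nu> {u<..u+\<delta>} < c / 4"
    using d1 d2 by (auto simp: \<delta>_def)
  have "0 < \<delta> * c / 4" using \<delta>(1) c by simp
  from lim[OF this] show "\<forall>\<^sub>F n in sequentially. excess (\<gamma> n) u < c"
  proof eventually_elim
    case (elim n)
    have "ennreal (\<delta> * (excess (\<gamma> n) u - measure \<mu> {u<..u+\<delta>} - measure \<nu> {u<..u+\<delta>})) \<le> ennreal (\<delta> * c / 4)"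
      using excess_le_nn_integral[OF \<gamma> \<delta>(1)] elim by (rule order_trans)
    then have "\<delta> * (excess (\<gamma> n) u - measure \<mu> {u<..u+\<delta>} - measure \<nu> {u<..u+\<delta>}) \<le> \<delta> * (c / 4)"
      using \<delta>(1) c by (subst (asm) ennreal_le_iff) auto
    then have "excess (\<gamma> n) u - measure \<mu> {u<..u+\<delta>} - measure \<nu> {u<..u+\<delta>} \<le> c / 4"
      using \<delta>(1) by simp
    then show ?case using \<delta>(2,3) c by linarith
  qed
qed

text \<open>
  A continuous concave function on the half-line that vanishes at \<open>0\<close> and has slope \<open>0\<close> at
  infinity is a mixture of the functions \<open>d \<mapsto> min d t\<close> with weight the negative of its second
  derivative at \<open>t\<close>.
\<close>

lemma powr_eq_nn_integral_min:
  fixes d q :: real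
  assumes q: "0 < q" "q < 1" and d: "0 \<le> d"
  shows "ennreal (d powr q) = (\<integral>\<^sup>+ t. ennreal (q * (1 - q) * t powr (q - 2)) * indicator {0<..} t * ennreal (min d t) \<partial>lborel)"
proof (cases "d = 0")
  case True
  have "(\<integral>\<^sup>+ t. ennreal (q * (1 - q) * t powr (q - 2)) * indicator {0<..} t * ennreal (min d t) \<partial>lborel) = (\<integral>\<^sup>+ t. 0 \<partial>(lborel :: real measure))"
    by (intro nn_integral_cong) (auto simp: True indicator_def min_def)
  then show ?thesis using True by simp
next
  case False
  with d have d: "0 < d" by simp
  have "(\<integral>\<^sup>+ t. ennreal (q * (1 - q) * t powr (q - 2)) * indicator {0<..} t * ennreal (min d t) \<partial>lborel)
     = (\<integral>\<^sup>+ t. ennreal (q * (1 - q) * (indicator {0..d} t * t powr (q - 1))) + ennreal (q * (1 - q) * d * (indicator {d..} t * t powr (q - 2))) \<partial>lborel)"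
  proof (rule nn_integral_cong_AE)
    have "AE t in lborel. t \<noteq> d" by (rule AE_lborel_singleton)
    then show "AE t in lborel. ennreal (q * (1 - q) * t powr (q - 2)) * indicator {0<..} t * ennreal (min d t)
       = ennreal (q * (1 - q) * (indicator {0..d} t * t powr (q - 1))) + ennreal (q * (1 - q) * d * (indicator {d..} t * t powr (q - 2)))"
    proof eventually_elim
      case (elim t)
      have w: "0 \<le> q * (1 - q) * t powr (q - 2)" using q by simp
      consider "t \<le> 0" | "0 < t" "t < d" | "d < t" using elim by linarith
      then show ?case
      proof cases
        case 1
        then have "indicator {0..d} t * t powr (q - 1) = 0" "indicator {d..} t * t powr (q - 2) = 0"
          using d by (auto simp: indicator_def)
        then show ?thesis using 1 by (simp only:) (simp add: indicator_def)
      next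
        case 2
        then have "t powr (q - 1) = t powr (q - 2) * t"
          using powr_mult_base[of t "q - 2"] by (simp add: mult.commute)
        then have "ennreal (q * (1 - q) * t powr (q - 1)) = ennreal (q * (1 - q) * t powr (q - 2)) * ennreal t"
          using w by (simp add: ennreal_mult'[symmetric] mult.assoc)
        then show ?thesis using 2 by (simp add: indicator_def min_def)
      next
        case 3
        have "ennreal (q * (1 - q) * d * t powr (q - 2)) = ennreal (q * (1 - q) * t powr (q - 2)) * ennreal d"
          using d by (subst ennreal_mult''[symmetric]) (auto simp: mult_ac)
        then show ?thesis using 3 d by (simp add: indicator_def min_def)
      qed
    qed
  qed
  also have "\<dots> = (\<integral>\<^sup>+ t. ennreal (q * (1 - q) * (indicator {0..d} t * t powr (q - 1))) \<partial>lborel)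
     + (\<integral>\<^sup>+ t. ennreal (q * (1 - q) * d * (indicator {d..} t * t powr (q - 2))) \<partial>lborel)"
    by (rule nn_integral_add) measurable
  also have "(\<integral>\<^sup>+ t. ennreal (q * (1 - q) * (indicator {0..d} t * t powr (q - 1))) \<partial>lborel) = ennreal (q * (1 - q) * (d powr q / q))"
  proof (rule nn_integral_has_integral_lborel)
    have "((\<lambda>t. t powr (q - 1)) has_integral (d powr q / q)) {0..d}"
      using has_integral_powr_from_0[of "q - 1" d] q d by simp
    then have "((\<lambda>t. if t \<in> {0..d} then t powr (q - 1) else 0) has_integral (d powr q / q)) UNIV"
      by (simp only: has_integral_restrict_UNIV)
    moreover have "(\<lambda>t. if t \<in> {0..d} then t powr (q - 1) else 0) = (\<lambda>t. indicator {0..d} t * t powr (q - 1))"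
      by (auto simp: indicator_def)
    ultimately show "((\<lambda>t. q * (1 - q) * (indicator {0..d} t * t powr (q - 1))) has_integral q * (1 - q) * (d powr q / q)) UNIV"
      by (intro has_integral_mult_right) simp
  qed (use q in auto)
  also have "(\<integral>\<^sup>+ t. ennreal (q * (1 - q) * d * (indicator {d..} t * t powr (q - 2))) \<partial>lborel) = ennreal (q * (1 - q) * d * (d powr (q - 1) / (1 - q)))"
  proof (rule nn_integral_has_integral_lborel)
    have "((\<lambda>t. t powr (q - 2)) has_integral - (d powr (q - 2 + 1)) / (q - 2 + 1)) {d..}"
      using q d by (intro has_integral_powr_to_inf) auto
    moreover have "- (d powr (q - 2 + 1)) / (q - 2 + 1) = d powr (q - 1) / (1 - q)"
      using q by (simp add: divide_simps algebra_simps)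
    ultimately have "((\<lambda>t. if t \<in> {d..} then t powr (q - 2) else 0) has_integral (d powr (q - 1) / (1 - q))) UNIV"
      by (simp only: has_integral_restrict_UNIV)
    moreover have "(\<lambda>t. if t \<in> {d..} then t powr (q - 2) else 0) = (\<lambda>t. indicator {d..} t * t powr (q - 2))"
      by (auto simp: indicator_def)
    ultimately show "((\<lambda>t. q * (1 - q) * d * (indicator {d..} t * t powr (q - 2))) has_integral q * (1 - q) * d * (d powr (q - 1) / (1 - q))) UNIV"
      by (intro has_integral_mult_right) simp
  qed (use q d in auto)
  also have "ennreal (q * (1 - q) * (d powr q / q)) + ennreal (q * (1 - q) * d * (d powr (q - 1) / (1 - q)))
    = ennreal (d powr q)"
  proof -
    have "d powr q = d * d powr (q - 1)" using powr_mult_base[of d "q - 1"] d by simp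
    then have "q * (1 - q) * d * (d powr (q - 1) / (1 - q)) = q * d powr q" using q by simp
    moreover have "q * (1 - q) * (d powr q / q) = (1 - q) * d powr q" using q by simp
    ultimately have "q * (1 - q) * (d powr q / q) + q * (1 - q) * d * (d powr (q - 1) / (1 - q)) = d powr q"
      by (simp only: left_diff_distrib mult_1)
    then show ?thesis using q d by (subst ennreal_plus[symmetric]) auto
  qed
  finally show ?thesis by simp
qed

text \<open>
  From \<open>min d t = d - (d - t)\<^sup>+\<close> and \<open>powr_eq_nn_integral_min\<close>. Finiteness of the cost for
  \<open>p = 1\<close> is what allows the subtraction.
\<close>

lemma T_cost_le_if_excess_over_length_le:
  assumes \<gamma>: "\<gamma> \<in> Marg \<mu> \<nu>" and \<pi>: "\<pi> \<in> Marg \<mu> \<nu>" and q: "0 < q" "q < 1"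
    and fin: "T_cost 1 \<pi> < \<infinity>" and eq: "T_cost 1 \<gamma> = T_cost 1 \<pi>"
    and le: "\<And>t. 0 \<le> t \<Longrightarrow> (\<integral>\<^sup>+ (x, y). ennreal (\<bar>x - y\<bar> - t) \<partial>\<gamma>) \<le> (\<integral>\<^sup>+ (x, y). ennreal (\<bar>x - y\<bar> - t) \<partial>\<pi>)"
  shows "T_cost q \<pi> \<le> T_cost q \<gamma>"
proof -
  let ?w = "\<lambda>t. ennreal (q * (1 - q) * t powr (q - 2)) * indicator {0<..} t"
  let ?m = "\<lambda>\<rho> t. (\<integral>\<^sup>+ z. ennreal (min \<bar>fst z - snd z\<bar> t) \<partial>\<rho>)"
  have T: "T_cost q \<rho> = (\<integral>\<^sup>+ t. ?w t * ?m \<rho> t \<partial>lborel)" if \<rho>: "\<rho> \<in> Marg \<mu> \<nu>" for \<rho>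
  proof -
    interpret prob_space \<rho> using \<rho> by (rule Marg_prob_space)
    have [measurable_cong]: "sets \<rho> = sets borel" using \<rho> by (rule Marg_sets)
    interpret P: pair_sigma_finite lborel \<rho> ..
    have "T_cost q \<rho> = (\<integral>\<^sup>+ z. (\<integral>\<^sup>+ t. ?w t * ennreal (min \<bar>fst z - snd z\<bar> t) \<partial>lborel) \<partial>\<rho>)"
      unfolding T_cost_def by (simp add: split_beta' powr_eq_nn_integral_min[OF q, symmetric])
    also have "\<dots> = (\<integral>\<^sup>+ t. (\<integral>\<^sup>+ z. ?w t * ennreal (min \<bar>fst z - snd z\<bar> t) \<partial>\<rho>) \<partial>lborel)"
      by (rule P.Fubini'[where f="\<lambda>t z. ?w t * ennreal (min \<bar>fst z - snd z\<bar> t)"]) measurable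
    also have "\<dots> = (\<integral>\<^sup>+ t. ?w t * ?m \<rho> t \<partial>lborel)"
      by (intro nn_integral_cong nn_integral_cmult) measurable
    finally show ?thesis .
  qed
  have m: "?m \<pi> t \<le> ?m \<gamma> t" if t: "0 < t" for t
  proof -
    let ?I = "\<lambda>\<rho>. (\<integral>\<^sup>+ (x, y). ennreal (\<bar>x - y\<bar> - t) \<partial>\<rho>)"
    have split: "T_cost 1 \<rho> = ?m \<rho> t + ?I \<rho>" if \<rho>: "\<rho> \<in> Marg \<mu> \<nu>" for \<rho>
    proof -
      have [measurable_cong]: "sets \<rho> = sets borel" using \<rho> by (rule Marg_sets)
      have "?m \<rho> t + ?I \<rho> = (\<integral>\<^sup>+ z. ennreal (min \<bar>fst z - snd z\<bar> t) + ennreal (\<bar>fst z - snd z\<bar> - t) \<partial>\<rho>)"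
        unfolding split_beta' by (rule nn_integral_add[symmetric]) measurable
      also have "\<dots> = T_cost 1 \<rho>"
        unfolding T_cost_def split_beta'
      proof (intro nn_integral_cong)
        fix z :: "real \<times> real"
        show "ennreal (min \<bar>fst z - snd z\<bar> t) + ennreal (\<bar>fst z - snd z\<bar> - t) = ennreal (\<bar>fst z - snd z\<bar> powr 1)"
          using t by (cases "\<bar>fst z - snd z\<bar> \<le> t") (auto simp: min_def ennreal_neg ennreal_plus[symmetric] simp del: ennreal_plus)
      qed
      finally show ?thesis by simp
    qed
    have "?m \<pi> t + ?I \<pi> = ?m \<gamma> t + ?I \<gamma>" using split[OF \<pi>] split[OF \<gamma>] eq by simp
    also have "\<dots> \<le> ?m \<gamma> t + ?I \<pi>" using le[of t] t by (intro add_left_mono) simp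
    finally have "?I \<pi> + ?m \<pi> t \<le> ?I \<pi> + ?m \<gamma> t" by (simp only: add.commute)
    moreover have "?I \<pi> \<noteq> \<infinity>" using fin unfolding split[OF \<pi>] by auto
    ultimately show ?thesis by (auto simp only: ennreal_add_left_cancel_le)
  qed
  have "?w t * ?m \<pi> t \<le> ?w t * ?m \<gamma> t" for t
  proof (cases "0 < t")
    case True
    show ?thesis by (rule mult_left_mono[OF m[OF True]]) simp
  qed simp
  then show ?thesis unfolding T[OF \<pi>] T[OF \<gamma>] by (rule nn_integral_mono)
qed

lemma P1_prob_space: "\<mu> \<in> P1 \<Longrightarrow> prob_space \<mu>"
  and P1_sets: "\<mu> \<in> P1 \<Longrightarrow> sets \<mu> = sets borel"
  unfolding P1_def by simp_all

text \<open>
  A plan that is optimal for the distance has no excess, so its flow over \<open>[a, b]\<close> is at most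
  \<open>F\<^sup>+\<close> (or \<open>F\<^sup>-\<close>) at each point of \<open>[a, b]\<close> and hence at most the maximal flow.
\<close>

lemma maximal_flow_imp_optimal:
  assumes \<mu>\<nu>: "\<mu> \<in> P1" "\<nu> \<in> P1" and \<pi>: "\<pi> \<in> Marg \<mu> \<nu>"
    and max1: "maximal_flow (F_diff \<mu> \<nu>) \<pi>" and max2: "maximal_flow (\<lambda>u. - F_diff \<mu> \<nu> u) (transpose_plan \<pi>)"
  shows "\<pi> \<in> Marg_opt 1 \<mu> \<nu>"
    and "\<lbrakk>\<gamma> \<in> Marg_opt 1 \<mu> \<nu>; 0 < q; q < 1\<rbrakk> \<Longrightarrow> T_cost q \<pi> \<le> T_cost q \<gamma>"
proof -
  show opt: "\<pi> \<in> Marg_opt 1 \<mu> \<nu>"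
    unfolding Marg_opt_def
  proof (intro CollectI conjI ballI \<pi>)
    fix \<pi>' assume "\<pi>' \<in> Marg \<mu> \<nu>"
    then show "T_cost 1 \<pi> \<le> T_cost 1 \<pi>'"
      unfolding T_cost_1_eq_add_excess[OF \<pi> max1 \<open>\<pi>' \<in> Marg \<mu> \<nu>\<close>] by simp
  qed
  have fin: "T_cost 1 \<pi> < \<infinity>" by (rule T_cost_finite[OF \<mu>\<nu> \<pi>]) auto
  assume \<gamma>o: "\<gamma> \<in> Marg_opt 1 \<mu> \<nu>" and q: "0 < q" "q < 1"
  then have \<gamma>: "\<gamma> \<in> Marg \<mu> \<nu>" and eq: "T_cost 1 \<gamma> = T_cost 1 \<pi>"
    using opt by (auto simp: Marg_opt_def intro: antisym)
  have "(\<integral>\<^sup>+ u. ennreal (excess \<gamma> u) \<partial>lborel) = 0"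
  proof -
    have "T_cost 1 \<pi> + 2 * (\<integral>\<^sup>+ u. ennreal (excess \<gamma> u) \<partial>lborel) = T_cost 1 \<pi> + 0"
      unfolding T_cost_1_eq_add_excess[OF \<pi> max1 \<gamma>, symmetric] using eq by simp
    then show ?thesis using fin by (simp only: ennreal_add_left_cancel) auto
  qed
  then have "(\<lambda>n::nat. excess \<gamma> u) \<longlonglongrightarrow> 0" for u
    by (intro excess_tendsto_zero[where \<gamma> = "\<lambda>n. \<gamma>", OF \<gamma> _ P1_prob_space[OF \<mu>\<nu>(1)]
        P1_prob_space[OF \<mu>\<nu>(2)] P1_sets[OF \<mu>\<nu>(1)] P1_sets[OF \<mu>\<nu>(2)]]) simp
  then have exc: "excess \<gamma> u = 0" for u
    using LIMSEQ_unique tendsto_const by blast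
  have le1: "flow \<gamma> a b \<le> flow \<pi> a b" if "a \<le> b" for a b
  proof -
    have "flow \<gamma> a b \<le> max 0 (F_diff \<mu> \<nu> u)" if "u \<in> {a..b}" for u
      using flow_mono[OF \<gamma>, of a u u b] that flow_eq_excess(1)[OF \<gamma>, of u] exc[of u] by simp
    then show ?thesis using max1 that by (simp add: maximal_flow_def)
  qed
  have le2: "flow (transpose_plan \<gamma>) a b \<le> flow (transpose_plan \<pi>) a b" if "a \<le> b" for a b
  proof -
    have "flow (transpose_plan \<gamma>) a b \<le> max 0 (- F_diff \<mu> \<nu> u)" if "u \<in> {a..b}" for u
      using flow_mono[OF transpose_plan_Marg[OF \<gamma>], of a u u b] that flow_eq_excess(2)[OF \<gamma>, of u] exc[of u] by simp
    then show ?thesis using max2 that by (simp add: maximal_flow_def)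
  qed
  show "T_cost q \<pi> \<le> T_cost q \<gamma>"
  proof (rule T_cost_le_if_excess_over_length_le[OF \<gamma> \<pi> q fin eq])
    fix t :: real assume t: "0 \<le> t"
    show "(\<integral>\<^sup>+ (x, y). ennreal (\<bar>x - y\<bar> - t) \<partial>\<gamma>) \<le> (\<integral>\<^sup>+ (x, y). ennreal (\<bar>x - y\<bar> - t) \<partial>\<pi>)"
      unfolding nn_integral_excess_over_length[OF \<gamma> t] nn_integral_excess_over_length[OF \<pi> t]
      using t by (intro nn_integral_mono ennreal_leI add_mono le1 le2) auto
  qed
qed

text \<open>
  The lower bound \<open>noncrossing_le_flow\<close> holds for every \<open>n\<close>. For the upper bound, compare with
  the pointwise flow at a point \<open>u\<close> where \<open>F\<^sup>+\<close> is almost minimal.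
\<close>

lemma flow_tendsto_maximal_flow:
  assumes \<gamma>: "\<And>n. \<gamma> n \<in> Marg \<mu> \<nu>" and nc: "\<And>n. noncrossing (\<gamma> n)"
    and exc: "\<And>u. (\<lambda>n. excess (\<gamma> n) u) \<longlonglongrightarrow> 0"
    and \<pi>: "\<pi> \<in> Marg \<mu> \<nu>" and mf: "maximal_flow (F_diff \<mu> \<nu>) \<pi>" and ab: "a \<le> b"
  shows "(\<lambda>n. flow (\<gamma> n) a b) \<longlonglongrightarrow> flow \<pi> a b"
proof (rule order_tendstoI)
  fix c assume c: "c < flow \<pi> a b"
  have "flow \<pi> a b \<le> flow (\<gamma> n) a b" for n
  proof (rule noncrossing_le_flow[OF \<gamma> nc ab])
    fix u assume u: "a \<le> u" "u \<le> b"
    have "flow \<pi> a b \<le> flow \<pi> u u" using u by (intro flow_mono[OF \<pi>])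
    also have "\<dots> \<le> max 0 (F_diff \<mu> \<nu> u)" using mf by (simp add: maximal_flow_def)
    also have "\<dots> \<le> flow (\<gamma> n) u u"
      unfolding flow_eq_excess(1)[OF \<gamma>] using excess_nonneg[OF \<gamma>[of n], of u] by simp
    finally show "flow \<pi> a b \<le> flow (\<gamma> n) u u" .
  qed
  then show "\<forall>\<^sub>F n in sequentially. c < flow (\<gamma> n) a b"
    using c by (intro always_eventually allI) (rule less_le_trans)
next
  fix c assume c: "flow \<pi> a b < c"
  have "\<exists>u\<in>{a..b}. max 0 (F_diff \<mu> \<nu> u) < c"
  proof (rule ccontr)
    assume "\<not> ?thesis"
    then have "\<forall>u\<in>{a..b}. c \<le> max 0 (F_diff \<mu> \<nu> u)" by (auto simp: not_less)
    then have "c \<le> flow \<pi> a b" using mf ab unfolding maximal_flow_def by blast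
    then show False using c by simp
  qed
  then obtain u where u: "a \<le> u" "u \<le> b" "max 0 (F_diff \<mu> \<nu> u) < c" by auto
  have "(\<lambda>n. max 0 (F_diff \<mu> \<nu> u) + excess (\<gamma> n) u) \<longlonglongrightarrow> max 0 (F_diff \<mu> \<nu> u) + 0"
    by (intro tendsto_intros exc)
  then have "\<forall>\<^sub>F n in sequentially. max 0 (F_diff \<mu> \<nu> u) + excess (\<gamma> n) u < c"
    using u by (intro order_tendstoD(2)) auto
  then show "\<forall>\<^sub>F n in sequentially. flow (\<gamma> n) a b < c"
  proof eventually_elim
    case (elim n)
    have "flow (\<gamma> n) a b \<le> flow (\<gamma> n) u u" using u by (intro flow_mono[OF \<gamma>])
    also have "\<dots> < c" unfolding flow_eq_excess(1)[OF \<gamma>] by (rule elim)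
    finally show ?case .
  qed
qed

text \<open>
  Convexity of the exponential function between \<open>0\<close> and \<open>ln d\<close>.
\<close>

lemma powr_le_affine:
  fixes d p :: real
  assumes "0 < p" "p < 1" "0 \<le> d"
  shows "d powr p \<le> p * d + (1 - p)"
proof (cases "d = 0")
  case False
  then have d: "0 < d" using assms by simp
  have "exp ((1 - p) *\<^sub>R 0 + p *\<^sub>R ln d) \<le> (1 - p) * exp 0 + p * exp (ln d)"
    using assms by (intro convex_onD[OF exp_convex]) auto
  then show ?thesis using d by (simp add: powr_def mult.commute)
qed (use assms in auto)

lemma T_cost_le_affine:
  assumes \<pi>: "\<pi> \<in> Marg \<mu> \<nu>" and p: "0 < p" "p < 1" and W: "T_cost 1 \<pi> = ennreal W" "0 \<le> W"
  shows "T_cost p \<pi> \<le> ennreal (p * W + (1 - p))"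
proof -
  interpret prob_space \<pi> using \<pi> by (rule Marg_prob_space)
  have [measurable_cong]: "sets \<pi> = sets borel" using \<pi> by (rule Marg_sets)
  have "T_cost p \<pi> \<le> (\<integral>\<^sup>+ z. ennreal p * ennreal \<bar>fst z - snd z\<bar> + ennreal (1 - p) \<partial>\<pi>)"
    unfolding T_cost_def split_beta'
  proof (rule nn_integral_mono)
    fix z :: "real \<times> real"
    have "ennreal (\<bar>fst z - snd z\<bar> powr p) \<le> ennreal (p * \<bar>fst z - snd z\<bar> + (1 - p))"
      using p by (intro ennreal_leI powr_le_affine) auto
    then show "ennreal (\<bar>fst z - snd z\<bar> powr p) \<le> ennreal p * ennreal \<bar>fst z - snd z\<bar> + ennreal (1 - p)"
      using p by (simp add: ennreal_mult)
  qed
  also have "\<dots> = ennreal p * (\<integral>\<^sup>+ z. ennreal \<bar>fst z - snd z\<bar> \<partial>\<pi>) + ennreal (1 - p)"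
    by (subst nn_integral_add, simp, simp, subst nn_integral_cmult) (simp_all add: emeasure_space_1)
  also have "(\<integral>\<^sup>+ z. ennreal \<bar>fst z - snd z\<bar> \<partial>\<pi>) = ennreal W"
    using W(1) by (simp add: T_cost_def split_beta')
  also have "ennreal p * ennreal W + ennreal (1 - p) = ennreal (p * W + (1 - p))"
    using p W(2) by (simp add: ennreal_mult)
  finally show ?thesis .
qed

text \<open>
  For \<open>\<bar>x - y\<bar> > M\<close> one of \<open>2\<bar>x\<bar>\<close> and \<open>2\<bar>y\<bar>\<close> exceeds \<open>M\<close> and bounds \<open>\<bar>x - y\<bar>\<close>.
\<close>

definition first_moment_tail :: "real measure \<Rightarrow> real \<Rightarrow> real" where
  "first_moment_tail \<rho> M = (\<integral>x. 2 * \<bar>x\<bar> * indicator {x. M < 2 * \<bar>x\<bar>} x \<partial>\<rho>)"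

lemma first_moment_tail_tendsto:
  assumes "\<rho> \<in> P1"
  shows "(\<lambda>n. first_moment_tail \<rho> (real n)) \<longlonglongrightarrow> 0"
proof -
  have [measurable_cong]: "sets \<rho> = sets borel" and int: "integrable \<rho> (\<lambda>x. x)"
    using assms by (simp_all add: P1_def)
  have "(\<lambda>n. first_moment_tail \<rho> (real n)) \<longlonglongrightarrow> (\<integral>x. 0 \<partial>\<rho>)"
    unfolding first_moment_tail_def
  proof (rule integral_dominated_convergence)
    show "integrable \<rho> (\<lambda>x. 2 * \<bar>x\<bar>)" using int by simp
    show "AE x in \<rho>. (\<lambda>n. 2 * \<bar>x\<bar> * indicator {x. real n < 2 * \<bar>x\<bar>} x) \<longlonglongrightarrow> 0"
    proof (rule AE_I2)
      fix x :: real
      obtain N :: nat where N: "2 * \<bar>x\<bar> < N" using reals_Archimedean2 by blast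
      have "\<forall>\<^sub>F n in sequentially. 2 * \<bar>x\<bar> * indicator {x. real n < 2 * \<bar>x\<bar>} x = 0"
        using eventually_ge_at_top[of N] by eventually_elim (use N in \<open>auto simp: indicator_def\<close>)
      then show "(\<lambda>n. 2 * \<bar>x\<bar> * indicator {x. real n < 2 * \<bar>x\<bar>} x) \<longlonglongrightarrow> 0"
        by (rule tendsto_eventually)
    qed
  qed (auto simp: indicator_def)
  then show ?thesis by simp
qed

text \<open>
  On \<open>\<bar>x - y\<bar> \<le> M\<close> use \<open>d = d powr (1 - p) * d powr p\<close>; beyond, the tails of the first moments
  of the marginals bound the distance.
\<close>

lemma T_cost_1_le_T_cost:
  assumes \<mu>\<nu>: "\<mu> \<in> P1" "\<nu> \<in> P1" and \<gamma>: "\<gamma> \<in> Marg \<mu> \<nu>" and p: "0 < p" "p < 1" and M: "0 < M"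
  shows "T_cost 1 \<gamma> \<le> ennreal (M powr (1 - p)) * T_cost p \<gamma> + ennreal (first_moment_tail \<mu> M + first_moment_tail \<nu> M)"
proof -
  have s\<gamma>: "sets \<gamma> = sets borel" using \<gamma> by (rule Marg_sets)
  note [measurable_cong] = s\<gamma>
  let ?t = "\<lambda>x. 2 * \<bar>x\<bar> * indicator {x. M < 2 * \<bar>x\<bar>} x :: real"
  have tail: "(\<integral>\<^sup>+ x. ennreal (?t x) \<partial>\<rho>) = ennreal (first_moment_tail \<rho> M)" "0 \<le> first_moment_tail \<rho> M"
    if "\<rho> \<in> P1" for \<rho>
  proof -
    have [measurable_cong]: "sets \<rho> = sets borel" and int: "integrable \<rho> (\<lambda>x. x)"
      using that by (simp_all add: P1_def)
    have "integrable \<rho> (\<lambda>x. 2 * \<bar>x\<bar>)" using int by simp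
    then have "integrable \<rho> ?t"
      by (rule Bochner_Integration.integrable_bound) (auto simp: indicator_def)
    then show "(\<integral>\<^sup>+ x. ennreal (?t x) \<partial>\<rho>) = ennreal (first_moment_tail \<rho> M)"
      unfolding first_moment_tail_def by (intro nn_integral_eq_integral) auto
    show "0 \<le> first_moment_tail \<rho> M"
      unfolding first_moment_tail_def by (intro integral_nonneg_AE) auto
  qed
  have "T_cost 1 \<gamma> \<le> (\<integral>\<^sup>+ z. ennreal (M powr (1 - p)) * ennreal (\<bar>fst z - snd z\<bar> powr p)
       + (ennreal (?t (fst z)) + ennreal (?t (snd z))) \<partial>\<gamma>)"
    unfolding T_cost_def split_beta'
  proof (rule nn_integral_mono)
    fix z :: "real \<times> real"
    obtain x y where z: "z = (x, y)" by (cases z)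
    define d where "d = \<bar>x - y\<bar>"
    have "d \<le> M powr (1 - p) * d powr p + (?t x + ?t y)"
    proof (cases "d \<le> M")
      case True
      have "d = d powr (1 - p) * d powr p"
        by (cases "d = 0") (simp_all add: powr_add[symmetric] d_def)
      also have "\<dots> \<le> M powr (1 - p) * d powr p"
        using True p by (intro mult_right_mono powr_mono2) (auto simp: d_def)
      finally show ?thesis by (smt (verit) indicator_pos_le abs_ge_zero mult_nonneg_nonneg)
    next
      case False
      have "d \<le> ?t x + ?t y"
        using False unfolding d_def by (cases "\<bar>x\<bar> \<le> \<bar>y\<bar>") (auto simp: indicator_def)
      then show ?thesis by (smt (verit) powr_ge_zero mult_nonneg_nonneg)
    qed
    then have "ennreal d \<le> ennreal (M powr (1 - p) * d powr p + (?t x + ?t y))" by (rule ennreal_leI)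
    also have "\<dots> = ennreal (M powr (1 - p)) * ennreal (d powr p) + (ennreal (?t x) + ennreal (?t y))"
      by (simp add: ennreal_mult)
    finally show "ennreal (\<bar>fst z - snd z\<bar> powr 1) \<le> ennreal (M powr (1 - p)) * ennreal (\<bar>fst z - snd z\<bar> powr p)
       + (ennreal (?t (fst z)) + ennreal (?t (snd z)))" by (simp add: z d_def)
  qed
  also have "\<dots> = ennreal (M powr (1 - p)) * T_cost p \<gamma> + ((\<integral>\<^sup>+ z. ennreal (?t (fst z)) \<partial>\<gamma>) + (\<integral>\<^sup>+ z. ennreal (?t (snd z)) \<partial>\<gamma>))"
    unfolding T_cost_def split_beta'
    by (subst nn_integral_add, simp, simp, subst nn_integral_cmult, simp, subst nn_integral_add) simp_all
  also have "(\<integral>\<^sup>+ z. ennreal (?t (fst z)) \<partial>\<gamma>) = (\<integral>\<^sup>+ x. ennreal (?t x) \<partial>distr \<gamma> borel fst)"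
    by (rule nn_integral_distr[symmetric]) (auto intro: measurable_fst_snd_sets_borel s\<gamma>)
  also have "\<dots> = ennreal (first_moment_tail \<mu> M)"
    unfolding Marg_distr_fst[OF \<gamma>] by (rule tail(1)[OF \<mu>\<nu>(1)])
  also have "(\<integral>\<^sup>+ z. ennreal (?t (snd z)) \<partial>\<gamma>) = (\<integral>\<^sup>+ x. ennreal (?t x) \<partial>distr \<gamma> borel snd)"
    by (rule nn_integral_distr[symmetric]) (auto intro: measurable_fst_snd_sets_borel s\<gamma>)
  also have "\<dots> = ennreal (first_moment_tail \<nu> M)"
    unfolding Marg_distr_snd[OF \<gamma>] by (rule tail(1)[OF \<mu>\<nu>(2)])
  finally show ?thesis using tail(2)[OF \<mu>\<nu>(1)] tail(2)[OF \<mu>\<nu>(2)] by simp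
qed

text \<open>
  The comparison \<open>T_cost (p n) (\<gamma> n) \<le> T_cost (p n) \<pi>\<close> together with \<open>T_cost_le_affine\<close> and
  \<open>T_cost_1_le_T_cost\<close> shows that the costs for \<open>p = 1\<close> approach the minimum. So the excess of
  \<open>\<gamma> n\<close> vanishes in the limit, in mean and then pointwise.
\<close>

theorem maximal_flow_imp_weak_limit:
  assumes \<mu>\<nu>: "\<mu> \<in> P1" "\<nu> \<in> P1" and \<pi>: "\<pi> \<in> Marg \<mu> \<nu>"
    and max1: "maximal_flow (F_diff \<mu> \<nu>) \<pi>" and max2: "maximal_flow (\<lambda>u. - F_diff \<mu> \<nu> u) (transpose_plan \<pi>)"
    and p: "\<And>n. 0 < p n" "\<And>n. p n < 1" "p \<longlonglongrightarrow> 1" and \<gamma>o: "\<And>n. \<gamma> n \<in> Marg_opt (p n) \<mu> \<nu>"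
  shows "weakly_converges \<gamma> \<pi>"
proof -
  have \<gamma>: "\<gamma> n \<in> Marg \<mu> \<nu>" for n using \<gamma>o[of n] by (simp add: Marg_opt_def)
  define W where "W = enn2real (T_cost 1 \<pi>)"
  have W: "T_cost 1 \<pi> = ennreal W" "0 \<le> W"
    using T_cost_finite[OF \<mu>\<nu> \<pi>, of 1] by (auto simp: W_def less_top)
  have small: "\<forall>\<^sub>F n in sequentially. (\<integral>\<^sup>+ u. ennreal (excess (\<gamma> n) u) \<partial>lborel) \<le> ennreal e" if e: "0 < e" for e
  proof -
    let ?\<tau> = "\<lambda>M. first_moment_tail \<mu> M + first_moment_tail \<nu> M"
    have "(\<lambda>n. ?\<tau> (real n)) \<longlonglongrightarrow> 0 + 0" by (intro tendsto_add first_moment_tail_tendsto \<mu>\<nu>)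
    then have "\<forall>\<^sub>F n in sequentially. ?\<tau> (real n) < 2 * e" using e by (intro order_tendstoD(2)) auto
    then have "\<forall>\<^sub>F n in sequentially. ?\<tau> (real n) < 2 * e \<and> 0 < n"
      using eventually_gt_at_top[of 0] by eventually_elim simp
    then obtain M :: nat where M: "?\<tau> (real M) < 2 * e" "0 < M"
      using eventually_happens'[OF sequentially_bot] by blast
    define c where "c n = real M powr (1 - p n) * (p n * W + (1 - p n)) + ?\<tau> (real M)" for n
    have "c \<longlonglongrightarrow> real M powr (1 - 1) * (1 * W + (1 - 1)) + ?\<tau> (real M)"
      unfolding c_def using M by (intro tendsto_intros p) auto
    then have "c \<longlonglongrightarrow> W + ?\<tau> (real M)" using M by simp
    then have "\<forall>\<^sub>F n in sequentially. c n < W + 2 * e" using M by (intro order_tendstoD(2)) auto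
    then show ?thesis
    proof eventually_elim
      case (elim n)
      have pn: "0 < p n" "p n < 1" using p by auto
      have "T_cost 1 (\<gamma> n) \<le> ennreal (real M powr (1 - p n)) * T_cost (p n) (\<gamma> n) + ennreal (?\<tau> (real M))"
        using M by (intro T_cost_1_le_T_cost[OF \<mu>\<nu> \<gamma> pn]) simp
      also have "T_cost (p n) (\<gamma> n) \<le> T_cost (p n) \<pi>" using \<gamma>o[of n] \<pi> by (simp add: Marg_opt_def)
      also have "T_cost (p n) \<pi> \<le> ennreal (p n * W + (1 - p n))" by (rule T_cost_le_affine[OF \<pi> pn W])
      finally have "T_cost 1 (\<gamma> n) \<le> ennreal (real M powr (1 - p n)) * ennreal (p n * W + (1 - p n)) + ennreal (?\<tau> (real M))"
        by (simp add: mult_left_mono add_right_mono)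
      also have "\<dots> = ennreal (c n)"
      proof -
        have "0 \<le> first_moment_tail \<rho> (real M)" for \<rho>
          unfolding first_moment_tail_def by (intro integral_nonneg_AE) auto
        then show ?thesis unfolding c_def using pn W(2)
          by (subst ennreal_plus) (auto simp: ennreal_mult intro!: mult_nonneg_nonneg add_nonneg_nonneg)
      qed
      also have "\<dots> \<le> ennreal (W + 2 * e)" using elim by (intro ennreal_leI) simp
      also have "\<dots> = T_cost 1 \<pi> + 2 * ennreal e" using W e by (simp add: ennreal_mult)
      finally have "T_cost 1 \<pi> + 2 * (\<integral>\<^sup>+ u. ennreal (excess (\<gamma> n) u) \<partial>lborel) \<le> T_cost 1 \<pi> + 2 * ennreal e"
        by (simp only: T_cost_1_eq_add_excess[OF \<pi> max1 \<gamma>])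
      then have "2 * (\<integral>\<^sup>+ u. ennreal (excess (\<gamma> n) u) \<partial>lborel) \<le> 2 * ennreal e"
        using W by (auto simp only: ennreal_add_left_cancel_le) (auto simp: W)
      then show ?case by (subst (asm) ennreal_mult_le_mult_iff) auto
    qed
  qed
  have exc: "(\<lambda>n. excess (\<gamma> n) u) \<longlonglongrightarrow> 0" for u
    by (rule excess_tendsto_zero[OF \<gamma> small P1_prob_space[OF \<mu>\<nu>(1)]
        P1_prob_space[OF \<mu>\<nu>(2)] P1_sets[OF \<mu>\<nu>(1)] P1_sets[OF \<mu>\<nu>(2)]])
  have flow1: "(\<lambda>n. flow (\<gamma> n) a b) \<longlonglongrightarrow> flow \<pi> a b" if "a \<le> b" for a b
    by (rule flow_tendsto_maximal_flow[OF \<gamma> Marg_opt_noncrossing[OF \<mu>\<nu> p(1,2) \<gamma>o] exc \<pi> max1 that])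
  have flow2: "(\<lambda>n. flow (transpose_plan (\<gamma> n)) a b) \<longlonglongrightarrow> flow (transpose_plan \<pi>) a b" if "a \<le> b" for a b
  proof (rule flow_tendsto_maximal_flow[OF transpose_plan_Marg[OF \<gamma>] _ _ transpose_plan_Marg[OF \<pi>] _ that])
    show "noncrossing (transpose_plan (\<gamma> n))" for n
      by (rule Marg_opt_noncrossing[OF \<mu>\<nu>(2,1) p(1,2) transpose_plan_Marg_opt[OF \<gamma>o]])
    show "(\<lambda>n. excess (transpose_plan (\<gamma> n)) u) \<longlonglongrightarrow> 0" for u
      using exc[of u] by (simp add: excess_transpose[OF Marg_sets[OF \<gamma>]])
    show "maximal_flow (F_diff \<nu> \<mu>) (transpose_plan \<pi>)"
      using max2 by (simp add: F_diff_commute[of \<nu> \<mu>, abs_def])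
  qed
  show ?thesis
  proof (rule weakly_converges_if_joint_cdf_converges[OF \<gamma> \<pi>])
    fix a b :: real
    have H1: "measure \<rho> ({..a} \<times> {..b}) = cdf \<mu> a - flow \<rho> a b" if "\<rho> \<in> Marg \<mu> \<nu>" for \<rho>
      using flow_eq_cdf_minus[OF that, of a b] by simp
    have H2: "measure \<rho> ({..a} \<times> {..b}) = cdf \<nu> b - flow (transpose_plan \<rho>) b a" if "\<rho> \<in> Marg \<mu> \<nu>" for \<rho>
      using flow_eq_cdf_minus[OF transpose_plan_Marg[OF that], of b a] Marg_sets[OF that]
      by (simp add: measure_def emeasure_transpose_plan)
    show "(\<lambda>n. measure (\<gamma> n) ({..a} \<times> {..b})) \<longlonglongrightarrow> measure \<pi> ({..a} \<times> {..b})"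
    proof (cases "a \<le> b")
      case True
      show ?thesis unfolding H1[OF \<gamma>] H1[OF \<pi>] by (intro tendsto_intros flow1 True)
    next
      case False
      then have "b \<le> a" by simp
      show ?thesis unfolding H2[OF \<gamma>] H2[OF \<pi>] by (intro tendsto_intros flow2 \<open>b \<le> a\<close>)
    qed
  qed
qed

section \<open>Level sets of the completed graph\<close>

text \<open>
  Everything about level sets that is needed below holds for functions of this kind and is
  stable under \<open>F \<mapsto> - F\<close>, which exchanges the levels above and below \<open>0\<close>.
\<close>

locale cadlag =
  fixes F :: "real \<Rightarrow> real"
  assumes right_cont: "(F \<longlongrightarrow> F x) (at_right x)"
    and ex_left_limit: "\<exists>l. (F \<longlongrightarrow> l) (at_left x)"
    and lim_bot: "(F \<longlongrightarrow> 0) at_bot" and lim_top: "(F \<longlongrightarrow> 0) at_top"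
begin

lemma left_limit: "(F \<longlongrightarrow> Lim (at_left x) F) (at_left x)"
  using ex_left_limit[of x] tendsto_Lim[of "at_left x" F] by auto

lemma F_star_eq: "F_star F x = closed_segment (Lim (at_left x) F) (F x)"
proof (cases "isCont F x")
  case True
  then have "(F \<longlongrightarrow> F x) (at_left x)"
    by (simp add: isCont_def filterlim_at_split)
  then have "Lim (at_left x) F = F x" using tendsto_Lim[of "at_left x" F] by simp
  then show ?thesis using True by (simp add: F_star_def)
qed (simp add: F_star_def)

lemma mem_F_star: "h \<in> F_star F x \<longleftrightarrow>
  (Lim (at_left x) F \<le> h \<and> h \<le> F x) \<or> (F x \<le> h \<and> h \<le> Lim (at_left x) F)"
  unfolding F_star_eq closed_segment_eq_real_ivl by auto

lemma level_set_iff: "x \<in> level_set F h \<longleftrightarrow> h \<in> F_star F x"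
  by (simp add: level_set_def Graph_star_def)

lemma self_mem_F_star: "F x \<in> F_star F x"
  unfolding mem_F_star by linarith

lemma not_level_neq: "x \<notin> level_set F h \<Longrightarrow> F x \<noteq> h"
  using self_mem_F_star[of x] by (auto simp: level_set_iff)

lemma not_level_F_star:
  assumes "x \<notin> level_set F h" "h' \<in> F_star F x"
  shows "h < h' \<longleftrightarrow> h < F x"
  using assms unfolding level_set_iff mem_F_star by linarith

text \<open>
  The intermediate value theorem for the completed graph; the point is the first time at which
  \<open>F\<close> reaches \<open>h\<close>.
\<close>

lemma level_between_up:
  assumes "a < b" "F a < h" "h < F b"
  shows "\<exists>x. a < x \<and> x \<le> b \<and> x \<in> level_set F h"
proof -
  define S where "S = {z \<in> {a..b}. h \<le> F z}"
  define x where "x = Inf S"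
  have bS: "b \<in> S" using assms by (simp add: S_def)
  have bdd: "bdd_below S" by (auto simp: S_def intro!: bdd_belowI[of _ a])
  have x: "a \<le> x" "x \<le> b"
    using bS bdd by (auto simp: x_def S_def intro!: cInf_greatest cInf_lower)
  have below: "F z < h" if "a \<le> z" "z < x" for z
    using cInf_lower[OF _ bdd, of z] that x by (force simp: x_def S_def)
  have "h \<le> F x"
  proof (rule ccontr)
    assume "\<not> h \<le> F x"
    then have "\<forall>\<^sub>F z in at_right x. F z < h" by (intro order_tendstoD(2)[OF right_cont]) simp
    then obtain y where y: "x < y" "\<And>z. x < z \<Longrightarrow> z < y \<Longrightarrow> F z < h"
      unfolding eventually_at_right_field by blast
    obtain z where z: "z \<in> S" "z < y" using cInf_lessD[of S y] bS y(1) by (auto simp: x_def)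
    have "x \<le> z" unfolding x_def by (rule cInf_lower[OF z(1) bdd])
    moreover have "z \<noteq> x" using z(1) \<open>\<not> h \<le> F x\<close> by (auto simp: S_def)
    ultimately have "F z < h" using y(2)[of z] z(2) by simp
    then show False using z(1) by (simp add: S_def)
  qed
  then have ax: "a < x" using assms(2) x(1) by (cases "a = x") auto
  have "Lim (at_left x) F \<le> h"
  proof (rule tendsto_upperbound[OF left_limit])
    show "\<forall>\<^sub>F z in at_left x. F z \<le> h"
      unfolding eventually_at_left_field using below ax by (intro exI[of _ a]) (auto intro: less_imp_le)
  qed simp
  then show ?thesis using \<open>h \<le> F x\<close> ax x(2) by (intro exI[of _ x]) (simp add: level_set_iff mem_F_star)
qed

lemma cadlag_uminus: "cadlag (\<lambda>x. - F x)"
proof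
  fix x
  show "((\<lambda>x. - F x) \<longlongrightarrow> - F x) (at_right x)" by (rule tendsto_minus[OF right_cont])
  show "\<exists>l. ((\<lambda>x. - F x) \<longlongrightarrow> l) (at_left x)" using tendsto_minus[OF left_limit] by blast
qed (use tendsto_minus[OF lim_bot] tendsto_minus[OF lim_top] in simp_all)

lemma level_set_uminus: "level_set (\<lambda>x. - F x) (- h) = level_set F h"
proof -
  interpret neg: cadlag "\<lambda>x. - F x" by (rule cadlag_uminus)
  have "Lim (at_left x) (\<lambda>x. - F x) = - Lim (at_left x) F" for x
    by (rule tendsto_Lim[OF _ tendsto_minus[OF left_limit]]) simp
  then show ?thesis by (auto simp: level_set_iff neg.level_set_iff mem_F_star neg.mem_F_star)
qed

lemma level_between:
  assumes "a < b" "F a \<noteq> h" "F b \<noteq> h" "(h < F a) \<noteq> (h < F b)"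
  shows "\<exists>x. a < x \<and> x \<le> b \<and> x \<in> level_set F h"
proof (cases "h < F b")
  case True
  then show ?thesis using assms by (intro level_between_up) auto
next
  case False
  interpret neg: cadlag "\<lambda>x. - F x" by (rule cadlag_uminus)
  have "\<exists>x. a < x \<and> x \<le> b \<and> x \<in> level_set (\<lambda>x. - F x) (- h)"
    using False assms by (intro neg.level_between_up) auto
  then show ?thesis by (simp add: level_set_uminus)
qed

lemma same_side:
  assumes "a \<le> b" "a \<notin> level_set F h" "\<And>x. a < x \<Longrightarrow> x \<le> b \<Longrightarrow> x \<notin> level_set F h"
  shows "h < F a \<longleftrightarrow> h < F b"
proof (cases "a = b")
  case False
  then show ?thesis using level_between[of a b h] not_level_neq[OF assms(2)] not_level_neq[OF assms(3)[of b]] assms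
    by force
qed simp

text \<open>
  The values of the completed graph over an interval form an interval, by the intermediate value
  theorem. This makes them Borel.
\<close>

lemma is_interval_F_star_image:
  assumes S: "is_interval S"
  shows "is_interval (\<Union>x\<in>S. F_star F x)"
  unfolding is_interval_1
proof (intro ballI allI impI)
  fix h1 h2 h assume h1: "h1 \<in> (\<Union>x\<in>S. F_star F x)" and h2: "h2 \<in> (\<Union>x\<in>S. F_star F x)" and h: "h1 \<le> h \<and> h \<le> h2"
  obtain x1 x2 where x: "x1 \<in> S" "h1 \<in> F_star F x1" "x2 \<in> S" "h2 \<in> F_star F x2" using h1 h2 by auto
  show "h \<in> (\<Union>x\<in>S. F_star F x)"
  proof (rule ccontr)
    assume no: "h \<notin> (\<Union>x\<in>S. F_star F x)"
    then have nl: "z \<notin> level_set F h" if "z \<in> S" for z using that by (auto simp: level_set_iff)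
    have ne: "h \<noteq> h1" "h \<noteq> h2" using no h1 h2 by auto
    have "\<not> h < F x1" using not_level_F_star[OF nl[OF x(1)] x(2)] h by simp
    moreover have "h < F x2" using not_level_F_star[OF nl[OF x(3)] x(4)] h ne by simp
    moreover have "z \<in> S" if "min x1 x2 \<le> z" "z \<le> max x1 x2" for z
      using S x(1,3) that unfolding is_interval_1 by (metis max_def min_def)
    ultimately show False
      using same_side[of x1 x2 h] same_side[of x2 x1 h] nl x(1,3)
      by (cases "x1 \<le> x2") (auto simp: min_def max_def)
  qed
qed

definition crosses :: "real \<Rightarrow> real \<Rightarrow> bool" where
  "crosses h x \<longleftrightarrow> (\<exists>e>0. \<forall>w\<in>{x-e<..<x}. \<forall>w'\<in>{x<..<x+e}.
     w \<notin> level_set F h \<and> w' \<notin> level_set F h \<and> (h < F w) \<noteq> (h < F w'))"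

text \<open>
  Every value at a strict local extremum of the completed graph is the maximum or the minimum
  over an interval with rational end points.
\<close>

definition extremal_levels :: "real set" where
  "extremal_levels = (\<Union>p\<in>\<rat>. \<Union>q\<in>\<rat>.
     {Sup (\<Union>x\<in>{p<..<q}. F_star F x), Inf (\<Union>x\<in>{p<..<q}. F_star F x)})"

lemma countable_extremal_levels: "countable extremal_levels"
  unfolding extremal_levels_def by (intro countable_UN countable_rat) auto

lemma isolated_level:
  assumes "finite (level_set F h)"
  shows "\<exists>e>0. \<forall>w. w \<noteq> x \<and> \<bar>w - x\<bar> < e \<longrightarrow> w \<notin> level_set F h"
proof -
  obtain e where "e > 0" "\<forall>w\<in>level_set F h. w \<noteq> x \<longrightarrow> e \<le> dist x w"
    using finite_set_avoid[OF assms, of x] by auto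
  then show ?thesis by (intro exI[of _ e]) (force simp: dist_real_def)
qed

text \<open>
  An isolated level point has the graph on a constant side of \<open>h\<close> on the left and on the right.
  If the two sides agree, \<open>h\<close> is the value at a strict local extremum.
\<close>

lemma crosses_if_not_extremal:
  assumes fin: "finite (level_set F h)" and x: "x \<in> level_set F h" and h: "h \<notin> extremal_levels"
  shows "crosses h x"
proof -
  obtain e where e: "0 < e" "\<And>w. w \<noteq> x \<Longrightarrow> \<bar>w - x\<bar> < e \<Longrightarrow> w \<notin> level_set F h"
    using isolated_level[OF fin] by blast
  have nl: "w \<notin> level_set F h" if "x - e < w" "w < x + e" "w \<noteq> x" for w
    using that by (intro e(2)) (simp_all add: abs_less_iff)
  define l where "l = x - e / 2"
  define r where "r = x + e / 2"
  have l: "(h < F w) = (h < F l)" if "x - e < w" "w < x" for w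
  proof (cases "l \<le> w")
    case True
    then show ?thesis using same_side[of l w h] e that by (auto simp: l_def)
  next
    case False
    then show ?thesis using same_side[of w l h] e that by (auto simp: l_def)
  qed
  have r: "(h < F w) = (h < F r)" if "x < w" "w < x + e" for w
  proof (cases "r \<le> w")
    case True
    then show ?thesis using same_side[of r w h] e that by (auto simp: r_def)
  next
    case False
    then show ?thesis using same_side[of w r h] e that by (auto simp: r_def)
  qed
  obtain p where p: "p \<in> \<rat>" "x - e < p" "p < x" using Rats_dense_in_real[of "x - e" x] e by auto
  obtain q where q: "q \<in> \<rat>" "x < q" "q < x + e" using Rats_dense_in_real[of x "x + e"] e by auto
  let ?V = "\<Union>w\<in>{p<..<q}. F_star F w"
  have hV: "h \<in> ?V" using x p q by (auto simp: level_set_iff)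
  have ev_l: "\<forall>\<^sub>F w in at_left x. x - e < w \<and> w < x"
    unfolding eventually_at_left_field using e(1) by (intro exI[of _ "x - e"]) auto
  have ev_r: "\<forall>\<^sub>F w in at_right x. x < w \<and> w < x + e"
    unfolding eventually_at_right_field using e(1) by (intro exI[of _ "x + e"]) auto
  have "(h < F l) \<noteq> (h < F r)"
  proof
    assume eq: "(h < F l) = (h < F r)"
    have side: "h < F w \<longleftrightarrow> h < F r" if "x - e < w" "w < x + e" "w \<noteq> x" for w
      using l[of w] r[of w] eq that by (cases "w < x") auto
    show False
    proof (cases "h < F r")
      case True
      then have gt: "h < F w" if "x - e < w" "w < x + e" "w \<noteq> x" for w using side[OF that] by simp
      have "h \<le> F x" by (rule tendsto_lowerbound[OF right_cont])
          (use ev_r gt e(1) in \<open>auto elim!: eventually_mono intro: less_imp_le\<close>)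
      moreover have "h \<le> Lim (at_left x) F" by (rule tendsto_lowerbound[OF left_limit])
          (use ev_l gt e(1) in \<open>auto elim!: eventually_mono intro: less_imp_le\<close>)
      ultimately have at_x: "h \<le> h'" if "h' \<in> F_star F x" for h' using that by (auto simp: mem_F_star)
      have "h \<le> h'" if V: "h' \<in> ?V" for h'
      proof -
        obtain w where w: "p < w" "w < q" "h' \<in> F_star F w" using V by auto
        show ?thesis
        proof (cases "w = x")
          case False
          then have "h < h'" using not_level_F_star[OF nl w(3)] side[of w] True w p q by (auto simp: abs_if)
          then show ?thesis by simp
        qed (use at_x w in auto)
      qed
      then have "Inf ?V = h" by (intro cInf_eq_minimum hV)
      then show False using h p q by (force simp: extremal_levels_def)
    next
      case False
      have nlt: "F w < h" if "x - e < w" "w < x + e" "w \<noteq> x" for w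
        using side[OF that] False not_level_neq[OF nl[OF that]] by linarith
      have "F x \<le> h" by (rule tendsto_upperbound[OF right_cont])
          (use ev_r nlt e(1) in \<open>auto elim!: eventually_mono intro: less_imp_le\<close>)
      moreover have "Lim (at_left x) F \<le> h" by (rule tendsto_upperbound[OF left_limit])
          (use ev_l nlt e(1) in \<open>auto elim!: eventually_mono intro: less_imp_le\<close>)
      ultimately have at_x: "h' \<le> h" if "h' \<in> F_star F x" for h' using that by (auto simp: mem_F_star)
      have "h' \<le> h" if V: "h' \<in> ?V" for h'
      proof -
        obtain w where w: "p < w" "w < q" "h' \<in> F_star F w" using V by auto
        show ?thesis
        proof (cases "w = x")
          case False
          then have "\<not> h < h'" using not_level_F_star[OF nl w(3)] nlt[of w] w p q by (auto simp: abs_if)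
          then show ?thesis by simp
        qed (use at_x w in auto)
      qed
      then have "Sup ?V = h" by (intro cSup_eq_maximum hV)
      then show False using h p q by (force simp: extremal_levels_def)
    qed
  qed
  then show ?thesis unfolding crosses_def
    using e l r by (intro exI[of _ e]) auto
qed

lemma Graph_star_iff: "(x, h) \<in> Graph_star F \<longleftrightarrow> h \<in> F_star F x"
  by (simp add: Graph_star_def)

lemma crosses_imp_plus_or_minus:
  assumes x: "x \<in> level_set F h" and c: "crosses h x"
  shows "(x, h) \<in> Graph_star_plus F \<union> Graph_star_minus F"
proof -
  obtain e where e: "0 < e" and c: "\<And>w w'. \<lbrakk>x - e < w; w < x; x < w'; w' < x + e\<rbrakk> \<Longrightarrow>
      w \<notin> level_set F h \<and> w' \<notin> level_set F h \<and> (h < F w) \<noteq> (h < F w')"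
    using c unfolding crosses_def by auto
  have G: "(x, h) \<in> Graph_star F" using x by (simp add: level_set_def)
  let ?l = "x - e / 2" and ?r = "x + e / 2"
  have val: "(h < h') = (h < F w) \<and> h' \<noteq> h" if "h' \<in> F_star F w" "x - e < w" "w < x + e" "w \<noteq> x" for w h'
  proof -
    have "w \<notin> level_set F h" using c[of w ?r] c[of ?l w] that e by (cases "w < x") auto
    then show ?thesis using not_level_F_star[of w h h'] that(1) by (auto simp: level_set_iff)
  qed
  have opp: "(h < F w) \<noteq> (h < F w')" if "x - e < w" "w < x" "x < w'" "w' < x + e" for w w'
    using c[OF that] by simp
  have sgn: "(h' - h) * (x' - x) \<noteq> 0 \<and> (0 < (h' - h) * (x' - x) \<longleftrightarrow> h < F ?r)"
    if z: "(x', h') \<in> Graph_star F" "x' \<in> {x-e<..<x+e} - {x}" for x' h'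
  proof -
    have v: "(h < h') = (h < F x')" "h' \<noteq> h" using val[of h' x'] z by (auto simp: Graph_star_iff)
    have "(h < h') = ((h < F ?r) = (x < x'))"
      using opp[of x' ?r] opp[of ?l x'] opp[of ?l ?r] v z(2) e by (cases "x < x'") auto
    then show ?thesis using v(2) z(2) by (auto simp: zero_less_mult_iff)
  qed
  have U: "open {x-e<..<x+e}" "x \<in> {x-e<..<x+e}" using e by auto
  show ?thesis
  proof (cases "h < F ?r")
    case True
    then have "0 < (h' - h) * (x' - x)"
      if "(x', h') \<in> Graph_star F" "x' \<in> {x-e<..<x+e} - {x}" for x' h'
      using sgn[OF that] by simp
    then have "(x, h) \<in> Graph_star_plus F"
      unfolding Graph_star_plus_def mem_Collect_eq prod.case
      using G U by (intro conjI exI[of _ "{x-e<..<x+e}"]) auto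
    then show ?thesis ..
  next
    case False
    then have "(h' - h) * (x' - x) < 0"
      if "(x', h') \<in> Graph_star F" "x' \<in> {x-e<..<x+e} - {x}" for x' h'
      using sgn[OF that] by linarith
    then have "(x, h) \<in> Graph_star_minus F"
      unfolding Graph_star_minus_def mem_Collect_eq prod.case
      using G U by (intro conjI exI[of _ "{x-e<..<x+e}"]) auto
    then show ?thesis ..
  qed
qed

text \<open>
  Completed graph points arbitrarily close to \<open>x\<close> always exist, so the two sign conditions
  exclude each other.
\<close>

lemma plus_minus_disjoint: "Graph_star_plus F \<inter> Graph_star_minus F = {}"
proof (rule equals0I)
  fix z assume z: "z \<in> Graph_star_plus F \<inter> Graph_star_minus F"
  obtain x h where xh: "z = (x, h)" by (cases z)
  obtain U where U: "open U" "x \<in> U" "\<And>x' h'. \<lbrakk>(x', h') \<in> Graph_star F; x' \<in> U - {x}\<rbrakk> \<Longrightarrow> 0 < (h' - h) * (x' - x)"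
    using z unfolding xh Graph_star_plus_def by fastforce
  obtain V where V: "open V" "x \<in> V" "\<And>x' h'. \<lbrakk>(x', h') \<in> Graph_star F; x' \<in> V - {x}\<rbrakk> \<Longrightarrow> (h' - h) * (x' - x) < 0"
    using z unfolding xh Graph_star_minus_def by fastforce
  have "open (U \<inter> V)" "x \<in> U \<inter> V" using U V by auto
  then obtain e where e: "e > 0" "ball x e \<subseteq> U \<inter> V" unfolding open_contains_ball by blast
  have "x + e / 2 \<in> U \<inter> V" using e by (intro subsetD[OF e(2)]) (auto simp: dist_real_def)
  then show False
    using U(3)[of "x + e / 2" "F (x + e / 2)"] V(3)[of "x + e / 2" "F (x + e / 2)"] e(1) self_mem_F_star
    by (auto simp: Graph_star_iff)
qed

lemma i_pm_eq_card:
  assumes fin: "finite (level_set F h)" and c: "\<And>x. x \<in> level_set F h \<Longrightarrow> crosses h x"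
  shows "i_pm F h = of_nat (card (level_set F h))"
proof -
  let ?P = "(UNIV \<times> {h}) \<inter> Graph_star_plus F" and ?M = "(UNIV \<times> {h}) \<inter> Graph_star_minus F"
  have "?P \<union> ?M = level_set F h \<times> {h}"
    using crosses_imp_plus_or_minus[OF _ c] 
    by (auto simp: level_set_def Graph_star_plus_def Graph_star_minus_def)
  moreover have "?P \<inter> ?M = {}" using plus_minus_disjoint by auto
  ultimately have "i_pm F h = emeasure (count_space UNIV) (level_set F h \<times> {h})"
    unfolding i_pm_def by (subst plus_emeasure) auto
  also have "\<dots> = of_nat (card (level_set F h \<times> {h}))"
    using fin by (intro emeasure_count_space_finite) auto
  finally show ?thesis using fin by (simp add: card_cartesian_product)
qed

end

section \<open>The pairs of level points\<close>

text \<open>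
  The indices of the entries \<open>\<le> a\<close> form an initial segment.
\<close>

lemma nth_sorted_list_of_set_le_iff:
  fixes L :: "real set"
  assumes fin: "finite L" and j: "j < card L"
  shows "sorted_list_of_set L ! j \<le> a \<longleftrightarrow> j < card (L \<inter> {..a})"
proof -
  let ?xs = "sorted_list_of_set L"
  have len: "length ?xs = card L" and sorted: "sorted_wrt (<) ?xs" and set: "set ?xs = L"
    using fin by simp_all
  let ?I = "{i. i < card L \<and> ?xs ! i \<le> a}"
  have inj: "inj_on (\<lambda>i. ?xs ! i) {..<card L}"
    using len by (auto simp: inj_on_def nth_eq_iff_index_eq)
  have L_iff: "y \<in> L \<longleftrightarrow> (\<exists>i<card L. ?xs ! i = y)" for y
    using in_set_conv_nth[of y ?xs] len set by simp
  have "L \<inter> {..a} = (\<lambda>i. ?xs ! i) ` ?I"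
    using L_iff by auto
  then have card: "card (L \<inter> {..a}) = card ?I"
    by (simp add: card_image inj_on_subset[OF inj] subset_eq)
  have down: "i' \<in> ?I" if "i \<in> ?I" "i' \<le> i" for i i'
  proof (cases "i' = i")
    case False
    then have "?xs ! i' < ?xs ! i" using that len by (intro sorted_wrt_nth_less[OF sorted]) auto
    then show ?thesis using that by auto
  qed (use that in auto)
  have fI: "finite ?I" by simp
  show ?thesis
  proof
    assume "?xs ! j \<le> a"
    then have "j \<in> ?I" using j by simp
    then have "{..j} \<subseteq> ?I" using down by blast
    then have "card {..j} \<le> card ?I" by (intro card_mono fI)
    then show "j < card (L \<inter> {..a})" using card by simp
  next
    assume lt: "j < card (L \<inter> {..a})"
    show "?xs ! j \<le> a"
    proof (rule ccontr)
      assume "\<not> ?xs ! j \<le> a"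
      have "?I \<subseteq> {..<j}"
      proof
        fix i assume "i \<in> ?I"
        then have "\<not> j \<le> i" using down[of i j] \<open>\<not> ?xs ! j \<le> a\<close> by auto
        then show "i \<in> {..<j}" by simp
      qed
      then have "card ?I \<le> card {..<j}" by (intro card_mono) auto
      then show False using lt card by simp
    qed
  qed
qed

lemma sorted_list_of_set_less:
  fixes L :: "real set"
  assumes "finite L" "i < j" "j < card L"
  shows "sorted_list_of_set L ! i < sorted_list_of_set L ! j"
  using assms by (intro sorted_wrt_nth_less[of "(<)"]) auto

lemma excursion_pairs_pos:
  assumes "0 < h" "finite (level_set F h)"
  shows "excursion_pairs F h = (\<lambda>k. (sorted_list_of_set (level_set F h) ! (2 * k), sorted_list_of_set (level_set F h) ! (2 * k + 1)))
     ` {k. 2 * k + 1 < card (level_set F h)}"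
  using assms unfolding excursion_pairs_def Let_def by (auto simp: image_iff)

lemma excursion_pairs_neg:
  assumes "h < 0" "finite (level_set F h)"
  shows "excursion_pairs F h = (\<lambda>k. (sorted_list_of_set (level_set F h) ! (2 * k + 1), sorted_list_of_set (level_set F h) ! (2 * k)))
     ` {k. 2 * k + 1 < card (level_set F h)}"
  using assms unfolding excursion_pairs_def Let_def by (auto simp: image_iff)

lemma finite_pair_index: "finite {k :: nat. 2 * k + 1 < n}"
  by (rule finite_subset[of _ "{..<n}"]) auto

lemma card_pair_index: "even n \<Longrightarrow> card {k :: nat. 2 * k + 1 < n} = n div 2"
proof -
  assume "even n"
  then have "{k :: nat. 2 * k + 1 < n} = {..<n div 2}" by (auto elim!: evenE)
  then show ?thesis by simp
qed

lemma pair_inj: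
  fixes L :: "real set"
  assumes "finite L"
  shows "inj_on (\<lambda>k. (sorted_list_of_set L ! (2 * k), sorted_list_of_set L ! (2 * k + 1))) {k. 2 * k + 1 < card L}"
    and "inj_on (\<lambda>k. (sorted_list_of_set L ! (2 * k + 1), sorted_list_of_set L ! (2 * k))) {k. 2 * k + 1 < card L}"
  using assms by (auto simp: inj_on_def nth_eq_iff_index_eq)

text \<open>
  Let \<open>c\<close> count the level points up to a given position. The pair with index \<open>k\<close> straddles
  \<open>[a, b]\<close> iff \<open>c\<close> equals \<open>2k + 1\<close> at both \<open>a\<close> and \<open>b\<close>.
\<close>

lemma card_excursion_pairs_forward:
  assumes h: "0 < h" and fin: "finite (level_set F h)" and ev: "even (card (level_set F h))" and ab: "a \<le> b"
  shows "card (excursion_pairs F h \<inter> ({..a} \<times> {b<..})) =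
    (if card (level_set F h \<inter> {..a}) = card (level_set F h \<inter> {..b}) \<and> odd (card (level_set F h \<inter> {..a})) then 1 else 0)"
proof -
  let ?L = "level_set F h"
  let ?xs = "sorted_list_of_set ?L"
  let ?f = "\<lambda>k. (?xs ! (2 * k), ?xs ! (2 * k + 1))"
  let ?ca = "card (?L \<inter> {..a})" and ?cb = "card (?L \<inter> {..b})"
  have le: "?ca \<le> ?cb" "?cb \<le> card ?L" using fin ab by (auto intro!: card_mono)
  have mem: "?f k \<in> {..a} \<times> {b<..} \<longleftrightarrow> ?ca = 2 * k + 1 \<and> ?cb = 2 * k + 1" if "2 * k + 1 < card ?L" for k
  proof -
    have "?f k \<in> {..a} \<times> {b<..} \<longleftrightarrow> ?xs ! (2 * k) \<le> a \<and> \<not> ?xs ! (2 * k + 1) \<le> b" by auto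
    also have "\<dots> \<longleftrightarrow> 2 * k < ?ca \<and> \<not> 2 * k + 1 < ?cb"
      using that by (simp only: nth_sorted_list_of_set_le_iff[OF fin])
    also have "\<dots> \<longleftrightarrow> ?ca = 2 * k + 1 \<and> ?cb = 2 * k + 1" using le by linarith
    finally show ?thesis .
  qed
  have "excursion_pairs F h \<inter> ({..a} \<times> {b<..}) = ?f ` {k. 2 * k + 1 < card ?L \<and> ?ca = 2 * k + 1 \<and> ?cb = 2 * k + 1}"
    unfolding excursion_pairs_pos[OF h fin] using mem by blast
  also have "{k. 2 * k + 1 < card ?L \<and> ?ca = 2 * k + 1 \<and> ?cb = 2 * k + 1}
      = (if ?ca = ?cb \<and> odd ?ca then {?ca div 2} else {})"
    using le ev by (auto elim!: oddE evenE) presburger+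
  finally show ?thesis by (cases "?ca = ?cb \<and> odd ?ca") auto
qed

lemma excursion_pairs_backward_empty:
  assumes h: "0 < h" and fin: "finite (level_set F h)" and ab: "a \<le> b"
  shows "excursion_pairs F h \<inter> ({b<..} \<times> {..a}) = {}"
proof -
  have "sorted_list_of_set (level_set F h) ! (2 * k) < sorted_list_of_set (level_set F h) ! (2 * k + 1)"
    if "2 * k + 1 < card (level_set F h)" for k
    using that by (intro sorted_list_of_set_less fin) auto
  then show ?thesis unfolding excursion_pairs_pos[OF h fin] using ab by fastforce
qed

lemma card_excursion_pairs:
  assumes h: "h \<noteq> 0" and fin: "finite (level_set F h)" and ev: "even (card (level_set F h))"
  shows "card (excursion_pairs F h) = card (level_set F h) div 2" "finite (excursion_pairs F h)"
proof -
  show "card (excursion_pairs F h) = card (level_set F h) div 2"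
  proof (cases "0 < h")
    case True
    show ?thesis
      unfolding excursion_pairs_pos[OF True fin] card_image[OF pair_inj(1)[OF fin]] by (rule card_pair_index[OF ev])
  next
    case False
    then have "h < 0" using h by simp
    show ?thesis
      unfolding excursion_pairs_neg[OF \<open>h < 0\<close> fin] card_image[OF pair_inj(2)[OF fin]] by (rule card_pair_index[OF ev])
  qed
  show "finite (excursion_pairs F h)"
    using h finite_pair_index by (cases "0 < h") (auto simp: excursion_pairs_pos excursion_pairs_neg fin)
qed

context cadlag
begin

lemma excursion_pairs_uminus:
  assumes h: "h < 0" and fin: "finite (level_set F h)"
  shows "excursion_pairs F h = prod.swap ` excursion_pairs (\<lambda>x. - F x) (- h)"
proof -
  have "0 < - h" "finite (level_set (\<lambda>x. - F x) (- h))" using h fin by (simp_all add: level_set_uminus)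
  from excursion_pairs_pos[OF this] show ?thesis
    unfolding excursion_pairs_neg[OF h fin] level_set_uminus by (simp add: image_image)
qed

lemma crosses_uminus: "cadlag.crosses (\<lambda>x. - F x) (- h) x \<longleftrightarrow> crosses h x"
proof -
  interpret neg: cadlag "\<lambda>x. - F x" by (rule cadlag_uminus)
  have "(w \<notin> level_set F h \<and> w' \<notin> level_set F h \<and> (- h < - F w) \<noteq> (- h < - F w'))
     \<longleftrightarrow> (w \<notin> level_set F h \<and> w' \<notin> level_set F h \<and> (h < F w) \<noteq> (h < F w'))" for w w'
    using not_level_neq[of w h] not_level_neq[of w' h] by auto
  then show ?thesis unfolding neg.crosses_def crosses_def level_set_uminus by simp
qed

text \<open>
  Induction over the level points from the left: \<open>F\<close> is below \<open>h > 0\<close> near \<open>-\<infinity>\<close>, each crossing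
  changes the side, and between crossings the side is constant.
\<close>

lemma above_level_iff_odd_aux:
  assumes h: "0 < h" and fin: "finite (level_set F h)" and c: "\<And>x. x \<in> level_set F h \<Longrightarrow> crosses h x"
  shows "z \<notin> level_set F h \<Longrightarrow> card (level_set F h \<inter> {..z}) = n \<Longrightarrow> h < F z \<longleftrightarrow> odd n"
proof (induction n arbitrary: z)
  case 0
  then have none: "x \<notin> level_set F h" if "x \<le> z" for x using fin that by auto
  have "\<forall>\<^sub>F w in at_bot. F w < h" using lim_bot h by (rule order_tendstoD)
  moreover have "\<forall>\<^sub>F w in at_bot. w \<le> z" by (rule eventually_le_at_bot)
  ultimately have "\<forall>\<^sub>F w in at_bot. F w < h \<and> w \<le> z" by eventually_elim simp
  then obtain w where "F w < h" "w \<le> z" using eventually_happens'[OF trivial_limit_at_bot_linorder] by blast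
  then show ?case using same_side[of w z h] none by auto
next
  case (Suc n)
  let ?L = "level_set F h"
  let ?A = "?L \<inter> {..z}"
  have A: "finite ?A" "?A \<noteq> {}" using fin Suc.prems(2) by auto
  define x where "x = Max ?A"
  have xA: "x \<in> ?A" unfolding x_def by (rule Max_in[OF A])
  have max: "y \<le> x" if "y \<in> ?L" "y \<le> z" for y using Max_ge[OF A(1)] that by (auto simp: x_def)
  have xz: "x < z" using xA Suc.prems(1) by (cases "x = z") auto
  obtain e where e: "0 < e" "\<And>w w'. \<lbrakk>x - e < w; w < x; x < w'; w' < x + e\<rbrakk> \<Longrightarrow>
      w \<notin> ?L \<and> w' \<notin> ?L \<and> (h < F w) \<noteq> (h < F w')"
    using c[of x] xA unfolding crosses_def by auto
  define w where "w = x - e / 2"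
  define w' where "w' = min z (x + e / 2)"
  have w: "x - e < w" "w < x" "x < w'" "w' < x + e" "w' \<le> z"
    using e(1) xz by (auto simp: w_def w'_def)
  have nl: "w \<notin> ?L" "(h < F w) \<noteq> (h < F w')" using e(2)[OF w(1-4)] by auto
  have "y \<notin> ?L" if "w < y" "y < x" for y using e(2)[of y w'] w that by auto
  then have "?L \<inter> {..w} = ?A - {x}" using max w nl(1) xz by (force simp: not_less)
  then have "card (?L \<inter> {..w}) = n" using Suc.prems(2) xA A(1) by simp
  then have "h < F w \<longleftrightarrow> odd n" using Suc.IH[OF nl(1)] by simp
  moreover have "h < F w' \<longleftrightarrow> h < F z"
  proof (rule same_side[OF w(5)])
    show "w' \<notin> ?L" using e(2)[OF w(1-4)] by simp
    show "\<And>y. w' < y \<Longrightarrow> y \<le> z \<Longrightarrow> y \<notin> ?L" using max w by force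
  qed
  ultimately show ?case using nl(2) by auto
qed

text \<open>
  At a jump the position itself may be a level point; the claim is transferred from a point
  slightly to the right.
\<close>

lemma above_level_iff_odd:
  assumes h: "0 < h" and fin: "finite (level_set F h)" and c: "\<And>x. x \<in> level_set F h \<Longrightarrow> crosses h x"
    and z: "F z \<noteq> h"
  shows "h < F z \<longleftrightarrow> odd (card (level_set F h \<inter> {..z}))"
proof -
  let ?L = "level_set F h"
  obtain e where e: "0 < e" "\<And>w. w \<noteq> z \<Longrightarrow> \<bar>w - z\<bar> < e \<Longrightarrow> w \<notin> ?L"
    using isolated_level[OF fin] by blast
  have "\<forall>\<^sub>F w in at_right z. h < F w \<longleftrightarrow> h < F z"
  proof (cases "h < F z")
    case True
    then show ?thesis using order_tendstoD(1)[OF right_cont True] by (auto elim!: eventually_mono)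
  next
    case False
    then have "F z < h" using z by simp
    then show ?thesis using order_tendstoD(2)[OF right_cont \<open>F z < h\<close>] by (auto elim!: eventually_mono)
  qed
  then obtain y where y: "z < y" "\<And>w. z < w \<Longrightarrow> w < y \<Longrightarrow> h < F w \<longleftrightarrow> h < F z"
    unfolding eventually_at_right_field by blast
  define d where "d = min e (y - z)"
  have d: "0 < d" "d \<le> e" "d \<le> y - z" using e(1) y(1) by (auto simp: d_def)
  define w where "w = z + d / 2"
  have w: "z < w" "w < y" "w < z + e" using d by (auto simp: w_def field_simps)
  have nl: "v \<notin> ?L" if "z < v" "v \<le> w" for v using e(2)[of v] that w by auto
  have "v \<le> w \<longleftrightarrow> v \<le> z" if "v \<in> ?L" for v using nl[of v] w(1) that by (cases "v \<le> z") auto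
  then have "?L \<inter> {..w} = ?L \<inter> {..z}" by auto
  then show ?thesis
    using above_level_iff_odd_aux[OF h fin c nl[OF w(1) order_refl] refl] y(2)[OF w(1,2)] by simp
qed

text \<open>
  \<open>F\<close> returns below \<open>h > 0\<close> near \<open>\<infinity>\<close>, so the total number of crossings is even. Negative levels
  reduce to \<open>- F\<close>.
\<close>

lemma even_card_level_set:
  assumes h: "h \<noteq> 0" and fin: "finite (level_set F h)" and c: "\<And>x. x \<in> level_set F h \<Longrightarrow> crosses h x"
  shows "even (card (level_set F h))"
proof -
  have pos: "even (card (level_set G k))"
    if G: "cadlag G" "0 < k" "finite (level_set G k)" "\<And>x. x \<in> level_set G k \<Longrightarrow> cadlag.crosses G k x" for G k
  proof -
    interpret G: cadlag G by fact
    have "\<forall>\<^sub>F z in at_top. G z < k" using G.lim_top G(2) by (rule order_tendstoD)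
    moreover have "\<forall>\<^sub>F z in at_top. \<forall>x\<in>level_set G k. x \<le> z"
      using G(3) by (intro eventually_ball_finite) (auto intro: eventually_ge_at_top)
    ultimately have "\<forall>\<^sub>F z in at_top. G z < k \<and> (\<forall>x\<in>level_set G k. x \<le> z)" by eventually_elim simp
    then obtain z where z: "G z < k" "\<forall>x\<in>level_set G k. x \<le> z"
      using eventually_happens'[OF trivial_limit_at_top_linorder] by blast
    then have "level_set G k \<inter> {..z} = level_set G k" by auto
    then show ?thesis using G.above_level_iff_odd[OF G(2-4), of z] z(1) by auto
  qed
  show ?thesis
  proof (cases "0 < h")
    case True
    then show ?thesis using pos[OF cadlag_axioms True fin c] by simp
  next
    case False
    then have "even (card (level_set (\<lambda>x. - F x) (- h)))"
      using h fin c by (intro pos cadlag_uminus) (auto simp: level_set_uminus crosses_uminus)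
    then show ?thesis by (simp add: level_set_uminus)
  qed
qed

text \<open>
  If \<open>F \<ge> k > h\<close> on \<open>[a, b]\<close>, then the left limits in \<open>]a, b]\<close> are \<open>\<ge> k\<close> as well, so the
  completed graph does not meet \<open>h\<close> there.
\<close>

lemma same_odd_count_if_above:
  assumes h: "0 < h" and fin: "finite (level_set F h)" and c: "\<And>x. x \<in> level_set F h \<Longrightarrow> crosses h x"
    and ab: "a \<le> b" and above: "\<And>u. a \<le> u \<Longrightarrow> u \<le> b \<Longrightarrow> k \<le> F u" and hk: "h < k"
  shows "card (level_set F h \<inter> {..a}) = card (level_set F h \<inter> {..b}) \<and> odd (card (level_set F h \<inter> {..a}))"
proof -
  have "h < F a" using above[of a] ab hk by simp
  moreover have "x \<notin> level_set F h" if "a < x" "x \<le> b" for x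
  proof -
    have "k \<le> Lim (at_left x) F"
    proof (rule tendsto_lowerbound[OF left_limit])
      show "\<forall>\<^sub>F u in at_left x. k \<le> F u"
        unfolding eventually_at_left_field using that above by (intro exI[of _ a]) auto
    qed simp
    moreover have "k \<le> F x" using that above by simp
    ultimately show ?thesis using hk by (auto simp: level_set_iff mem_F_star)
  qed
  then have "level_set F h \<inter> {..a} = level_set F h \<inter> {..b}" using ab by force
  ultimately show ?thesis using above_level_iff_odd[OF h fin c, of a] by auto
qed

end

section \<open>Measurability of the level points and of the kernel\<close>

text \<open>
  The half-open cells of length \<open>1 / (m + 1)\<close>, numbered by naturals so that sums over all cells
  are series.
\<close>

definition cell_code :: "nat \<Rightarrow> real \<Rightarrow> nat" where
  "cell_code m x = int_encode \<lceil>real (Suc m) * x\<rceil>"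

lemma eventually_inj_cell_code:
  assumes "finite B"
  shows "\<forall>\<^sub>F m in sequentially. inj_on (cell_code m) B"
proof -
  have "\<forall>\<^sub>F m in sequentially. x \<noteq> y \<longrightarrow> cell_code m x \<noteq> cell_code m y" for x y
  proof -
    have less: "\<forall>\<^sub>F m in sequentially. cell_code m x \<noteq> cell_code m y" if "x < y" for x y
    proof -
      obtain n :: nat where n: "1 / (y - x) < n" using reals_Archimedean2 by blast
      show ?thesis
        using eventually_ge_at_top[of n]
      proof eventually_elim
        case (elim m)
        have "1 / (y - x) < real (Suc m)" using n elim by linarith
        then have "1 < real (Suc m) * (y - x)" using that by (simp add: field_simps)
        then have "real (Suc m) * x + 1 < real (Suc m) * y" by (simp only: right_diff_distrib)
        then have "\<lceil>real (Suc m) * x\<rceil> \<noteq> \<lceil>real (Suc m) * y\<rceil>" by linarith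
        then show ?case by (simp add: cell_code_def inj_eq[OF inj_int_encode])
      qed
    qed
    show ?thesis
    proof (cases x y rule: linorder_cases)
      case greater
      then show ?thesis using less[of y x] by (auto elim!: eventually_mono)
    qed (auto intro: eventually_mono[OF less])
  qed
  then have "\<forall>\<^sub>F m in sequentially. \<forall>x\<in>B. \<forall>y\<in>B. x \<noteq> y \<longrightarrow> cell_code m x \<noteq> cell_code m y"
    by (intro eventually_ball_finite[OF assms] ballI)
  then show ?thesis by eventually_elim (auto simp: inj_on_def)
qed

text \<open>
  Finitely many points lie in different cells as soon as the cells are short enough.
\<close>

lemma cardinality_eq_liminf_cell_codes:
  "emeasure (count_space UNIV) A = liminf (\<lambda>m. emeasure (count_space UNIV) (cell_code m ` A))"
proof (rule antisym)
  have fin: "of_nat (card B) \<le> liminf (\<lambda>m. emeasure (count_space UNIV) (cell_code m ` A))"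
    if "finite B" "B \<subseteq> A" for B
  proof (rule Liminf_bounded)
    show "\<forall>\<^sub>F m in sequentially. of_nat (card B) \<le> emeasure (count_space UNIV) (cell_code m ` A)"
      using eventually_inj_cell_code[OF that(1)]
    proof eventually_elim
      case (elim m)
      have "of_nat (card B) = emeasure (count_space UNIV) (cell_code m ` B)"
        using elim that(1) by (simp add: emeasure_count_space card_image)
      also have "\<dots> \<le> emeasure (count_space UNIV) (cell_code m ` A)"
        using that by (intro emeasure_mono) auto
      finally show ?case .
    qed
  qed
  show "emeasure (count_space UNIV) A \<le> liminf (\<lambda>m. emeasure (count_space UNIV) (cell_code m ` A))" (is "_ \<le> ?l")
  proof (cases "finite A")
    case True
    then show ?thesis using fin[of A] by (simp add: emeasure_count_space)
  next
    case False
    have "of_nat n \<le> ?l" for n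
      using infinite_arbitrarily_large[OF False, of n] fin by auto
    then have "?l = \<top>" using ennreal_Ex_less_of_nat[of ?l] by (metis leD not_less_iff_gr_or_eq top.not_eq_extremum)
    then show ?thesis by simp
  qed
  have "emeasure (count_space UNIV) (cell_code m ` A) \<le> emeasure (count_space UNIV) A" for m
  proof (cases "finite A")
    case True
    then show ?thesis using card_image_le[OF True, of "cell_code m"] by (simp add: emeasure_count_space)
  qed (simp add: emeasure_count_space)
  then have "liminf (\<lambda>m. emeasure (count_space UNIV) (cell_code m ` A)) \<le> liminf (\<lambda>m::nat. emeasure (count_space UNIV) A)"
    by (intro Liminf_mono always_eventually) auto
  then show "liminf (\<lambda>m. emeasure (count_space UNIV) (cell_code m ` A)) \<le> emeasure (count_space UNIV) A"
    by (simp add: Liminf_const)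
qed

lemma is_interval_cell: "is_interval {x. cell_code m x = k}"
  unfolding is_interval_1
proof (intro ballI allI impI)
  fix a b x assume a: "a \<in> {x. cell_code m x = k}" and b: "b \<in> {x. cell_code m x = k}" and x: "a \<le> x \<and> x \<le> b"
  have "\<lceil>real (Suc m) * a\<rceil> \<le> \<lceil>real (Suc m) * x\<rceil>" "\<lceil>real (Suc m) * x\<rceil> \<le> \<lceil>real (Suc m) * b\<rceil>"
    using x by (auto intro!: ceiling_mono mult_left_mono)
  moreover have "\<lceil>real (Suc m) * a\<rceil> = \<lceil>real (Suc m) * b\<rceil>"
    using a b by (simp add: cell_code_def) (metis inj_eq[OF inj_int_encode])
  ultimately show "x \<in> {x. cell_code m x = k}" using a by (simp add: cell_code_def)
qed

lemma cell_eq_Ioc: "{x. cell_code m x = k} = {(of_int (int_decode k) - 1) / Suc m<..of_int (int_decode k) / Suc m}"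
proof -
  have "cell_code m x = k \<longleftrightarrow> \<lceil>real (Suc m) * x\<rceil> = int_decode k" for x
    unfolding cell_code_def by (metis int_decode_inverse int_encode_inverse)
  moreover have "\<lceil>real (Suc m) * x\<rceil> = j \<longleftrightarrow> (of_int j - 1) / Suc m < x \<and> x \<le> of_int j / Suc m" for x j
    by (simp add: ceiling_eq_iff pos_divide_less_eq pos_le_divide_eq mult.commute del: of_nat_Suc)
  ultimately show ?thesis by (simp add: set_eq_iff del: of_nat_Suc)
qed

context cadlag
begin

definition level_count :: "real set \<Rightarrow> real \<Rightarrow> ennreal" where
  "level_count S h = emeasure (count_space UNIV) (level_set F h \<inter> S)"

lemma level_codes_eq_suminf:
  "emeasure (count_space UNIV) (cell_code m ` (level_set F h \<inter> S))
   = (\<Sum>k. indicator (\<Union>x\<in>S \<inter> {x. cell_code m x = k}. F_star F x) h)"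
proof -
  have "emeasure (count_space UNIV) (cell_code m ` (level_set F h \<inter> S))
    = (\<integral>\<^sup>+ k. indicator (cell_code m ` (level_set F h \<inter> S)) k \<partial>count_space UNIV)" by simp
  also have "\<dots> = (\<Sum>k. indicator (cell_code m ` (level_set F h \<inter> S)) k)"
    by (rule nn_integral_count_space_nat)
  also have "\<dots> = (\<Sum>k. indicator (\<Union>x\<in>S \<inter> {x. cell_code m x = k}. F_star F x) h)"
    by (intro suminf_cong) (auto simp: indicator_def level_set_iff)
  finally show ?thesis .
qed

lemma F_star_image_cell_borel:
  "is_interval S \<Longrightarrow> (\<Union>x\<in>S \<inter> {x. cell_code m x = k}. F_star F x) \<in> sets borel"
  by (intro real_interval_borel_measurable is_interval_F_star_image is_interval_Int is_interval_cell)

text \<open>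
  The count is a limit inferior of the numbers of cells over which the graph meets the level,
  and the levels met over one cell form an interval.
\<close>

lemma borel_measurable_level_count:
  assumes S: "is_interval S"
  shows "level_count S \<in> borel_measurable borel"
proof -
  have [measurable]: "(\<lambda>h. indicator (\<Union>x\<in>S \<inter> {x. cell_code m x = k}. F_star F x) h :: ennreal) \<in> borel_measurable borel" for m k
    by (intro borel_measurable_indicator F_star_image_cell_borel S)
  have "level_count S = (\<lambda>h. liminf (\<lambda>m. \<Sum>k. indicator (\<Union>x\<in>S \<inter> {x. cell_code m x = k}. F_star F x) h))"
    unfolding level_count_def level_codes_eq_suminf[symmetric] by (intro ext cardinality_eq_liminf_cell_codes)
  then show ?thesis by simp
qed

lemma level_count_eq_card: "finite (level_set F h) \<Longrightarrow> level_count S h = of_nat (card (level_set F h \<inter> S))"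
  by (simp add: level_count_def emeasure_count_space)

lemma level_count_eq_of_nat_iff:
  "level_count UNIV h = of_nat n \<longleftrightarrow> finite (level_set F h) \<and> card (level_set F h) = n"
  by (cases "finite (level_set F h)") (simp_all add: level_count_def emeasure_count_space)

lemma regular_level_if_not_extremal:
  assumes "h \<noteq> 0" "h \<notin> extremal_levels" "finite (level_set F h)" "level_set F h \<noteq> {}"
  shows "regular_level F h"
proof -
  have c: "crosses h x" if "x \<in> level_set F h" for x
    using crosses_if_not_extremal that assms by blast
  show ?thesis
    using assms even_card_level_set[OF assms(1,3) c] i_pm_eq_card[OF assms(3) c] by (simp add: regular_level_def)
qed

text \<open>
  Off the countable set of extremal levels, regularity is a condition on the Borel measurable
  number of level points.
\<close>

lemma regular_levels_borel: "{h. regular_level F h} \<in> sets borel"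
proof -
  note [measurable] = borel_measurable_level_count[OF is_interval_univ]
  let ?A = "\<lambda>n. {h. level_count UNIV h = of_nat n}"
  define R0 where "R0 = (\<Union>n\<in>{n. even n \<and> 0 < n}. ?A n) - {0}"
  have A: "?A n \<in> sets borel" for n
  proof -
    have "?A n = level_count UNIV -` {of_nat n} \<inter> space borel" by auto
    then show ?thesis
      using measurable_sets[OF borel_measurable_level_count[OF is_interval_univ], of "{of_nat n}"] by simp
  qed
  have R0: "R0 \<in> sets borel" unfolding R0_def using A by (intro sets.Diff sets.countable_UN') auto
  have count: "B \<in> sets borel" if "B \<subseteq> extremal_levels" for B :: "real set"
    by (rule sets.countable[OF _ countable_subset[OF that countable_extremal_levels]]) simp
  have dec: "{h. regular_level F h} = (R0 - extremal_levels) \<union> ({h. regular_level F h} \<inter> extremal_levels)"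
  proof -
    have "h \<in> R0" if "regular_level F h" for h
      using that by (auto simp: regular_level_def R0_def level_count_eq_of_nat_iff card_gt_0_iff)
    moreover have "regular_level F h" if "h \<in> R0 - extremal_levels" for h
      using that by (intro regular_level_if_not_extremal) (auto simp: R0_def level_count_eq_of_nat_iff)
    ultimately show ?thesis by auto
  qed
  show ?thesis
    by (subst dec) (rule sets.Un[OF sets.Diff[OF R0 count[OF order_refl]] count[OF inf_le2]])
qed

text \<open>
  Extended by \<open>0\<close> so as to be a function on all levels.
\<close>

definition level_point :: "nat \<Rightarrow> real \<Rightarrow> real" where
  "level_point j h = (if regular_level F h \<and> j < card (level_set F h)
     then sorted_list_of_set (level_set F h) ! j else 0)"

lemma less_card_level_borel:
  assumes "is_interval S"
  shows "{h. regular_level F h \<and> j < card (level_set F h \<inter> S)} \<in> sets borel"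
proof -
  note [measurable] = borel_measurable_level_count[OF assms] regular_levels_borel
  have "{h. regular_level F h \<and> j < card (level_set F h \<inter> S)}
      = {h. regular_level F h} \<inter> (level_count S -` {of_nat j<..} \<inter> space borel)"
    by (auto simp: regular_level_def level_count_eq_card)
  then show ?thesis
    using measurable_sets[OF borel_measurable_level_count[OF assms], of "{of_nat j<..}"] by simp
qed

text \<open>
  The \<open>j\<close>-th level point is \<open>\<le> a\<close> iff more than \<open>j\<close> level points are \<open>\<le> a\<close>.
\<close>

lemma borel_measurable_level_point [measurable]: "level_point j \<in> borel_measurable borel"
  unfolding borel_measurable_iff_le
proof
  fix a
  have "{h \<in> space borel. level_point j h \<le> a} = {h. regular_level F h \<and> j < card (level_set F h \<inter> {..a})}
     \<union> (if 0 \<le> a then - {h. regular_level F h \<and> j < card (level_set F h \<inter> UNIV)} else {})"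
  proof -
    have "level_point j h \<le> a \<longleftrightarrow> j < card (level_set F h \<inter> {..a})" if "regular_level F h" "j < card (level_set F h)" for h
      using that nth_sorted_list_of_set_le_iff[of "level_set F h" j a] by (simp add: level_point_def regular_level_def)
    moreover have "j < card (level_set F h)" if "regular_level F h" "j < card (level_set F h \<inter> {..a})" for h
      using that card_mono[of "level_set F h" "level_set F h \<inter> {..a}"] by (auto simp: regular_level_def)
    moreover have "level_point j h = 0" if "\<not> (regular_level F h \<and> j < card (level_set F h))" for h
      using that by (auto simp: level_point_def)
    ultimately show ?thesis by (auto split: if_splits) (metis+)?
  qed
  moreover have "is_interval {..a}" "is_interval (UNIV :: real set)" by (auto simp: is_interval_1)
  ultimately show "{h \<in> space borel. level_point j h \<le> a} \<in> sets borel"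
    using less_card_level_borel[of "{..a}" j] less_card_level_borel[of UNIV j] by auto
qed

text \<open>
  Integrated over \<open>h\<close> this gives the excursion coupling: the density of the law of the level is
  half the number of level points, which is the number of pairs, and cancels the normalisation
  of the uniform law.
\<close>

definition pair_count :: "(real \<times> real) set \<Rightarrow> real \<Rightarrow> ennreal" where
  "pair_count E h = (if regular_level F h then of_nat (card (excursion_pairs F h \<inter> E)) else 0)"

text \<open>
  Written as a series over the index of the pair, the count is visibly measurable.
\<close>

lemma pair_count_eq_suminf:
  "pair_count E h = (\<Sum>k. indicator {h. regular_level F h \<and> 2 * k + 1 < card (level_set F h \<inter> UNIV)} h *
     indicator E (if 0 < h then (level_point (2 * k) h, level_point (2 * k + 1) h)
       else (level_point (2 * k + 1) h, level_point (2 * k) h)))"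
proof (cases "regular_level F h")
  case False
  then show ?thesis by (simp add: pair_count_def indicator_def)
next
  case True
  let ?L = "level_set F h"
  let ?K = "{k. 2 * k + 1 < card ?L}"
  let ?xs = "sorted_list_of_set ?L"
  let ?f = "\<lambda>k. if 0 < h then (?xs ! (2 * k), ?xs ! (2 * k + 1)) else (?xs ! (2 * k + 1), ?xs ! (2 * k))"
  have reg: "h \<noteq> 0" "finite ?L" using True by (auto simp: regular_level_def)
  have pairs: "excursion_pairs F h = ?f ` ?K"
    using reg by (cases "0 < h") (simp_all add: excursion_pairs_pos excursion_pairs_neg)
  have inj: "inj_on ?f ?K" using pair_inj[OF reg(2)] by (cases "0 < h") simp_all
  have "excursion_pairs F h \<inter> E = ?f ` {k \<in> ?K. ?f k \<in> E}" unfolding pairs by blast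
  then have card_eq: "card (excursion_pairs F h \<inter> E) = card {k \<in> ?K. ?f k \<in> E}"
    by (simp only:) (rule card_image, rule inj_on_subset[OF inj], blast)
  have "of_nat (card (excursion_pairs F h \<inter> E)) = (\<Sum>k\<in>?K. indicator E (?f k) :: ennreal)"
    unfolding card_eq using finite_pair_index[of "card ?L"] by (simp add: indicator_def sum.If_cases Int_def)
  also have "\<dots> = (\<Sum>k\<in>?K. indicator {h. regular_level F h \<and> 2 * k + 1 < card (level_set F h \<inter> UNIV)} h *
     indicator E (if 0 < h then (level_point (2 * k) h, level_point (2 * k + 1) h)
       else (level_point (2 * k + 1) h, level_point (2 * k) h)))"
  proof (rule sum.cong[OF refl])
    fix k assume k: "k \<in> ?K"
    then have "level_point (2 * k) h = ?xs ! (2 * k)" "level_point (2 * k + 1) h = ?xs ! (2 * k + 1)"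
      using True by (simp_all add: level_point_def)
    moreover have "h \<in> {h. regular_level F h \<and> 2 * k + 1 < card (level_set F h \<inter> UNIV)}" using k True by simp
    ultimately show "indicator E (?f k) = (indicator {h. regular_level F h \<and> 2 * k + 1 < card (level_set F h \<inter> UNIV)} h *
     indicator E (if 0 < h then (level_point (2 * k) h, level_point (2 * k + 1) h)
       else (level_point (2 * k + 1) h, level_point (2 * k) h)) :: ennreal)"
      by (simp only: indicator_simps mult_1)
  qed
  also have "\<dots> = (\<Sum>k. indicator {h. regular_level F h \<and> 2 * k + 1 < card (level_set F h \<inter> UNIV)} h *
     indicator E (if 0 < h then (level_point (2 * k) h, level_point (2 * k + 1) h)
       else (level_point (2 * k + 1) h, level_point (2 * k) h)))"
    by (rule suminf_finite[symmetric, OF finite_pair_index]) (simp add: indicator_def)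
  finally show ?thesis using True by (simp add: pair_count_def)
qed

lemma borel_measurable_pair_count [measurable]:
  assumes [measurable]: "E \<in> sets borel"
  shows "pair_count E \<in> borel_measurable borel"
proof -
  have [measurable]: "{h. regular_level F h \<and> 2 * k + 1 < card (level_set F h \<inter> UNIV)} \<in> sets borel" for k
    by (intro less_card_level_borel is_interval_univ)
  have pt: "(\<lambda>h. if 0 < h then (level_point (2 * k) h, level_point (2 * k + 1) h)
       else (level_point (2 * k + 1) h, level_point (2 * k) h)) \<in> borel \<rightarrow>\<^sub>M (borel :: (real \<times> real) measure)" for k
    unfolding borel_prod[symmetric] by measurable
  have [measurable]: "(\<lambda>h. indicator E (if 0 < h then (level_point (2 * k) h, level_point (2 * k + 1) h)
       else (level_point (2 * k + 1) h, level_point (2 * k) h)) :: ennreal) \<in> borel_measurable borel" for k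
    using measurable_compose[OF pt[of k] borel_measurable_indicator[OF assms]] by simp
  show ?thesis unfolding pair_count_eq_suminf[abs_def] by measurable
qed

lemma regular_pair_count:
  assumes "regular_level F h"
  shows "2 * pair_count UNIV h = level_count UNIV h" "pair_count UNIV h \<noteq> 0" "pair_count UNIV h \<noteq> \<top>"
proof -
  have reg: "h \<noteq> 0" "finite (level_set F h)" "even (card (level_set F h))" "level_set F h \<noteq> {}"
    using assms by (auto simp: regular_level_def)
  have c: "card (excursion_pairs F h) = card (level_set F h) div 2" by (rule card_excursion_pairs[OF reg(1-3)])
  have "0 < card (level_set F h)" using reg by (simp add: card_gt_0_iff)
  then have pos: "0 < card (level_set F h) div 2" using reg(3) by (auto elim!: evenE)
  have "2 * pair_count UNIV h = of_nat (2 * (card (level_set F h) div 2))"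
    using assms by (simp add: pair_count_def c)
  also have "2 * (card (level_set F h) div 2) = card (level_set F h)" using reg(3) by simp
  finally show "2 * pair_count UNIV h = level_count UNIV h" by (simp add: level_count_eq_card reg(2))
  show "pair_count UNIV h \<noteq> 0" "pair_count UNIV h \<noteq> \<top>"
    using assms pos by (simp_all add: pair_count_def c)
qed

lemma sets_excursion_kernel: "sets (excursion_kernel F h) = sets borel"
  by (simp add: excursion_kernel_def)

lemma emeasure_excursion_kernel:
  assumes "E \<in> sets borel"
  shows "emeasure (excursion_kernel F h) E
    = (if regular_level F h then pair_count E h / pair_count UNIV h else indicator E (0, 0))"
proof (cases "regular_level F h")
  case True
  let ?S = "excursion_pairs F h"
  have reg: "h \<noteq> 0" "finite (level_set F h)" "even (card (level_set F h))"
    using True by (auto simp: regular_level_def)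
  have fin: "finite ?S" by (rule card_excursion_pairs[OF reg])
  have "card ?S \<noteq> 0" using regular_pair_count(2)[OF True] True by (auto simp: pair_count_def)
  then have ne: "?S \<noteq> {}" and pos: "0 < card ?S" by auto
  have "emeasure (excursion_kernel F h) E = emeasure (measure_pmf (pmf_of_set ?S)) E"
    using True assms by (simp add: excursion_kernel_def emeasure_distr)
  also have "\<dots> = ennreal (card (?S \<inter> E) / card ?S)" by (rule emeasure_pmf_of_set[OF ne fin])
  also have "\<dots> = pair_count E h / pair_count UNIV h"
    using True pos by (simp add: pair_count_def divide_ennreal[symmetric] ennreal_of_nat_eq_real_of_nat)
  finally show ?thesis using True by simp
next
  case False
  then show ?thesis using assms by (simp add: excursion_kernel_def)
qed

lemma measurable_excursion_kernel:
  "excursion_kernel F \<in> borel \<rightarrow>\<^sub>M subprob_algebra borel"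
proof (rule measurable_subprob_algebra)
  fix h
  show "subprob_space (excursion_kernel F h)"
  proof (rule prob_space_imp_subprob_space, cases "regular_level F h")
    case True
    then show "prob_space (excursion_kernel F h)"
      by (auto simp: excursion_kernel_def intro!: measure_pmf.prob_space_distr)
  next
    case False
    then show "prob_space (excursion_kernel F h)"
      by (auto simp: excursion_kernel_def intro!: prob_space_return)
  qed
next
  fix E :: "(real \<times> real) set" assume [measurable]: "E \<in> sets borel"
  have [measurable]: "Measurable.pred borel (regular_level F)"
    using regular_levels_borel by (simp add: pred_def)
  show "(\<lambda>h. emeasure (excursion_kernel F h) E) \<in> borel_measurable borel"
    unfolding emeasure_excursion_kernel[OF \<open>E \<in> sets borel\<close>] by measurable
qed (rule sets_excursion_kernel)

text \<open>
  The condition \<open>h \<noteq> F u\<close> excludes the level at which \<open>u\<close> is the left end of an excursion that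
  starts with the value \<open>h\<close>.
\<close>

lemma card_pairs_forward_le:
  assumes h: "h \<noteq> 0" "h \<notin> extremal_levels" and fin: "finite (level_set F h)" and hu: "h \<noteq> F u"
  shows "card (excursion_pairs F h \<inter> ({..u} \<times> {u<..})) \<le> (if 0 < h \<and> h < F u then 1 else 0)"
proof -
  have c: "crosses h x" if "x \<in> level_set F h" for x by (rule crosses_if_not_extremal[OF fin that h(2)])
  have ev: "even (card (level_set F h))" by (rule even_card_level_set[OF h(1) fin c])
  show ?thesis
  proof (cases "0 < h")
    case True
    then show ?thesis
      using above_level_iff_odd[OF True fin c hu[symmetric]]
      by (simp add: card_excursion_pairs_forward[OF True fin ev])
  next
    case False
    then have neg: "h < 0" using h(1) by simp
    have "excursion_pairs (\<lambda>x. - F x) (- h) \<inter> ({u<..} \<times> {..u}) = {}"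
      using neg fin by (intro excursion_pairs_backward_empty) (auto simp: level_set_uminus)
    then have "excursion_pairs F h \<inter> ({..u} \<times> {u<..}) = {}"
      unfolding excursion_pairs_uminus[OF neg fin] by auto
    then show ?thesis by simp
  qed
qed

lemma card_pairs_forward_ge:
  assumes h: "0 < h" "h \<notin> extremal_levels" and fin: "finite (level_set F h)"
    and ab: "a \<le> b" and above: "\<And>u. a \<le> u \<Longrightarrow> u \<le> b \<Longrightarrow> k \<le> F u" and hk: "h < k"
  shows "card (excursion_pairs F h \<inter> ({..a} \<times> {b<..})) = 1" "level_set F h \<noteq> {}"
proof -
  have c: "crosses h x" if "x \<in> level_set F h" for x by (rule crosses_if_not_extremal[OF fin that h(2)])
  have ev: "even (card (level_set F h))" using h(1) by (intro even_card_level_set fin c) auto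
  note odd = same_odd_count_if_above[OF h(1) fin c ab above hk]
  show "card (excursion_pairs F h \<inter> ({..a} \<times> {b<..})) = 1"
    unfolding card_excursion_pairs_forward[OF h(1) fin ev ab] by (rule if_P[OF odd])
  show "level_set F h \<noteq> {}" using odd by (metis card.empty even_zero inf_bot_left)
qed

lemma card_pairs_uminus:
  assumes h: "h \<noteq> 0" and fin: "finite (level_set F h)"
  shows "card (excursion_pairs F h \<inter> (B \<times> A)) = card (excursion_pairs (\<lambda>x. - F x) (- h) \<inter> (A \<times> B))"
proof -
  have swap: "card (prod.swap ` P \<inter> (B \<times> A)) = card (P \<inter> (A \<times> B))" for P :: "(real \<times> real) set" and A B
  proof -
    have "prod.swap ` P \<inter> (B \<times> A) = prod.swap ` (P \<inter> (A \<times> B))" by force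
    then show ?thesis by (simp add: card_image)
  qed
  show ?thesis
  proof (cases "h < 0")
    case True
    show ?thesis unfolding excursion_pairs_uminus[OF True fin] by (rule swap)
  next
    case False
    interpret neg: cadlag "\<lambda>x. - F x" by (rule cadlag_uminus)
    have "- h < 0" "finite (level_set (\<lambda>x. - F x) (- h))" using False h fin by (auto simp: level_set_uminus)
    from neg.excursion_pairs_uminus[OF this] show ?thesis using swap[of "excursion_pairs F h" A B] by simp
  qed
qed

end

section \<open>The coupling of mutually singular measures\<close>

lemma real_distributionI: "prob_space \<rho> \<Longrightarrow> sets \<rho> = sets borel \<Longrightarrow> real_distribution \<rho>"
  by (simp add: real_distribution_def real_distribution_axioms_def)

context
  fixes \<mu> \<nu> :: "real measure"
  assumes prob: "prob_space \<mu>" "prob_space \<nu>" and sets: "sets \<mu> = sets borel" "sets \<nu> = sets borel"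
begin

interpretation \<mu>: real_distribution \<mu> by (rule real_distributionI[OF prob(1) sets(1)])
interpretation \<nu>: real_distribution \<nu> by (rule real_distributionI[OF prob(2) sets(2)])

lemma cadlag_F_diff:
  shows "cadlag (F_diff \<mu> \<nu>)"
    and "Lim (at_left x) (F_diff \<mu> \<nu>) = measure \<mu> {..<x} - measure \<nu> {..<x}"
proof -
  have F: "F_diff \<mu> \<nu> = (\<lambda>x. cdf \<mu> x - cdf \<nu> x)" by (simp add: F_diff_def fun_eq_iff)
  have left: "(F_diff \<mu> \<nu> \<longlongrightarrow> measure \<mu> {..<x} - measure \<nu> {..<x}) (at_left x)" for x
    unfolding F by (intro tendsto_diff \<mu>.cdf_at_left \<nu>.cdf_at_left)
  show "cadlag (F_diff \<mu> \<nu>)"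
  proof
    fix x
    show "(F_diff \<mu> \<nu> \<longlongrightarrow> F_diff \<mu> \<nu> x) (at_right x)"
      unfolding F using \<mu>.cdf_is_right_cont[of x] \<nu>.cdf_is_right_cont[of x]
      by (intro tendsto_diff) (simp_all add: continuous_within)
    show "\<exists>l. (F_diff \<mu> \<nu> \<longlongrightarrow> l) (at_left x)" using left by blast
    show "(F_diff \<mu> \<nu> \<longlongrightarrow> 0) at_bot"
      unfolding F using tendsto_diff[OF \<mu>.cdf_lim_at_bot \<nu>.cdf_lim_at_bot] by simp
    show "(F_diff \<mu> \<nu> \<longlongrightarrow> 0) at_top"
      unfolding F using tendsto_diff[OF \<mu>.cdf_lim_at_top_prob \<nu>.cdf_lim_at_top_prob] by simp
  qed
  show "Lim (at_left x) (F_diff \<mu> \<nu>) = measure \<mu> {..<x} - measure \<nu> {..<x}"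
    by (rule tendsto_Lim[OF _ left]) simp
qed

text \<open>
  Relative to \<open>F c\<close>, all values and left limits on \<open>]c, d]\<close> lie between minus the \<open>\<nu>\<close>-mass and
  the \<open>\<mu>\<close>-mass of that interval.
\<close>

lemma emeasure_F_star_image_le:
  assumes cd: "c \<le> d"
  shows "emeasure lborel (\<Union>x\<in>{c<..d}. F_star (F_diff \<mu> \<nu>) x) \<le> emeasure \<mu> {c<..d} + emeasure \<nu> {c<..d}"
proof -
  interpret cadlag "F_diff \<mu> \<nu>" by (rule cadlag_F_diff(1))
  let ?F = "F_diff \<mu> \<nu>"
  let ?m = "measure \<mu> {c<..d}" and ?n = "measure \<nu> {c<..d}"
  have dec: "measure \<rho> {..x} = measure \<rho> {..c} + measure \<rho> {c<..x} \<and> measure \<rho> {..<x} = measure \<rho> {..c} + measure \<rho> {c<..<x}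
      \<and> measure \<rho> {c<..x} \<le> measure \<rho> {c<..d} \<and> measure \<rho> {c<..<x} \<le> measure \<rho> {c<..d}"
    if "real_distribution \<rho>" "c < x" "x \<le> d" for \<rho> x
  proof -
    interpret real_distribution \<rho> by fact
    have 1: "{..x} = {..c} \<union> {c<..x}" and 2: "{..<x} = {..c} \<union> {c<..<x}" using that by auto
    have "measure \<rho> ({..c} \<union> {c<..x}) = measure \<rho> {..c} + measure \<rho> {c<..x}"
      "measure \<rho> ({..c} \<union> {c<..<x}) = measure \<rho> {..c} + measure \<rho> {c<..<x}"
      by (intro finite_measure_Union; auto)+
    then show ?thesis unfolding 1 2 using that by (auto intro!: finite_measure_mono)
  qed
  have "(\<Union>x\<in>{c<..d}. F_star ?F x) \<subseteq> {?F c - ?n .. ?F c + ?m}"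
  proof
    fix h assume "h \<in> (\<Union>x\<in>{c<..d}. F_star ?F x)"
    then obtain x where x: "c < x" "x \<le> d" "h \<in> F_star ?F x" by auto
    have d\<mu>: "measure \<mu> {..x} = measure \<mu> {..c} + measure \<mu> {c<..x}" "measure \<mu> {..<x} = measure \<mu> {..c} + measure \<mu> {c<..<x}"
      "measure \<mu> {c<..x} \<le> ?m" "measure \<mu> {c<..<x} \<le> ?m" using dec[OF \<mu>.real_distribution_axioms x(1,2)] by auto
    have d\<nu>: "measure \<nu> {..x} = measure \<nu> {..c} + measure \<nu> {c<..x}" "measure \<nu> {..<x} = measure \<nu> {..c} + measure \<nu> {c<..<x}"
      "measure \<nu> {c<..x} \<le> ?n" "measure \<nu> {c<..<x} \<le> ?n" using dec[OF \<nu>.real_distribution_axioms x(1,2)] by auto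
    note nonneg = measure_nonneg[of \<mu> "{c<..x}"] measure_nonneg[of \<mu> "{c<..<x}"]
      measure_nonneg[of \<nu> "{c<..x}"] measure_nonneg[of \<nu> "{c<..<x}"]
    have "?F c - ?n \<le> ?F x" "?F x \<le> ?F c + ?m"
      unfolding F_diff_def cdf_def using d\<mu> d\<nu> nonneg by linarith+
    moreover have "?F c - ?n \<le> Lim (at_left x) ?F" "Lim (at_left x) ?F \<le> ?F c + ?m"
      unfolding cadlag_F_diff(2) unfolding F_diff_def cdf_def using d\<mu> d\<nu> nonneg by linarith+
    ultimately show "h \<in> {?F c - ?n .. ?F c + ?m}" using x(3) by (auto simp: mem_F_star)
  qed
  then have "emeasure lborel (\<Union>x\<in>{c<..d}. F_star ?F x) \<le> emeasure lborel {?F c - ?n .. ?F c + ?m}"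
    by (intro emeasure_mono) auto
  also have "\<dots> = ennreal (?m + ?n)" by (subst emeasure_lborel_Icc) (use measure_nonneg[of \<mu> "{c<..d}"] measure_nonneg[of \<nu> "{c<..d}"] in \<open>auto simp: algebra_simps\<close>)
  finally show ?thesis by (simp add: \<mu>.emeasure_eq_measure \<nu>.emeasure_eq_measure)
qed

text \<open>
  Fatou's lemma, applied to the counts of cells: a single cell meets a set of levels of measure
  at most its mass under \<open>\<mu> + \<nu>\<close>, and the cells are disjoint.
\<close>

lemma nn_integral_level_count_le:
  shows "(\<integral>\<^sup>+ h. cadlag.level_count (F_diff \<mu> \<nu>) UNIV h \<partial>lborel) \<le> 2"
proof -
  interpret cadlag "F_diff \<mu> \<nu>" by (rule cadlag_F_diff(1))
  let ?F = "F_diff \<mu> \<nu>"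
  let ?cell = "\<lambda>m k. {x. cell_code m x = k}"
  have cell_borel: "?cell m k \<in> sets borel" for m k by (intro real_interval_borel_measurable is_interval_cell)
  have [measurable]: "(\<lambda>h. indicator (\<Union>x\<in>?cell m k. F_star ?F x) h :: ennreal) \<in> borel_measurable borel" for m k
    using F_star_image_cell_borel[of UNIV m k] by (intro borel_measurable_indicator) simp
  have total: "(\<Sum>k. emeasure \<rho> (?cell m k)) = 1" if "real_distribution \<rho>" for \<rho> m
  proof -
    interpret real_distribution \<rho> by fact
    have "(\<Sum>k. emeasure \<rho> (?cell m k)) = emeasure \<rho> (\<Union>k. ?cell m k)"
      using cell_borel by (intro suminf_emeasure) (auto simp: disjoint_family_on_def)
    also have "(\<Union>k. ?cell m k) = space \<rho>" by auto
    finally show ?thesis using emeasure_space_1 by simp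
  qed
  have "(\<integral>\<^sup>+ h. level_count UNIV h \<partial>lborel)
     = (\<integral>\<^sup>+ h. liminf (\<lambda>m. \<Sum>k. indicator (\<Union>x\<in>?cell m k. F_star ?F x) h) \<partial>lborel)"
    unfolding level_count_def
    by (subst cardinality_eq_liminf_cell_codes, subst level_codes_eq_suminf) simp
  also have "\<dots> \<le> liminf (\<lambda>m. \<integral>\<^sup>+ h. (\<Sum>k. indicator (\<Union>x\<in>?cell m k. F_star ?F x) h) \<partial>lborel)"
    by (intro nn_integral_liminf) measurable
  also have "\<dots> \<le> liminf (\<lambda>m::nat. 2)"
  proof (intro Liminf_mono always_eventually allI)
    fix m
    have "(\<integral>\<^sup>+ h. (\<Sum>k. indicator (\<Union>x\<in>?cell m k. F_star ?F x) h) \<partial>lborel)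
      = (\<Sum>k. \<integral>\<^sup>+ h. indicator (\<Union>x\<in>?cell m k. F_star ?F x) h \<partial>lborel)"
      by (intro nn_integral_suminf) measurable
    also have "\<dots> = (\<Sum>k. emeasure lborel (\<Union>x\<in>?cell m k. F_star ?F x))"
      using F_star_image_cell_borel[of UNIV m] by (intro suminf_cong nn_integral_indicator) simp
    also have "\<dots> \<le> (\<Sum>k. emeasure \<mu> (?cell m k) + emeasure \<nu> (?cell m k))"
      unfolding cell_eq_Ioc
      by (intro suminf_le emeasure_F_star_image_le) (auto intro!: divide_right_mono)
    also have "\<dots> = 2"
      by (subst suminf_add[symmetric]) (auto simp: total[OF \<mu>.real_distribution_axioms] total[OF \<nu>.real_distribution_axioms])
    finally show "(\<integral>\<^sup>+ h. (\<Sum>k. indicator (\<Union>x\<in>?cell m k. F_star ?F x) h) \<partial>lborel) \<le> 2" .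
  qed
  finally show ?thesis by (simp add: Liminf_const)
qed

interpretation cadlag "F_diff \<mu> \<nu>" by (rule cadlag_F_diff(1))

lemma AE_finite_level: "AE h in lborel. finite (level_set (F_diff \<mu> \<nu>) h)"
proof -
  have "AE h in lborel. level_count UNIV h \<noteq> \<infinity>"
    using borel_measurable_level_count[OF is_interval_univ] nn_integral_level_count_le
    by (intro nn_integral_PInf_AE) (auto simp: top_unique)
  then show ?thesis
    by eventually_elim (auto simp: level_count_def emeasure_count_space split: if_splits)
qed

lemma AE_crosses: "AE h in lborel. h \<noteq> 0 \<and> h \<notin> extremal_levels \<and> finite (level_set (F_diff \<mu> \<nu>) h)"
proof -
  have "AE h in lborel. h \<notin> extremal_levels"
    by (rule AE_not_in[OF countable_imp_null_set_lborel[OF countable_extremal_levels]])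
  with AE_finite_level AE_lborel_singleton[of 0] show ?thesis by eventually_elim simp
qed

text \<open>
  The two densities agree almost everywhere. The one on the right is known to be Borel, so the
  integrals with respect to \<open>theta\<close> can be computed.
\<close>

lemma theta_eq: "theta (F_diff \<mu> \<nu>) = density lborel (level_count UNIV)"
proof -
  have "AE h in lborel. i_pm (F_diff \<mu> \<nu>) h = level_count UNIV h"
    using AE_crosses
  proof eventually_elim
    case (elim h)
    then show ?case
      using i_pm_eq_card[of h] crosses_if_not_extremal[of h] by (simp add: level_count_eq_card)
  qed
  then have "(\<integral>\<^sup>+ h. i_pm (F_diff \<mu> \<nu>) h * indicator A h \<partial>lborel) = (\<integral>\<^sup>+ h. level_count UNIV h * indicator A h \<partial>lborel)" for A
    by (intro nn_integral_cong_AE) auto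
  then show ?thesis unfolding theta_def density_def by simp
qed

lemma sets_excursion_coupling_singular: "sets (excursion_coupling_singular \<mu> \<nu>) = sets borel"
  unfolding excursion_coupling_singular_def Let_def
  by (rule sets_bind) (simp_all add: sets_excursion_kernel theta_eq space_scale_measure)

lemma emeasure_excursion_coupling_singular:
  assumes E: "E \<in> sets borel"
  shows "emeasure (excursion_coupling_singular \<mu> \<nu>) E = (\<integral>\<^sup>+ h. pair_count E h \<partial>lborel)"
proof -
  let ?F = "F_diff \<mu> \<nu>"
  note [measurable] = borel_measurable_level_count[OF is_interval_univ] borel_measurable_pair_count[OF E]
  have K: "(\<lambda>h. emeasure (excursion_kernel ?F h) E) \<in> borel_measurable borel"
    by (rule measurable_emeasure_kernel[OF measurable_excursion_kernel E])
  have K1: "excursion_kernel ?F \<in> scale_measure (1 / 2) (theta ?F) \<rightarrow>\<^sub>M subprob_algebra borel"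
    using measurable_excursion_kernel by (simp add: theta_eq cong: measurable_cong_sets)
  have "emeasure (excursion_coupling_singular \<mu> \<nu>) E = (\<integral>\<^sup>+ h. emeasure (excursion_kernel ?F h) E \<partial>scale_measure (1 / 2) (theta ?F))"
    unfolding excursion_coupling_singular_def Let_def
    by (rule emeasure_bind[OF _ K1 E]) (simp add: space_scale_measure theta_def)
  also have "\<dots> = 1 / 2 * (\<integral>\<^sup>+ h. emeasure (excursion_kernel ?F h) E \<partial>density lborel (level_count UNIV))"
    unfolding theta_eq using K by (intro nn_integral_scale_measure) simp
  also have "(\<integral>\<^sup>+ h. emeasure (excursion_kernel ?F h) E \<partial>density lborel (level_count UNIV))
     = (\<integral>\<^sup>+ h. level_count UNIV h * emeasure (excursion_kernel ?F h) E \<partial>lborel)"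
    using K by (intro nn_integral_density) simp_all
  also have "\<dots> = (\<integral>\<^sup>+ h. 2 * pair_count E h \<partial>lborel)"
  proof (rule nn_integral_cong_AE)
    show "AE h in lborel. level_count UNIV h * emeasure (excursion_kernel ?F h) E = 2 * pair_count E h"
      using AE_crosses
    proof eventually_elim
      case (elim h)
      show ?case
      proof (cases "level_set ?F h = {}")
        case True
        then show ?thesis by (simp add: level_count_def pair_count_def regular_level_def)
      next
        case False
        then have reg: "regular_level ?F h" using elim by (intro regular_level_if_not_extremal) auto
        have "level_count UNIV h * (pair_count E h / pair_count UNIV h) = 2 * (pair_count UNIV h * (pair_count E h / pair_count UNIV h))"
          unfolding regular_pair_count(1)[OF reg, symmetric] by (simp add: mult.assoc)
        also have "pair_count UNIV h * (pair_count E h / pair_count UNIV h) = pair_count E h"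
          using regular_pair_count(2,3)[OF reg] by (simp add: ennreal_times_divide mult_divide_eq_ennreal mult.commute)
        finally show ?thesis using reg by (simp add: emeasure_excursion_kernel[OF E])
      qed
    qed
  qed
  also have "\<dots> = 2 * (\<integral>\<^sup>+ h. pair_count E h \<partial>lborel)" by (intro nn_integral_cmult) simp
  also have "1 / 2 * (2 * (\<integral>\<^sup>+ h. pair_count E h \<partial>lborel)) = (\<integral>\<^sup>+ h. pair_count E h \<partial>lborel)"
    by (simp add: mult.assoc[symmetric] ennreal_divide_times)
  finally show ?thesis .
qed

lemma emeasure_forward_le: "emeasure (excursion_coupling_singular \<mu> \<nu>) ({..u} \<times> {u<..}) \<le> ennreal (max 0 (F_diff \<mu> \<nu> u))"
proof -
  let ?\<pi> = "excursion_coupling_singular \<mu> \<nu>"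
  have "emeasure ?\<pi> ({..u} \<times> {u<..}) = (\<integral>\<^sup>+ h. pair_count ({..u} \<times> {u<..}) h \<partial>lborel)"
    by (rule emeasure_excursion_coupling_singular) simp
  also have "\<dots> \<le> (\<integral>\<^sup>+ h. indicator {0..max 0 (F_diff \<mu> \<nu> u)} h \<partial>lborel)"
    using AE_crosses AE_lborel_singleton[of "F_diff \<mu> \<nu> u"]
  proof (intro nn_integral_mono_AE, eventually_elim)
    case (elim h)
    then have "card (excursion_pairs (F_diff \<mu> \<nu>) h \<inter> ({..u} \<times> {u<..})) \<le> (if 0 < h \<and> h < F_diff \<mu> \<nu> u then 1 else 0)"
      by (intro card_pairs_forward_le) auto
    then show ?case by (auto simp: pair_count_def indicator_def split: if_splits)
  qed
  also have "\<dots> = ennreal (max 0 (F_diff \<mu> \<nu> u))" by simp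
  finally show ?thesis .
qed

lemma emeasure_forward_ge:
  assumes ab: "a \<le> b" and k: "\<And>u. a \<le> u \<Longrightarrow> u \<le> b \<Longrightarrow> k \<le> F_diff \<mu> \<nu> u"
  shows "ennreal k \<le> emeasure (excursion_coupling_singular \<mu> \<nu>) ({..a} \<times> {b<..})"
proof -
  let ?\<pi> = "excursion_coupling_singular \<mu> \<nu>"
  have "ennreal k \<le> (\<integral>\<^sup>+ h. indicator {0<..<k} h \<partial>lborel)"
    by (cases "0 \<le> k") (simp_all add: ennreal_neg)
  also have "\<dots> \<le> (\<integral>\<^sup>+ h. pair_count ({..a} \<times> {b<..}) h \<partial>lborel)"
    using AE_crosses
  proof (intro nn_integral_mono_AE, eventually_elim)
    case (elim h)
    show ?case
    proof (cases "0 < h \<and> h < k")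
      case True
      have "card (excursion_pairs (F_diff \<mu> \<nu>) h \<inter> ({..a} \<times> {b<..})) = 1" "level_set (F_diff \<mu> \<nu>) h \<noteq> {}"
        by (rule card_pairs_forward_ge[of h a b k]; use elim True ab k in simp)+
      moreover then have "regular_level (F_diff \<mu> \<nu>) h" using elim by (intro regular_level_if_not_extremal) auto
      ultimately show ?thesis by (simp add: pair_count_def indicator_def)
    qed (auto simp: indicator_def)
  qed
  also have "\<dots> = emeasure ?\<pi> ({..a} \<times> {b<..})"
    by (rule emeasure_excursion_coupling_singular[symmetric]) simp
  finally show ?thesis .
qed

lemma emeasure_coupling_le_1: "emeasure (excursion_coupling_singular \<mu> \<nu>) UNIV \<le> 1"
proof -
  let ?\<pi> = "excursion_coupling_singular \<mu> \<nu>"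
  have "2 * emeasure ?\<pi> UNIV = (\<integral>\<^sup>+ h. 2 * pair_count UNIV h \<partial>lborel)"
    by (subst emeasure_excursion_coupling_singular) (simp_all add: nn_integral_cmult)
  also have "\<dots> \<le> (\<integral>\<^sup>+ h. level_count UNIV h \<partial>lborel)"
  proof (rule nn_integral_mono)
    fix h
    show "2 * pair_count UNIV h \<le> level_count UNIV h"
      using regular_pair_count(1)[of h] by (cases "regular_level (F_diff \<mu> \<nu>) h") (simp_all add: pair_count_def)
  qed
  also have "\<dots> \<le> 2 * 1" using nn_integral_level_count_le by simp
  finally show ?thesis by (subst (asm) ennreal_mult_le_mult_iff) auto
qed

end

text \<open>
  Exchanging \<open>\<mu>\<close> and \<open>\<nu>\<close> reflects the completed graph at the horizontal axis and exchanges the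
  entries of all pairs. The bounds for jumps to the left thus follow from those for jumps to the
  right.
\<close>

lemma emeasure_excursion_coupling_singular_commute:
  fixes \<mu> \<nu> :: "real measure"
  assumes prob: "prob_space \<mu>" "prob_space \<nu>" and sets: "sets \<mu> = sets borel" "sets \<nu> = sets borel"
    and [measurable]: "A \<in> sets borel" "B \<in> sets borel"
  shows "emeasure (excursion_coupling_singular \<nu> \<mu>) (A \<times> B) = emeasure (excursion_coupling_singular \<mu> \<nu>) (B \<times> A)"
proof -
  interpret cadlag "F_diff \<mu> \<nu>" by (rule cadlag_F_diff(1)[OF prob sets])
  interpret neg: cadlag "\<lambda>x. - F_diff \<mu> \<nu> x" by (rule cadlag_uminus)
  have F: "F_diff \<nu> \<mu> = (\<lambda>x. - F_diff \<mu> \<nu> x)" by (rule ext) (rule F_diff_commute)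
  have "countable (uminus ` neg.extremal_levels)" using neg.countable_extremal_levels by (rule countable_image)
  from AE_not_in[OF countable_imp_null_set_lborel[OF this]] AE_crosses[OF prob sets]
  have eq: "AE h in lborel. neg.pair_count (A \<times> B) (- h) = pair_count (B \<times> A) h"
  proof eventually_elim
    case (elim h)
    then have h: "- h \<notin> neg.extremal_levels" by (auto simp: image_iff)
    show ?case
    proof (cases "level_set (F_diff \<mu> \<nu>) h = {}")
      case True
      then show ?thesis
        by (simp add: pair_count_def neg.pair_count_def regular_level_def level_set_uminus)
    next
      case False
      then have "regular_level (F_diff \<mu> \<nu>) h" "regular_level (\<lambda>x. - F_diff \<mu> \<nu> x) (- h)"
        using elim h regular_level_if_not_extremal[of h] neg.regular_level_if_not_extremal[of "- h"]
        by (simp_all add: level_set_uminus)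
      then show ?thesis
        using card_pairs_uminus[of h B A] elim by (simp add: pair_count_def neg.pair_count_def)
    qed
  qed
  have "emeasure (excursion_coupling_singular \<nu> \<mu>) (A \<times> B) = (\<integral>\<^sup>+ h. neg.pair_count (A \<times> B) h \<partial>lborel)"
    using emeasure_excursion_coupling_singular[OF prob(2,1) sets(2,1), of "A \<times> B"] by (simp add: F)
  also have "\<dots> = (\<integral>\<^sup>+ h. neg.pair_count (A \<times> B) (- h) \<partial>lborel)"
    using nn_integral_real_affine[of "neg.pair_count (A \<times> B)" "- 1" 0] by simp
  also have "\<dots> = (\<integral>\<^sup>+ h. pair_count (B \<times> A) h \<partial>lborel)" by (rule nn_integral_cong_AE[OF eq])
  also have "\<dots> = emeasure (excursion_coupling_singular \<mu> \<nu>) (B \<times> A)"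
    by (rule emeasure_excursion_coupling_singular[OF prob sets, symmetric]) simp
  finally show ?thesis .
qed

context
  fixes \<mu> \<nu> :: "real measure"
  assumes prob: "prob_space \<mu>" "prob_space \<nu>" and sets: "sets \<mu> = sets borel" "sets \<nu> = sets borel"
begin

interpretation \<mu>: real_distribution \<mu> by (rule real_distributionI[OF prob(1) sets(1)])
interpretation \<nu>: real_distribution \<nu> by (rule real_distributionI[OF prob(2) sets(2)])

lemma emeasure_backward_le: "emeasure (excursion_coupling_singular \<mu> \<nu>) ({u<..} \<times> {..u}) \<le> ennreal (max 0 (- F_diff \<mu> \<nu> u))"
  using emeasure_forward_le[OF prob(2,1) sets(2,1), of u]
  by (simp add: emeasure_excursion_coupling_singular_commute[OF prob sets] F_diff_commute[of \<nu>])

lemma emeasure_backward_ge: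
  assumes "a \<le> b" "\<And>u. a \<le> u \<Longrightarrow> u \<le> b \<Longrightarrow> k \<le> - F_diff \<mu> \<nu> u"
  shows "ennreal k \<le> emeasure (excursion_coupling_singular \<mu> \<nu>) ({b<..} \<times> {..a})"
  using emeasure_forward_ge[OF prob(2,1) sets(2,1) assms(1), of k] assms(2)
  by (simp add: emeasure_excursion_coupling_singular_commute[OF prob sets] F_diff_commute[of \<nu>])

text \<open>
  The flows at single points show that the marginals \<open>\<mu>'\<close>, \<open>\<nu>'\<close> of the coupling satisfy
  \<open>\<mu>' - \<nu>' = \<mu> - \<nu>\<close>. Restricting this to a set that carries \<open>\<mu>\<close> and is null for \<open>\<nu>\<close> gives
  \<open>\<mu> \<le> \<mu>'\<close>, and symmetrically \<open>\<nu> \<le> \<nu>'\<close>. Equality follows since the total mass of the coupling is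
  at most \<open>1\<close>.
\<close>

lemma excursion_coupling_singular_marginals:
  assumes Y: "Y \<in> sets borel" "emeasure \<mu> (- Y) = 0" "emeasure \<nu> Y = 0"
  shows "excursion_coupling_singular \<mu> \<nu> \<in> Marg \<mu> \<nu>"
proof -
  let ?\<pi> = "excursion_coupling_singular \<mu> \<nu>"
  have s\<pi>: "sets ?\<pi> = sets borel" by (rule sets_excursion_coupling_singular[OF prob sets])
  have sp: "space ?\<pi> = UNIV" using sets_eq_imp_space_eq[OF s\<pi>] by simp
  note T = borel_Times[folded s\<pi>]
  define \<mu>' where "\<mu>' = distr ?\<pi> borel fst"
  define \<nu>' where "\<nu>' = distr ?\<pi> borel snd"
  have s': "sets \<mu>' = sets borel" "sets \<nu>' = sets borel" by (simp_all add: \<mu>'_def \<nu>'_def)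
  have \<mu>': "emeasure \<mu>' A = emeasure ?\<pi> (A \<times> UNIV)" and \<nu>': "emeasure \<nu>' A = emeasure ?\<pi> (UNIV \<times> A)"
    if "A \<in> sets borel" for A
    unfolding \<mu>'_def \<nu>'_def by (rule emeasure_distr_fst_snd[OF s\<pi> that])+
  have mass: "emeasure \<mu>' UNIV \<le> 1" "emeasure \<nu>' UNIV \<le> 1"
    using emeasure_coupling_le_1[OF prob sets] \<mu>'[of UNIV] \<nu>'[of UNIV] by simp_all
  have "finite_measure \<mu>'"
    using mass(1) s' sets_eq_imp_space_eq[OF s'(1)] by (intro finite_measureI) (auto simp: top_unique)
  then interpret \<mu>': finite_measure \<mu>' .
  have "finite_measure \<nu>'"
    using mass(2) s' sets_eq_imp_space_eq[OF s'(2)] by (intro finite_measureI) (auto simp: top_unique)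
  then interpret \<nu>': finite_measure \<nu>' .
  have "add_measure \<mu>' \<nu> = add_measure \<nu>' \<mu>"
  proof (rule measure_eqI_lessThan)
    fix a :: real
    have up: "emeasure ?\<pi> ({..a} \<times> {a<..}) = ennreal (max 0 (F_diff \<mu> \<nu> a))"
    proof (rule antisym[OF emeasure_forward_le[OF prob sets]])
      have "ennreal (max 0 (F_diff \<mu> \<nu> a)) = ennreal (F_diff \<mu> \<nu> a)" by (cases "0 \<le> F_diff \<mu> \<nu> a") (simp_all add: ennreal_neg)
      also have "\<dots> \<le> emeasure ?\<pi> ({..a} \<times> {a<..})" by (intro emeasure_forward_ge[OF prob sets]) (auto dest: antisym)
      finally show "ennreal (max 0 (F_diff \<mu> \<nu> a)) \<le> emeasure ?\<pi> ({..a} \<times> {a<..})" .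
    qed
    have down: "emeasure ?\<pi> ({a<..} \<times> {..a}) = ennreal (max 0 (- F_diff \<mu> \<nu> a))"
    proof (rule antisym[OF emeasure_backward_le])
      have "ennreal (max 0 (- F_diff \<mu> \<nu> a)) = ennreal (- F_diff \<mu> \<nu> a)" by (cases "0 \<le> - F_diff \<mu> \<nu> a") (simp_all add: ennreal_neg)
      also have "\<dots> \<le> emeasure ?\<pi> ({a<..} \<times> {..a})" by (intro emeasure_backward_ge) (auto dest: antisym)
      finally show "ennreal (max 0 (- F_diff \<mu> \<nu> a)) \<le> emeasure ?\<pi> ({a<..} \<times> {..a})" .
    qed
    have "emeasure \<mu>' {a<..} = emeasure ?\<pi> (({a<..} \<times> {a<..}) \<union> ({a<..} \<times> {..a}))"
      unfolding \<mu>'[OF borel_open[OF open_greaterThan]] by (rule arg_cong[where f="emeasure ?\<pi>"]) auto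
    also have "\<dots> = emeasure ?\<pi> ({a<..} \<times> {a<..}) + emeasure ?\<pi> ({a<..} \<times> {..a})"
      by (rule plus_emeasure[symmetric]) (auto intro!: T)
    finally have m1: "emeasure \<mu>' {a<..} = emeasure ?\<pi> ({a<..} \<times> {a<..}) + ennreal (max 0 (- F_diff \<mu> \<nu> a))" by (simp only: down)
    have "emeasure \<nu>' {a<..} = emeasure ?\<pi> (({a<..} \<times> {a<..}) \<union> ({..a} \<times> {a<..}))"
      unfolding \<nu>'[OF borel_open[OF open_greaterThan]] by (rule arg_cong[where f="emeasure ?\<pi>"]) auto
    also have "\<dots> = emeasure ?\<pi> ({a<..} \<times> {a<..}) + emeasure ?\<pi> ({..a} \<times> {a<..})"
      by (rule plus_emeasure[symmetric]) (auto intro!: T)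
    finally have m2: "emeasure \<nu>' {a<..} = emeasure ?\<pi> ({a<..} \<times> {a<..}) + ennreal (max 0 (F_diff \<mu> \<nu> a))" by (simp only: up)
    have compl: "measure \<rho> {a<..} = 1 - cdf \<rho> a" if "real_distribution \<rho>" for \<rho>
    proof -
      interpret real_distribution \<rho> by fact
      have "{a<..} = space \<rho> - {..a}" by auto
      then show ?thesis using prob_compl[of "{..a}"] by (simp add: cdf_def)
    qed
    have "max 0 (- F_diff \<mu> \<nu> a) + measure \<nu> {a<..} = max 0 (F_diff \<mu> \<nu> a) + measure \<mu> {a<..}"
      using compl[OF \<mu>.real_distribution_axioms] compl[OF \<nu>.real_distribution_axioms] by (simp add: F_diff_def max_def)
    then have "ennreal (max 0 (- F_diff \<mu> \<nu> a) + measure \<nu> {a<..}) = ennreal (max 0 (F_diff \<mu> \<nu> a) + measure \<mu> {a<..})"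
      by (rule arg_cong)
    then have "ennreal (max 0 (- F_diff \<mu> \<nu> a)) + emeasure \<nu> {a<..} = ennreal (max 0 (F_diff \<mu> \<nu> a)) + emeasure \<mu> {a<..}"
      unfolding \<mu>.emeasure_eq_measure \<nu>.emeasure_eq_measure
      by (subst (asm) ennreal_plus, simp, simp, subst (asm) ennreal_plus) simp_all
    then show "emeasure (add_measure \<mu>' \<nu>) {a<..} = emeasure (add_measure \<nu>' \<mu>) {a<..}"
      using s' sets by (simp add: emeasure_add_measure m1 m2 add.assoc)
    show "emeasure (add_measure \<mu>' \<nu>) {a<..} < \<infinity>"
      using s' sets by (simp add: emeasure_add_measure \<mu>'.emeasure_eq_measure \<nu>.emeasure_eq_measure)
  qed (simp_all add: s')
  then have sum: "measure \<mu>' A + measure \<nu> A = measure \<nu>' A + measure \<mu> A" if "A \<in> sets borel" for A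
  proof -
    have "emeasure \<mu>' A + emeasure \<nu> A = emeasure \<nu>' A + emeasure \<mu> A"
      using \<open>add_measure \<mu>' \<nu> = add_measure \<nu>' \<mu>\<close> emeasure_add_measure[of \<mu>' \<nu> A] emeasure_add_measure[of \<nu>' \<mu> A] that s' sets by simp
    then show ?thesis
      by (simp add: \<mu>.emeasure_eq_measure \<nu>.emeasure_eq_measure \<mu>'.emeasure_eq_measure \<nu>'.emeasure_eq_measure
          ennreal_plus[symmetric] del: ennreal_plus)
  qed
  \<comment> \<open>on subsets of \<open>Y\<close> the measure \<open>\<nu>\<close> vanishes, so \<open>\<mu> = \<mu>' - \<nu>' \<le> \<mu>'\<close> there\<close>
  have ge\<mu>: "measure \<mu> A \<le> measure \<mu>' A" if A: "A \<in> sets borel" for A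
  proof -
    have "measure \<mu> A \<le> measure \<mu> ((A \<inter> Y) \<union> (- Y))" using A Y(1) by (intro \<mu>.finite_measure_mono) auto
    also have "\<dots> \<le> measure \<mu> (A \<inter> Y) + measure \<mu> (- Y)" using A Y(1) by (intro measure_Un_le) auto
    also have "measure \<mu> (- Y) = 0" using Y(2) by (simp add: measure_def)
    also have "measure \<mu> (A \<inter> Y) \<le> measure \<mu>' (A \<inter> Y)"
    proof -
      have "measure \<nu> (A \<inter> Y) \<le> measure \<nu> Y" using A Y(1) by (intro \<nu>.finite_measure_mono) auto
      also have "\<dots> = 0" using Y(3) by (simp add: measure_def)
      finally have "measure \<nu> (A \<inter> Y) \<le> 0" .
      moreover have "measure \<mu>' (A \<inter> Y) + measure \<nu> (A \<inter> Y) = measure \<nu>' (A \<inter> Y) + measure \<mu> (A \<inter> Y)"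
        using A Y(1) by (intro sum) simp
      ultimately show ?thesis using measure_nonneg[of \<nu>' "A \<inter> Y"] by linarith
    qed
    also have "measure \<mu>' (A \<inter> Y) \<le> measure \<mu>' A" using A s' by (intro \<mu>'.finite_measure_mono) auto
    finally show ?thesis by simp
  qed
  have ge\<nu>: "measure \<nu> A \<le> measure \<nu>' A" if A: "A \<in> sets borel" for A
    using sum[OF A] ge\<mu>[OF A] by simp
  have eq: "emeasure \<rho>' A = emeasure \<rho> A"
    if "real_distribution \<rho>" "finite_measure \<rho>'" "sets \<rho>' = sets borel" "emeasure \<rho>' UNIV \<le> 1"
      "\<And>A. A \<in> sets borel \<Longrightarrow> measure \<rho> A \<le> measure \<rho>' A" and A: "A \<in> sets borel" for \<rho> \<rho>' A
  proof -
    interpret \<rho>: real_distribution \<rho> by fact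
    interpret \<rho>': finite_measure \<rho>' by fact
    have sp': "space \<rho>' = UNIV" using sets_eq_imp_space_eq[OF that(3)] by simp
    have "measure \<rho>' A + measure \<rho>' (- A) = measure \<rho>' UNIV"
      using \<rho>'.finite_measure_compl[of A] A that(3) by (simp add: sp' Compl_eq_Diff_UNIV)
    moreover have "measure \<rho>' UNIV \<le> 1" using that(4) by (simp add: \<rho>'.emeasure_eq_measure)
    moreover have "measure \<rho> (- A) = 1 - measure \<rho> A"
      using \<rho>.prob_compl[of A] A by (simp add: Compl_eq_Diff_UNIV)
    ultimately have "measure \<rho>' A \<le> measure \<rho> A" using that(5)[of "- A"] A by simp
    then have "measure \<rho>' A = measure \<rho> A" using that(5)[OF A] by simp
    then show ?thesis by (simp add: \<rho>.emeasure_eq_measure \<rho>'.emeasure_eq_measure)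
  qed
  show ?thesis
  proof (rule MargI[OF s\<pi> sets prob(1)])
    fix A :: "real set" assume A: "A \<in> sets borel"
    show "emeasure ?\<pi> (A \<times> UNIV) = emeasure \<mu> A"
      using eq[OF \<mu>.real_distribution_axioms \<mu>'.finite_measure_axioms s'(1) mass(1) ge\<mu> A] \<mu>'[OF A] by simp
    show "emeasure ?\<pi> (UNIV \<times> A) = emeasure \<nu> A"
      using eq[OF \<nu>.real_distribution_axioms \<nu>'.finite_measure_axioms s'(2) mass(2) ge\<nu> A] \<nu>'[OF A] by simp
  qed
qed

lemma excursion_coupling_singular_maximal_flow:
  shows "maximal_flow (F_diff \<mu> \<nu>) (excursion_coupling_singular \<mu> \<nu>)" "maximal_flow (\<lambda>u. - F_diff \<mu> \<nu> u) (transpose_plan (excursion_coupling_singular \<mu> \<nu>))"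
proof -
  let ?\<pi> = "excursion_coupling_singular \<mu> \<nu>"
  have s\<pi>: "sets ?\<pi> = sets borel" by (rule sets_excursion_coupling_singular[OF prob sets])
  have sp: "space ?\<pi> = UNIV" using sets_eq_imp_space_eq[OF s\<pi>] by simp
  have "finite_measure ?\<pi>" using emeasure_coupling_le_1[OF prob sets] sp by (intro finite_measureI) (auto simp: top_unique)
  then interpret finite_measure ?\<pi> .
  have fwd: "emeasure ?\<pi> ({..a} \<times> {b<..}) = ennreal (flow ?\<pi> a b)" for a b
    by (simp add: flow_def emeasure_eq_measure)
  have bwd: "emeasure ?\<pi> ({b<..} \<times> {..a}) = ennreal (flow (transpose_plan ?\<pi>) a b)" for a b
    by (simp add: flow_transpose_plan[OF s\<pi>] emeasure_eq_measure)
  have nonneg: "0 \<le> flow \<rho> a b" for \<rho> a b by (simp add: flow_def)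
  have main: "h \<le> f" if "0 \<le> f" "\<And>u. a \<le> u \<Longrightarrow> u \<le> b \<Longrightarrow> h \<le> max 0 (G u)"
      "(\<And>u. a \<le> u \<Longrightarrow> u \<le> b \<Longrightarrow> h \<le> G u) \<Longrightarrow> ennreal h \<le> ennreal f" for h f a b :: real and G
  proof (cases "0 < h")
    case True
    then have "h \<le> G u" if "a \<le> u" "u \<le> b" for u using that \<open>\<And>u. a \<le> u \<Longrightarrow> u \<le> b \<Longrightarrow> h \<le> max 0 (G u)\<close>[of u] by (auto simp: max_def split: if_splits)
    then show ?thesis using that(1,3) by (simp add: ennreal_le_iff)
  qed (use that(1) in auto)
  show "maximal_flow (F_diff \<mu> \<nu>) ?\<pi>" unfolding maximal_flow_def
  proof (intro conjI allI impI)
    show "flow ?\<pi> u u \<le> max 0 (F_diff \<mu> \<nu> u)" for u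
      using emeasure_forward_le[OF prob sets, of u] unfolding fwd by (subst (asm) ennreal_le_iff) auto
    fix a b h assume ab: "a \<le> b" and h: "\<forall>u\<in>{a..b}. h \<le> max 0 (F_diff \<mu> \<nu> u)"
    show "h \<le> flow ?\<pi> a b"
      by (rule main[of _ a b _ "F_diff \<mu> \<nu>"])
        (use nonneg h emeasure_forward_ge[OF prob sets ab] fwd in auto)
  qed
  show "maximal_flow (\<lambda>u. - F_diff \<mu> \<nu> u) (transpose_plan ?\<pi>)" unfolding maximal_flow_def
  proof (intro conjI allI impI)
    show "flow (transpose_plan ?\<pi>) u u \<le> max 0 (- F_diff \<mu> \<nu> u)" for u
      using emeasure_backward_le[of u] unfolding bwd by (subst (asm) ennreal_le_iff) auto
    fix a b h assume ab: "a \<le> b" and h: "\<forall>u\<in>{a..b}. h \<le> max 0 (- F_diff \<mu> \<nu> u)"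
    show "h \<le> flow (transpose_plan ?\<pi>) a b"
      by (rule main[of _ a b _ "\<lambda>u. - F_diff \<mu> \<nu> u"])
        (use nonneg h emeasure_backward_ge[OF ab] bwd in auto)
  qed
qed

end

section \<open>The coupling in general\<close>

text \<open>
  With a Hahn set \<open>Y\<close> for \<open>\<mu> - \<nu>\<close>, the measure \<open>A \<mapsto> \<nu>(A \<inter> Y) + \<mu>(A - Y)\<close> is a lower bound of \<open>\<mu>\<close>
  and \<open>\<nu>\<close>, and every lower bound is below it.
\<close>

lemma emeasure_inf_eq_Hahn:
  fixes \<mu> \<nu> :: "real measure"
  assumes prob: "prob_space \<mu>" "prob_space \<nu>" and sets: "sets \<mu> = sets borel" "sets \<nu> = sets borel"
  shows "sets (inf \<mu> \<nu>) = sets borel"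
    and "\<exists>Y\<in>sets borel. \<forall>A\<in>sets borel. emeasure (inf \<mu> \<nu>) A = emeasure \<nu> (A \<inter> Y) + emeasure \<mu> (A - Y)"
proof -
  interpret \<mu>: real_distribution \<mu> by (rule real_distributionI[OF prob(1) sets(1)])
  interpret \<nu>: real_distribution \<nu> by (rule real_distributionI[OF prob(2) sets(2)])
  let ?\<eta> = "inf \<mu> \<nu>"
  obtain Y where Y: "Y \<in> sets borel" "\<And>X. X \<in> sets borel \<Longrightarrow> X \<subseteq> Y \<Longrightarrow> emeasure \<nu> X \<le> emeasure \<mu> X"
    "\<And>X. X \<in> sets borel \<Longrightarrow> X \<inter> Y = {} \<Longrightarrow> emeasure \<mu> X \<le> emeasure \<nu> X"
    using finite_unsigned_Hahn_decomposition[OF \<mu>.finite_measure_axioms \<nu>.finite_measure_axioms] sets by auto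
  define \<kappa> where "\<kappa> = add_measure (density \<nu> (indicator Y)) (density \<mu> (indicator (- Y)))"
  have s\<kappa>: "sets \<kappa> = sets borel" by (simp add: \<kappa>_def sets)
  have \<kappa>: "emeasure \<kappa> A = emeasure \<nu> (A \<inter> Y) + emeasure \<mu> (A - Y)" if A: "A \<in> sets borel" for A
  proof -
    have "emeasure (density \<nu> (indicator Y)) A = emeasure \<nu> (A \<inter> Y)"
      using A Y(1) by (simp add: emeasure_density sets indicator_inter_arith[symmetric] Int_commute)
    moreover have "emeasure (density \<mu> (indicator (- Y))) A = emeasure \<mu> (A - Y)"
      using A Y(1) by (simp add: emeasure_density sets indicator_inter_arith[symmetric] Int_commute Diff_eq)
    ultimately show ?thesis unfolding \<kappa>_def using A by (subst emeasure_add_measure) (simp_all add: sets)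
  qed
  have split: "emeasure \<rho> A = emeasure \<rho> (A \<inter> Y) + emeasure \<rho> (A - Y)" if "sets \<rho> = sets borel" "A \<in> sets borel" for \<rho> A
  proof -
    have "emeasure \<rho> ((A \<inter> Y) \<union> (A - Y)) = emeasure \<rho> (A \<inter> Y) + emeasure \<rho> (A - Y)"
      using that Y(1) by (intro plus_emeasure[symmetric]) auto
    then show ?thesis by (simp add: Int_Diff_Un)
  qed
  have "\<kappa> \<le> \<mu>" unfolding le_measure[OF s\<kappa>[folded sets(1)]]
  proof
    fix A assume "A \<in> sets \<kappa>"
    then have A: "A \<in> sets borel" by (simp add: s\<kappa>)
    show "emeasure \<kappa> A \<le> emeasure \<mu> A"
      unfolding \<kappa>[OF A] split[OF sets(1) A]
      by (intro add_mono order_refl Y(2)) (use A Y(1) in auto)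
  qed
  moreover have "\<kappa> \<le> \<nu>" unfolding le_measure[OF s\<kappa>[folded sets(2)]]
  proof
    fix A assume "A \<in> sets \<kappa>"
    then have A: "A \<in> sets borel" by (simp add: s\<kappa>)
    show "emeasure \<kappa> A \<le> emeasure \<nu> A"
      unfolding \<kappa>[OF A] split[OF sets(2) A]
      by (intro add_mono order_refl Y(3)) (use A Y(1) in auto)
  qed
  ultimately have \<kappa>\<eta>: "\<kappa> \<le> ?\<eta>" by (rule inf_greatest)
  have \<eta>\<mu>: "?\<eta> \<le> \<mu>" and \<eta>\<nu>: "?\<eta> \<le> \<nu>" by simp_all
  have s\<eta>: "sets ?\<eta> = sets borel"
    using sets_eq_iff_bounded[OF \<kappa>\<eta> \<eta>\<mu>] s\<kappa> sets by simp
  have sp\<eta>: "space ?\<eta> = UNIV" using sets_eq_imp_space_eq[OF s\<eta>] by simp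
  have le\<mu>: "emeasure ?\<eta> A \<le> emeasure \<mu> A" for A by (rule le_measureD3[OF \<eta>\<mu>]) (simp add: s\<eta> sets)
  have le\<nu>: "emeasure ?\<eta> A \<le> emeasure \<nu> A" for A by (rule le_measureD3[OF \<eta>\<nu>]) (simp add: s\<eta> sets)
  have \<eta>: "emeasure ?\<eta> A = emeasure \<nu> (A \<inter> Y) + emeasure \<mu> (A - Y)" if A: "A \<in> sets borel" for A
  proof (rule antisym)
    show "emeasure ?\<eta> A \<le> emeasure \<nu> (A \<inter> Y) + emeasure \<mu> (A - Y)"
      unfolding split[OF s\<eta> A] by (intro add_mono le\<mu> le\<nu>)
    show "emeasure \<nu> (A \<inter> Y) + emeasure \<mu> (A - Y) \<le> emeasure ?\<eta> A"
      unfolding \<kappa>[OF A, symmetric] by (rule le_measureD3[OF \<kappa>\<eta>]) (simp add: s\<kappa> s\<eta>)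
  qed
  show "sets ?\<eta> = sets borel" by (rule s\<eta>)
  show "\<exists>Y\<in>sets borel. \<forall>A\<in>sets borel. emeasure ?\<eta> A = emeasure \<nu> (A \<inter> Y) + emeasure \<mu> (A - Y)"
    using \<eta> Y(1) by blast
qed

text \<open>
  The diagonal part has no flow over any interval, and the rest is a multiple of a coupling of
  mutually singular probability measures. Since \<open>F\<close> scales by the same factor, maximality
  carries over.
\<close>

lemma excursion_coupling_Marg_maximal:
  fixes \<mu> \<nu> :: "real measure"
  assumes prob: "prob_space \<mu>" "prob_space \<nu>" and sets: "sets \<mu> = sets borel" "sets \<nu> = sets borel"
  shows "excursion_coupling \<mu> \<nu> \<in> Marg \<mu> \<nu>"
    and "maximal_flow (F_diff \<mu> \<nu>) (excursion_coupling \<mu> \<nu>)"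
    and "maximal_flow (\<lambda>u. - F_diff \<mu> \<nu> u) (transpose_plan (excursion_coupling \<mu> \<nu>))"
proof -
  interpret \<mu>: real_distribution \<mu> by (rule real_distributionI[OF prob(1) sets(1)])
  interpret \<nu>: real_distribution \<nu> by (rule real_distributionI[OF prob(2) sets(2)])
  define \<eta> where "\<eta> = inf \<mu> \<nu>"
  define \<mu>0 where "\<mu>0 = diff_measure \<mu> \<eta>"
  define \<nu>0 where "\<nu>0 = diff_measure \<nu> \<eta>"
  define m where "m = emeasure \<mu>0 UNIV"
  define diag where "diag = distr \<eta> borel (\<lambda>x. (x, x))"
  have s\<eta>: "sets \<eta> = sets borel" unfolding \<eta>_def by (rule emeasure_inf_eq_Hahn(1)[OF prob sets])
  have sp\<eta>: "space \<eta> = UNIV" using sets_eq_imp_space_eq[OF s\<eta>] by simp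
  obtain Y where Y: "Y \<in> sets borel"
    and \<eta>: "\<And>A. A \<in> sets borel \<Longrightarrow> emeasure \<eta> A = emeasure \<nu> (A \<inter> Y) + emeasure \<mu> (A - Y)"
    using emeasure_inf_eq_Hahn(2)[OF prob sets] unfolding \<eta>_def by blast
  have le\<mu>: "emeasure \<eta> A \<le> emeasure \<mu> A" for A
    by (rule le_measureD3) (simp_all add: \<eta>_def s\<eta>[unfolded \<eta>_def] sets)
  have le\<nu>: "emeasure \<eta> A \<le> emeasure \<nu> A" for A
    by (rule le_measureD3) (simp_all add: \<eta>_def s\<eta>[unfolded \<eta>_def] sets)
  have fin\<eta>: "finite_measure \<eta>"
    using le\<mu>[of UNIV] \<mu>.emeasure_space_1 sp\<eta> by (intro finite_measureI) (auto simp: top_unique)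
  then interpret \<eta>: finite_measure \<eta> .
  have s0: "sets \<mu>0 = sets borel" "sets \<nu>0 = sets borel" by (simp_all add: \<mu>0_def \<nu>0_def sets)
  have \<mu>0: "emeasure \<mu>0 A + emeasure \<eta> A = emeasure \<mu> A" if A: "A \<in> sets borel" for A
  proof -
    have "emeasure \<mu>0 A = emeasure \<mu> A - emeasure \<eta> A"
      unfolding \<mu>0_def using A le\<mu>
      by (intro emeasure_diff_measure \<mu>.finite_measure_axioms fin\<eta>) (auto simp: sets s\<eta>)
    then show ?thesis using le\<mu>[of A] by (simp add: diff_add_cancel_ennreal)
  qed
  have \<nu>0: "emeasure \<nu>0 A + emeasure \<eta> A = emeasure \<nu> A" if A: "A \<in> sets borel" for A
  proof -
    have "emeasure \<nu>0 A = emeasure \<nu> A - emeasure \<eta> A"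
      unfolding \<nu>0_def using A le\<nu>
      by (intro emeasure_diff_measure \<nu>.finite_measure_axioms fin\<eta>) (auto simp: sets s\<eta>)
    then show ?thesis using le\<nu>[of A] by (simp add: diff_add_cancel_ennreal)
  qed
  have cancel: "a = b" if "a + emeasure \<eta> A = b + emeasure \<eta> A" for a b A
    using that \<eta>.emeasure_finite[of A] by (auto simp: add.commute[of _ "emeasure \<eta> A"] ennreal_add_left_cancel)
  have total: "emeasure \<mu> UNIV = 1" "emeasure \<nu> UNIV = 1"
    using \<mu>.emeasure_space_1 \<nu>.emeasure_space_1 by simp_all
  have m\<nu>: "emeasure \<nu>0 UNIV = m"
    by (rule cancel[of _ UNIV]) (simp add: m_def \<mu>0 \<nu>0 total)
  have m_le: "m \<le> 1" using \<mu>0[of UNIV] total by (simp add: m_def) (metis le_iff_add)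
  have singular: "emeasure \<mu>0 (- Y) = 0" "emeasure \<nu>0 Y = 0"
  proof -
    show "emeasure \<mu>0 (- Y) = 0"
      by (rule cancel[of _ "- Y"]) (use \<mu>0[of "- Y"] \<eta>[of "- Y"] Y in \<open>simp add: Diff_eq\<close>)
    show "emeasure \<nu>0 Y = 0"
      by (rule cancel[of _ Y]) (use \<nu>0[of Y] \<eta>[of Y] Y in simp)
  qed
  have diag: "emeasure diag (A \<times> B) = emeasure \<eta> (A \<inter> B)" if "A \<in> sets borel" "B \<in> sets borel" for A B
  proof -
    have "(\<lambda>x :: real. (x, x)) \<in> borel \<rightarrow>\<^sub>M (borel :: (real \<times> real) measure)"
      unfolding borel_prod[symmetric] by measurable
    then have "(\<lambda>x. (x, x)) \<in> \<eta> \<rightarrow>\<^sub>M (borel :: (real \<times> real) measure)"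
      by (simp add: measurable_cong_sets[OF s\<eta> refl])
    then have "emeasure diag (A \<times> B) = emeasure \<eta> ((\<lambda>x. (x, x)) -` (A \<times> B) \<inter> space \<eta>)"
      unfolding diag_def using that by (intro emeasure_distr) simp_all
    also have "(\<lambda>x. (x, x)) -` (A \<times> B) \<inter> space \<eta> = A \<inter> B" by (auto simp: sp\<eta>)
    finally show ?thesis .
  qed
  have sdiag: "sets diag = sets borel" by (simp add: diag_def)
  let ?\<pi> = "excursion_coupling \<mu> \<nu>"
  have def: "?\<pi> = (if m = 0 then diag else add_measure diag (scale_measure m
      (excursion_coupling_singular (scale_measure (1 / m) \<mu>0) (scale_measure (1 / m) \<nu>0))))"
    unfolding excursion_coupling_def Let_def diag_def m_def \<mu>0_def \<nu>0_def \<eta>_def ..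
  have "?\<pi> \<in> Marg \<mu> \<nu> \<and> maximal_flow (F_diff \<mu> \<nu>) ?\<pi> \<and> maximal_flow (\<lambda>u. - F_diff \<mu> \<nu> u) (transpose_plan ?\<pi>)"
  proof (cases "m = 0")
    case True
    have z: "emeasure \<mu>0 A = 0" "emeasure \<nu>0 A = 0" if "A \<in> sets borel" for A
      using emeasure_mono[of A UNIV \<mu>0] emeasure_mono[of A UNIV \<nu>0] True m\<nu> s0 by (simp_all add: m_def)
    have eq: "emeasure \<mu> A = emeasure \<eta> A" "emeasure \<nu> A = emeasure \<eta> A" if "A \<in> sets borel" for A
      using \<mu>0[OF that] \<nu>0[OF that] z[OF that] by simp_all
    have \<pi>: "?\<pi> = diag" using True by (simp add: def)
    have "\<mu> = \<nu>" by (rule measure_eqI) (use sets eq in auto)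
    then have F: "F_diff \<mu> \<nu> u = 0" for u by (simp add: F_diff_def)
    have flow0: "flow diag a b = 0" "flow (transpose_plan diag) a b = 0" if "a \<le> b" for a b
    proof -
      have "{..a} \<inter> {b<..} = {}" "{b<..} \<inter> {..a} = {}" using that by auto
      then show "flow diag a b = 0" "flow (transpose_plan diag) a b = 0"
        unfolding flow_transpose_plan[OF sdiag] unfolding flow_def measure_def by (simp_all add: diag)
    qed
    have "diag \<in> Marg \<mu> \<nu>"
      by (rule MargI[OF sdiag sets prob(1)]) (simp_all add: diag eq)
    then show ?thesis unfolding \<pi> maximal_flow_def using flow0 by (auto simp: F)
  next
    case False
    define \<mu>1 where "\<mu>1 = scale_measure (1 / m) \<mu>0"
    define \<nu>1 where "\<nu>1 = scale_measure (1 / m) \<nu>0"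
    have m: "m \<noteq> 0" "m \<noteq> \<top>" using False m_le by (auto simp: top_unique)
    define r where "r = enn2real m"
    have m': "m < \<top>" using m(2) unfolding less_top .
    have r: "ennreal r = m" "0 < r"
      unfolding r_def using m' m(1) by (simp_all add: enn2real_positive_iff zero_less_iff_neq_zero)
    have m_inv: "m * (1 / m) = 1"
      unfolding ennreal_times_divide mult_1_right using m(1) m' by (rule ennreal_divide_self)
    have inv: "m * (1 / m * x) = x" for x by (simp only: mult.assoc[symmetric] m_inv mult_1)
    have s1: "sets \<mu>1 = sets borel" "sets \<nu>1 = sets borel" by (simp_all add: \<mu>1_def \<nu>1_def s0)
    have p1: "prob_space \<mu>1" "prob_space \<nu>1"
    proof -
      have "emeasure \<mu>1 UNIV = 1" "emeasure \<nu>1 UNIV = 1"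
        unfolding \<mu>1_def \<nu>1_def emeasure_scale_measure m\<nu> m_def[symmetric]
        using m_inv by (simp_all only: mult.commute[of "1 / m" m])
      then show "prob_space \<mu>1" "prob_space \<nu>1"
        using sets_eq_imp_space_eq[OF s1(1)] sets_eq_imp_space_eq[OF s1(2)]
        by (auto intro!: prob_spaceI)
    qed
    define \<pi>1 where "\<pi>1 = excursion_coupling_singular \<mu>1 \<nu>1"
    have \<pi>1: "\<pi>1 \<in> Marg \<mu>1 \<nu>1"
      unfolding \<pi>1_def
      by (rule excursion_coupling_singular_marginals[OF p1 s1 Y]) (simp_all add: \<mu>1_def \<nu>1_def singular)
    note mf = excursion_coupling_singular_maximal_flow[OF p1 s1, folded \<pi>1_def]
    interpret \<pi>1: prob_space \<pi>1 by (rule Marg_prob_space[OF \<pi>1])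
    have s\<pi>1: "sets \<pi>1 = sets borel" by (rule Marg_sets[OF \<pi>1])
    have \<pi>: "?\<pi> = add_measure diag (scale_measure m \<pi>1)" using False by (simp add: def \<pi>1_def \<mu>1_def \<nu>1_def)
    have s\<pi>: "sets ?\<pi> = sets borel" by (simp add: \<pi> sdiag)
    have em: "emeasure ?\<pi> (A \<times> B) = emeasure \<eta> (A \<inter> B) + m * emeasure \<pi>1 (A \<times> B)" if "A \<in> sets borel" "B \<in> sets borel" for A B
      unfolding \<pi> using that by (subst emeasure_add_measure) (simp_all add: sdiag s\<pi>1 diag)
    have M: "?\<pi> \<in> Marg \<mu> \<nu>"
    proof (rule MargI[OF s\<pi> sets prob(1)])
      fix A :: "real set" assume A: "A \<in> sets borel"
      show "emeasure ?\<pi> (A \<times> UNIV) = emeasure \<mu> A"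
        using \<mu>0[OF A] by (simp add: em A Marg_emeasure_fst[OF \<pi>1 A] \<mu>1_def inv add.commute)
      show "emeasure ?\<pi> (UNIV \<times> A) = emeasure \<nu> A"
        using \<nu>0[OF A] by (simp add: em A Marg_emeasure_snd[OF \<pi>1 A] \<nu>1_def inv add.commute)
    qed
    have me: "measure ?\<pi> (A \<times> B) = r * measure \<pi>1 (A \<times> B)" if "A \<in> sets borel" "B \<in> sets borel" "A \<inter> B = {}" for A B
      unfolding measure_def using em[OF that(1,2)] that(3) r by (simp add: enn2real_mult r_def)
    have fl: "flow ?\<pi> a b = r * flow \<pi>1 a b" "flow (transpose_plan ?\<pi>) a b = r * flow (transpose_plan \<pi>1) a b" if "a \<le> b" for a b
    proof -
      have "{..a} \<inter> {b<..} = {}" "{b<..} \<inter> {..a} = {}" using that by auto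
      then show "flow ?\<pi> a b = r * flow \<pi>1 a b" "flow (transpose_plan ?\<pi>) a b = r * flow (transpose_plan \<pi>1) a b"
        unfolding flow_transpose_plan[OF s\<pi>] flow_transpose_plan[OF s\<pi>1] unfolding flow_def by (simp_all add: me)
    qed
    have Fr: "F_diff \<mu> \<nu> u = r * F_diff \<mu>1 \<nu>1 u" for u
      using flow_minus_flow_transpose[OF M, of u] flow_minus_flow_transpose[OF \<pi>1, of u] fl[of u u]
      by (simp add: right_diff_distrib[symmetric])
    have scale: "maximal_flow (\<lambda>u. r * G u) \<rho>"
      if "maximal_flow G \<rho>1" "\<And>a b. a \<le> b \<Longrightarrow> flow \<rho> a b = r * flow \<rho>1 a b" for G \<rho> \<rho>1
    proof -
      have mx: "max 0 (r * x) = r * max 0 x" for x using r(2) by (simp add: max_def zero_le_mult_iff)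
      show ?thesis
        unfolding maximal_flow_def mx
      proof (intro conjI allI impI)
        show "flow \<rho> u u \<le> r * max 0 (G u)" for u
          using that(1) r(2) by (simp add: that(2) maximal_flow_def mult_left_mono)
        fix a b h assume ab: "a \<le> b" and h: "\<forall>u\<in>{a..b}. h \<le> r * max 0 (G u)"
        then have "\<forall>u\<in>{a..b}. h / r \<le> max 0 (G u)" using r(2) by (simp add: divide_le_eq mult.commute)
        then have "h / r \<le> flow \<rho>1 a b" using that(1) ab unfolding maximal_flow_def by blast
        then show "h \<le> flow \<rho> a b" using r(2) by (simp add: that(2)[OF ab] divide_le_eq mult.commute)
      qed
    qed
    have "F_diff \<mu> \<nu> = (\<lambda>u. r * F_diff \<mu>1 \<nu>1 u)" "(\<lambda>u. - F_diff \<mu> \<nu> u) = (\<lambda>u. r * (- F_diff \<mu>1 \<nu>1 u))"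
      using Fr by (simp_all add: fun_eq_iff)
    then show ?thesis
      using M scale[OF mf(1) fl(1)] scale[OF mf(2) fl(2)] by (simp only:)
  qed
  then show "?\<pi> \<in> Marg \<mu> \<nu>" "maximal_flow (F_diff \<mu> \<nu>) ?\<pi>" "maximal_flow (\<lambda>u. - F_diff \<mu> \<nu> u) (transpose_plan ?\<pi>)"
    by auto
qed

theorem corollary0p2:
  fixes \<mu> \<nu> :: "real measure"
  assumes "\<mu> \<in> P1" and "\<nu> \<in> P1"
  shows "excursion_coupling \<mu> \<nu> \<in> Marg \<mu> \<nu>
    \<and> (\<forall>(\<pi>_seq :: nat \<Rightarrow> (real \<times> real) measure) (p :: nat \<Rightarrow> real).
          (\<forall>n. 0 < p n \<and> p n < 1) \<and> p \<longlonglongrightarrow> 1 \<and> (\<forall>n. \<pi>_seq n \<in> Marg_opt (p n) \<mu> \<nu>)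
          \<longrightarrow> weakly_converges \<pi>_seq (excursion_coupling \<mu> \<nu>))
    \<and> (\<forall>q' :: real. 0 < q' \<and> q' < 1 \<longrightarrow>
          excursion_coupling \<mu> \<nu> \<in> Marg_opt 1 \<mu> \<nu>
          \<and> (\<forall>\<gamma> \<in> Marg_opt 1 \<mu> \<nu>. T_cost q' (excursion_coupling \<mu> \<nu>) \<le> T_cost q' \<gamma>))"
proof -
  note exc = excursion_coupling_Marg_maximal[OF P1_prob_space[OF assms(1)] P1_prob_space[OF assms(2)]
      P1_sets[OF assms(1)] P1_sets[OF assms(2)]]
  show ?thesis
  proof (intro conjI allI impI ballI)
    show "excursion_coupling \<mu> \<nu> \<in> Marg \<mu> \<nu>" by (rule exc)
    show "excursion_coupling \<mu> \<nu> \<in> Marg_opt 1 \<mu> \<nu>" by (rule maximal_flow_imp_optimal(1)[OF assms exc])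
  next
    fix \<pi>_seq :: "nat \<Rightarrow> (real \<times> real) measure" and p :: "nat \<Rightarrow> real"
    assume "(\<forall>n. 0 < p n \<and> p n < 1) \<and> p \<longlonglongrightarrow> 1 \<and> (\<forall>n. \<pi>_seq n \<in> Marg_opt (p n) \<mu> \<nu>)"
    then show "weakly_converges \<pi>_seq (excursion_coupling \<mu> \<nu>)"
      by (intro maximal_flow_imp_weak_limit[OF assms exc, of p]) auto
  next
    fix q' :: real and \<gamma> assume "0 < q' \<and> q' < 1" "\<gamma> \<in> Marg_opt 1 \<mu> \<nu>"
    then show "T_cost q' (excursion_coupling \<mu> \<nu>) \<le> T_cost q' \<gamma>"
      by (intro maximal_flow_imp_optimal(2)[OF assms exc]) auto
  qed
qed

end
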